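(* Let $M$ be a connected $C^\infty$ manifold of dimension $d+2$, $\mathcal F\subset T^{\mathbb R}M$ an integrable $C^\infty$ subbundle of rank $d$, and $\widehat{\mathcal F}$ a transversely complex structure on $\mathcal F$. Assume that $(M,\widehat{\mathcal F})$ admits a transversely projective structure compatible with $\widehat{\mathcal F}$. Then the space of all transversely projective structures compatible with $\widehat{\mathcal F}$ is an affine space for the complex vector space $H^0_{\mathcal F}(M,\mathbb K^{\otimes2})$ of transversely holomorphic sections of $\mathbb K^{\otimes2}$, where $\mathbb K=(N^{1,0})^*$.
   Context: **Transverse structures.** A transversely complex structure on $\mathcal F$ is an equivalence class of data $\{(U_i,\sigma_i)\}_{i\in I}$ where: (1) the $U_i$ are open in $M$ and cover $M$; (2) each $\sigma_i$ is a $C^\infty$ submersion of $U_i$ onto an open subset $D_i\subset\mathbb{CP}^1$ with $\ker(d\sigma_i)=\mathcal F|_{U_i}$; (3) for all $i,j$ and every connected component $U^c_{i,j}$ of $U_i\cap U_j$ there is a holomorphic map $f^c_{i,j}:\sigma_i(U^c_{i,j})\to\sigma_j(U^c_{i,j})$ with $f^c_{i,j}\circ\sigma_i=\sigma_j$ on $U^c_{i,j}$. Two data are equivalent if their union again satisfies (1)–(3). A transversely projective structure (also called transversely complex projective structure) is defined the same way, requiring in addition that each $f^c_{i,j}$ be the restriction of a Möbius transformation $z\mapsto(az+b)/(cz+d)$, $ad-bc=1$ (equivalence of data: the union satisfies this too). It is compatible with $\widehat{\mathcal F}$ if the transversely complex structure it defines is $\widehat{\mathcal F}$. **The bundle $\mathbb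 K$.** Let $N=T^{\mathbb R}M/\mathcal F$, with complex structure $J$ obtained by pulling back that of $D_i$ via $N|_{U_i}\cong\sigma_i^*T^{\mathbb R}D_i$; $N^{1,0}\subset N\otimes\mathbb C$ is the $\sqrt{-1}$-eigenbundle of $J$, a transversely holomorphic line bundle equal to $\sigma_i^*T^{1,0}D_i$ over $U_i$. A section of $\mathbb K^{\otimes2}$ is transversely holomorphic if it is locally of the form $\sigma^*\theta$ with $\sigma$ a chart of $\widehat{\mathcal F}$ and $\theta$ a holomorphic section of $K^{\otimes2}$ over the image of the chart (a holomorphic quadratic differential). **Affine structure.** "Affine space for a vector space" means a nonempty set with a free and transitive action of the vector space. The action here is the one obtained locally, by pullback through charts $\sigma$ of $\widehat{\mathcal F}$, from the classical action of $H^0(X,K_X^{\otimes2})$ on the projective structures on a Riemann surface $X$ compatible with its complex structure; up to a universal nonzero constant factor, the difference of two such structures with local charts $w$ and $w'$ is the quadratic differential $\{w',w\}\,(dw)^{2}$, where $\{w',w\}=(w'''/w')-\tfrac32(w''/w')^2$ denotes the Schwarzian derivative of $w'$ as a function of $w$ (on the right-hand side primes are derivatives with respect to $w$ of that function). *)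

theory Defs
  imports "HOL-Analysis.Analysis" "HOL-Library.Function_Algebras"
begin

section \<open>Smooth manifolds\<close>

primrec C_k_on :: "nat \<Rightarrow> ('a::euclidean_space \<Rightarrow> 'b::euclidean_space) \<Rightarrow> 'a set \<Rightarrow> bool" where
  "C_k_on 0 g S \<longleftrightarrow> continuous_on S g"
| "C_k_on (Suc k) g S \<longleftrightarrow> (\<forall>x\<in>S. g differentiable (at x)) \<and>
     (\<forall>v. C_k_on k (\<lambda>x. frechet_derivative g (at x) v) S)"

text \<open>Only used for open \<open>S\<close>.\<close>

definition smooth_on :: "('a::euclidean_space \<Rightarrow> 'b::euclidean_space) \<Rightarrow> 'a set \<Rightarrow> bool" where
  "smooth_on g S \<longleftrightarrow> (\<forall>k. C_k_on k g S)"

text \<open>A chart is a pair of a domain and a coordinate map; the values of the map outside the domain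
  are irrelevant. The manifold is the whole type \<open>'m\<close>, its dimension is \<open>DIM('e)\<close>, and its
  smooth structure is the one generated by the given atlas.\<close>

type_synonym ('m, 'e) chart = "'m set \<times> ('m \<Rightarrow> 'e)"

definition chart_inv :: "('m, 'e) chart \<Rightarrow> 'e \<Rightarrow> 'm" where
  "chart_inv c = inv_into (fst c) (snd c)"

definition smooth_atlas ::
    "('m::topological_space, 'e::euclidean_space) chart set \<Rightarrow> bool" where
  "smooth_atlas A \<longleftrightarrow>
     (\<Union>c\<in>A. fst c) = UNIV \<and>
     (\<forall>c\<in>A. open (fst c) \<and> open (snd c ` fst c) \<and>
        homeomorphism (fst c) (snd c ` fst c) (snd c) (chart_inv c)) \<and>
     (\<forall>c\<in>A. \<forall>c'\<in>A. smooth_on (snd c' \<circ> chart_inv c) (snd c ` (fst c \<inter> fst c')))"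

definition smooth_map ::
    "('m::topological_space, 'e::euclidean_space) chart set \<Rightarrow>
     ('n::topological_space, 'f::euclidean_space) chart set \<Rightarrow> 'm set \<Rightarrow> ('m \<Rightarrow> 'n) \<Rightarrow> bool" where
  "smooth_map A B W g \<longleftrightarrow> continuous_on W g \<and>
     (\<forall>c\<in>A. \<forall>c'\<in>B. smooth_on (snd c' \<circ> g \<circ> chart_inv c)
        (snd c ` {p \<in> W \<inter> fst c. g p \<in> fst c'}))"

text \<open>The tangent space at \<open>p\<close> is the model space \<open>'e\<close>, a vector being given by its coordinates
  in the preferred chart \<open>chart_at A p\<close>.\<close>

definition chart_at :: "('m, 'e) chart set \<Rightarrow> 'm \<Rightarrow> ('m, 'e) chart" where
  "chart_at A p = (SOME c. c \<in> A \<and> p \<in> fst c)"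

text \<open>\<open>dfun A g p\<close> is the differential at \<open>p\<close> of a vector-valued function \<open>g\<close>. For a chart
  \<open>c\<close>, \<open>dfun A (snd c) p v\<close> gives the coordinates in \<open>c\<close> of the tangent vector \<open>v\<close>.\<close>

definition dfun ::
    "('m, 'e::real_normed_vector) chart set \<Rightarrow> ('m \<Rightarrow> 'f::real_normed_vector) \<Rightarrow> 'm \<Rightarrow> 'e \<Rightarrow> 'f" where
  "dfun A g p = frechet_derivative (g \<circ> chart_inv (chart_at A p)) (at (snd (chart_at A p) p))"

definition tangent_map ::
    "('m, 'e::real_normed_vector) chart set \<Rightarrow> ('n, 'f::real_normed_vector) chart set \<Rightarrow>
     ('m \<Rightarrow> 'n) \<Rightarrow> 'm \<Rightarrow> 'e \<Rightarrow> 'f" where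
  "tangent_map A B g p = dfun A (snd (chart_at B (g p)) \<circ> g) p"


section \<open>Integrable subbundles of the tangent bundle\<close>

definition field_in_chart ::
    "('m, 'e::euclidean_space) chart set \<Rightarrow> ('m, 'e) chart \<Rightarrow> ('m \<Rightarrow> 'e) \<Rightarrow> 'e \<Rightarrow> 'e" where
  "field_in_chart A c X = (\<lambda>x. dfun A (snd c) (chart_inv c x) (X (chart_inv c x)))"

definition smooth_field ::
    "('m, 'e::euclidean_space) chart set \<Rightarrow> 'm set \<Rightarrow> ('m \<Rightarrow> 'e) \<Rightarrow> bool" where
  "smooth_field A W X \<longleftrightarrow> (\<forall>c\<in>A. smooth_on (field_in_chart A c X) (snd c ` (W \<inter> fst c)))"

definition lie_bracket ::
    "('m, 'e::euclidean_space) chart set \<Rightarrow> ('m \<Rightarrow> 'e) \<Rightarrow> ('m \<Rightarrow> 'e) \<Rightarrow> 'm \<Rightarrow> 'e" where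
  "lie_bracket A X Y p =
     (let c = chart_at A p; x = snd c p; X' = field_in_chart A c X; Y' = field_in_chart A c Y
      in frechet_derivative Y' (at x) (X' x) - frechet_derivative X' (at x) (Y' x))"

definition smooth_subbundle ::
    "('m::topological_space, 'e::euclidean_space) chart set \<Rightarrow> nat \<Rightarrow> ('m \<Rightarrow> 'e set) \<Rightarrow> bool" where
  "smooth_subbundle A d F \<longleftrightarrow>
     (\<forall>p. subspace (F p) \<and> dim (F p) = d) \<and>
     (\<forall>p. \<exists>W X. open W \<and> p \<in> W \<and> (\<forall>i<d. smooth_field A W (X i)) \<and>
        (\<forall>q\<in>W. F q = span ((\<lambda>i. X i q) ` {..<d})))"

definition integrable_subbundle ::
    "('m::topological_space, 'e::euclidean_space) chart set \<Rightarrow> ('m \<Rightarrow> 'e set) \<Rightarrow> bool" where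
  "integrable_subbundle A F \<longleftrightarrow>
     (\<forall>W X Y. open W \<longrightarrow> smooth_field A W X \<longrightarrow> smooth_field A W Y \<longrightarrow>
        (\<forall>p\<in>W. X p \<in> F p \<and> Y p \<in> F p) \<longrightarrow> (\<forall>p\<in>W. lie_bracket A X Y p \<in> F p))"


section \<open>The complex projective line\<close>

text \<open>\<open>Cpt z\<close> is the point \<open>[z : 1]\<close> and \<open>Infty\<close> is \<open>[1 : 0]\<close>.\<close>

datatype cp1 = Cpt complex | Infty

text \<open>The parametrisation \<open>w \<mapsto> [1 : w]\<close> of the complement of \<open>[0 : 1]\<close>.\<close>

definition cp1_inf :: "complex \<Rightarrow> cp1" where
  "cp1_inf w = (if w = 0 then Infty else Cpt (1 / w))"

instantiation cp1 :: topological_space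
begin

definition open_cp1 :: "cp1 set \<Rightarrow> bool" where
  "open_cp1 U \<longleftrightarrow> open (Cpt -` U) \<and> open (cp1_inf -` U)"

instance
  by standard (auto simp: open_cp1_def vimage_Union)

end

definition cp1_atlas :: "(cp1, complex) chart set" where
  "cp1_atlas = {(- {Infty}, case_cp1 (\<lambda>z. z) 0), (- {Cpt 0}, case_cp1 (\<lambda>z. 1 / z) 0)}"

definition cp1_holomorphic_on :: "(cp1 \<Rightarrow> cp1) \<Rightarrow> cp1 set \<Rightarrow> bool" where
  "cp1_holomorphic_on f D \<longleftrightarrow> continuous_on D f \<and>
     (\<forall>c\<in>cp1_atlas. \<forall>c'\<in>cp1_atlas.
        (snd c' \<circ> f \<circ> chart_inv c) holomorphic_on (snd c ` {z \<in> D \<inter> fst c. f z \<in> fst c'}))"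

fun moebius :: "complex \<Rightarrow> complex \<Rightarrow> complex \<Rightarrow> complex \<Rightarrow> cp1 \<Rightarrow> cp1" where
  "moebius a b c d (Cpt z) = (if c * z + d = 0 then Infty else Cpt ((a * z + b) / (c * z + d)))"
| "moebius a b c d Infty = (if c = 0 then Infty else Cpt (a / c))"

definition cp1_moebius_on :: "(cp1 \<Rightarrow> cp1) \<Rightarrow> cp1 set \<Rightarrow> bool" where
  "cp1_moebius_on f D \<longleftrightarrow> cp1_holomorphic_on f D \<and>
     (\<exists>a b c d. a * d - b * c = 1 \<and> (\<forall>z\<in>D. f z = moebius a b c d z))"


section \<open>Transverse structures\<close>

type_synonym 'm tdata = "('m set \<times> ('m \<Rightarrow> cp1)) set"

text \<open>Both kinds of structure at once: \<open>G\<close> says which transition maps are allowed.\<close>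

definition transverse_data ::
    "(('m::topological_space), 'e::euclidean_space) chart set \<Rightarrow> ('m \<Rightarrow> 'e set) \<Rightarrow>
     ((cp1 \<Rightarrow> cp1) \<Rightarrow> cp1 set \<Rightarrow> bool) \<Rightarrow> 'm tdata \<Rightarrow> bool" where
  "transverse_data A F G D \<longleftrightarrow>
     (\<forall>(U, \<sigma>)\<in>D. open U) \<and> (\<Union>(U, \<sigma>)\<in>D. U) = UNIV \<and>
     (\<forall>(U, \<sigma>)\<in>D. smooth_map A cp1_atlas U \<sigma> \<and> open (\<sigma> ` U) \<and>
        (\<forall>p\<in>U. surj (tangent_map A cp1_atlas \<sigma> p) \<and>
                {v. tangent_map A cp1_atlas \<sigma> p v = 0} = F p)) \<and>
     (\<forall>(U, \<sigma>)\<in>D. \<forall>(V, \<tau>)\<in>D. \<forall>C\<in>components (U \<inter> V).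
        \<exists>f. G f (\<sigma> ` C) \<and> (\<forall>p\<in>C. f (\<sigma> p) = \<tau> p))"

text \<open>For holomorphic transition maps the relation "the union is again such a datum" is not
  transitive as it stands: with \<open>M = \<complex> - {0}\<close> and \<open>d = 0\<close>, both the single chart \<open>z\<close> and the
  single chart \<open>z\<^sup>2\<close> are related to the datum of all sufficiently small restrictions of \<open>z\<close>, but
  not to one another, as \<open>z\<close> is not globally a function of \<open>z\<^sup>2\<close>. Equivalence classes are
  therefore taken for the equivalence relation generated by it, whence the transitive closure. In the
  projective case the relation is already transitive, and the closure changes nothing.\<close>

definition transverse_equiv ::
    "(('m::topological_space), 'e::euclidean_space) chart set \<Rightarrow> ('m \<Rightarrow> 'e set) \<Rightarrow>
     ((cp1 \<Rightarrow> cp1) \<Rightarrow> cp1 set \<Rightarrow> bool) \<Rightarrow> ('m tdata \<times> 'm tdata) set" where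
  "transverse_equiv A F G =
     {(D, D'). transverse_data A F G D \<and> transverse_data A F G D' \<and>
               transverse_data A F G (D \<union> D')}\<^sup>+"

definition transverse_structures ::
    "(('m::topological_space), 'e::euclidean_space) chart set \<Rightarrow> ('m \<Rightarrow> 'e set) \<Rightarrow>
     ((cp1 \<Rightarrow> cp1) \<Rightarrow> cp1 set \<Rightarrow> bool) \<Rightarrow> 'm tdata set set" where
  "transverse_structures A F G = Collect (transverse_data A F G) // transverse_equiv A F G"

abbreviation "complex_structures A F \<equiv> transverse_structures A F cp1_holomorphic_on"
abbreviation "projective_structures A F \<equiv> transverse_structures A F cp1_moebius_on"

text \<open>The transversely complex structure defined by a transversely projective structure \<open>P\<close> is the
  image of \<open>P\<close> under equivalence of transversely complex data.\<close>

definition compatible_structures ::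
    "(('m::topological_space), 'e::euclidean_space) chart set \<Rightarrow> ('m \<Rightarrow> 'e set) \<Rightarrow>
     'm tdata set \<Rightarrow> 'm tdata set set" where
  "compatible_structures A F T =
     {P \<in> projective_structures A F. transverse_equiv A F cp1_holomorphic_on `` P = T}"


section \<open>The normal bundle and its \<open>(1,0)\<close> part\<close>

text \<open>Elements of the fibre \<open>N\<^sub>p = T\<^sub>pM / F\<^sub>p\<close> are cosets.\<close>

definition normal_space :: "('m \<Rightarrow> 'e::real_vector set) \<Rightarrow> 'm \<Rightarrow> 'e set set" where
  "normal_space F p = UNIV // {(u, v). u - v \<in> F p}"

definition nadd :: "'e::real_vector set \<Rightarrow> 'e set \<Rightarrow> 'e set" where
  "nadd m n = {u + v | u v. u \<in> m \<and> v \<in> n}"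

definition nscale :: "('m \<Rightarrow> 'e::real_vector set) \<Rightarrow> 'm \<Rightarrow> real \<Rightarrow> 'e set \<Rightarrow> 'e set" where
  "nscale F p r n = {r *\<^sub>R u + f | u f. u \<in> n \<and> f \<in> F p}"

text \<open>The map on cosets induced by a map which is constant on each of them.\<close>

definition descend :: "('e \<Rightarrow> 'b) \<Rightarrow> 'e set \<Rightarrow> 'b" where
  "descend g n = the_elem (g ` n)"

definition normal_J ::
    "('m, 'e::euclidean_space) chart set \<Rightarrow> ('m \<Rightarrow> 'e set) \<Rightarrow> 'm tdata set \<Rightarrow> 'm \<Rightarrow> 'e set \<Rightarrow> 'e set" where
  "normal_J A F T p n =
     (let d\<sigma> = descend (tangent_map A cp1_atlas (snd (SOME s. s \<in> \<Union>T \<and> p \<in> fst s)) p)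
      in THE m. m \<in> normal_space F p \<and> d\<sigma> m = \<i> * d\<sigma> n)"

text \<open>The complexification of a real vector space \<open>V\<close> is \<open>V \<times> V\<close>, where \<open>(u, v)\<close> stands for
  \<open>u + \<i>v\<close>.\<close>

definition ncadd :: "'e::real_vector set \<times> 'e set \<Rightarrow> 'e set \<times> 'e set \<Rightarrow> 'e set \<times> 'e set" where
  "ncadd m n = (nadd (fst m) (fst n), nadd (snd m) (snd n))"

definition ncscale ::
    "('m \<Rightarrow> 'e::real_vector set) \<Rightarrow> 'm \<Rightarrow> complex \<Rightarrow> 'e set \<times> 'e set \<Rightarrow> 'e set \<times> 'e set" where
  "ncscale F p c m =
     (nadd (nscale F p (Re c) (fst m)) (nscale F p (- Im c) (snd m)),
      nadd (nscale F p (Im c) (fst m)) (nscale F p (Re c) (snd m)))"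

definition normal10 ::
    "('m, 'e::euclidean_space) chart set \<Rightarrow> ('m \<Rightarrow> 'e set) \<Rightarrow> 'm tdata set \<Rightarrow> 'm \<Rightarrow>
     ('e set \<times> 'e set) set" where
  "normal10 A F T p =
     {m \<in> normal_space F p \<times> normal_space F p.
        map_prod (normal_J A F T p) (normal_J A F T p) m = ncscale F p \<i> m}"

text \<open>The holomorphic tangent space of \<open>\<complex>\<P>\<^sup>1\<close> at any point: the tangent space is \<open>complex\<close>, in
  the coordinate of a holomorphic chart, and its complex structure is multiplication by \<open>\<i>\<close>.\<close>

definition cp1_tangent10 :: "(complex \<times> complex) set" where
  "cp1_tangent10 = {(u, v). (\<i> * u, \<i> * v) = (- v, u)}"

text \<open>The complex-linear extension of a complex-valued real-linear functional.\<close>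

definition cext :: "('v \<Rightarrow> complex) \<Rightarrow> 'v \<times> 'v \<Rightarrow> complex" where
  "cext L m = L (fst m) + \<i> * L (snd m)"


section \<open>Quadratic differentials\<close>

text \<open>The square \<open>L\<^sup>*\<^sup>\<otimes>\<^sup>2\<close> of the dual of a complex vector space \<open>L\<close> is the space of complex
  bilinear forms on \<open>L\<close>; forms on \<open>N\<^sup>1\<^sup>,\<^sup>0\<close> are extended by \<open>0\<close>.\<close>

type_synonym ('m, 'e) ksection = "'m \<Rightarrow> 'e set \<times> 'e set \<Rightarrow> 'e set \<times> 'e set \<Rightarrow> complex"

definition K2_fibre ::
    "('m, 'e::euclidean_space) chart set \<Rightarrow> ('m \<Rightarrow> 'e set) \<Rightarrow> 'm tdata set \<Rightarrow> 'm \<Rightarrow>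
     ('e set \<times> 'e set \<Rightarrow> 'e set \<times> 'e set \<Rightarrow> complex) set" where
  "K2_fibre A F T p = {\<beta>.
     (\<forall>l\<in>normal10 A F T p. \<forall>m\<in>normal10 A F T p. \<forall>n\<in>normal10 A F T p. \<forall>c.
        \<beta> (ncadd l m) n = \<beta> l n + \<beta> m n \<and> \<beta> n (ncadd l m) = \<beta> n l + \<beta> n m \<and>
        \<beta> (ncscale F p c m) n = c * \<beta> m n \<and> \<beta> m (ncscale F p c n) = c * \<beta> m n) \<and>
     (\<forall>m n. m \<notin> normal10 A F T p \<or> n \<notin> normal10 A F T p \<longrightarrow> \<beta> m n = 0)}"

text \<open>In each of the two charts \<open>z\<close> of \<open>\<complex>\<P>\<^sup>1\<close> one has \<open>\<theta> = h(z) dz \<otimes> dz\<close> with \<open>h\<close> holomorphic.\<close>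

definition holomorphic_quadratic_differential ::
    "cp1 set \<Rightarrow> (cp1 \<Rightarrow> complex \<times> complex \<Rightarrow> complex \<times> complex \<Rightarrow> complex) \<Rightarrow> bool" where
  "holomorphic_quadratic_differential D \<theta> \<longleftrightarrow>
     (\<forall>c\<in>cp1_atlas. \<exists>h. h holomorphic_on (snd c ` (D \<inter> fst c)) \<and>
        (\<forall>z\<in>D \<inter> fst c. \<forall>m\<in>cp1_tangent10. \<forall>n\<in>cp1_tangent10.
           \<theta> z m n = h (snd c z) * cext (dfun cp1_atlas (snd c) z) m
                                * cext (dfun cp1_atlas (snd c) z) n))"

definition pullback_quadratic ::
    "('m, 'e::euclidean_space) chart set \<Rightarrow> ('m \<Rightarrow> 'e set) \<Rightarrow> 'm tdata set \<Rightarrow> ('m \<Rightarrow> cp1) \<Rightarrow>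
     (cp1 \<Rightarrow> complex \<times> complex \<Rightarrow> complex \<times> complex \<Rightarrow> complex) \<Rightarrow> ('m, 'e) ksection" where
  "pullback_quadratic A F T \<sigma> \<theta> p m n =
     (let d\<sigma> = descend (tangent_map A cp1_atlas \<sigma> p)
      in if m \<in> normal10 A F T p \<and> n \<in> normal10 A F T p
         then \<theta> (\<sigma> p) (map_prod d\<sigma> d\<sigma> m) (map_prod d\<sigma> d\<sigma> n) else 0)"

definition H0_K2 ::
    "('m, 'e::euclidean_space) chart set \<Rightarrow> ('m \<Rightarrow> 'e set) \<Rightarrow> 'm tdata set \<Rightarrow>
     ('m, 'e) ksection set" where
  "H0_K2 A F T = {q. (\<forall>p. q p \<in> K2_fibre A F T p) \<and>
     (\<forall>p. \<exists>(U, \<sigma>)\<in>\<Union>T. p \<in> U \<and>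
        (\<exists>\<theta>. holomorphic_quadratic_differential (\<sigma> ` U) \<theta> \<and>
             (\<forall>x\<in>U. q x = pullback_quadratic A F T \<sigma> \<theta> x)))}"

definition ksection_scale :: "complex \<Rightarrow> ('m, 'e) ksection \<Rightarrow> ('m, 'e) ksection" where
  "ksection_scale c q = (\<lambda>p m n. c * q p m n)"

interpretation ksection: vector_space ksection_scale
  by standard (auto simp: ksection_scale_def plus_fun_def algebra_simps fun_eq_iff)


section \<open>Differences of projective structures\<close>

definition schwarzian :: "(complex \<Rightarrow> complex) \<Rightarrow> complex \<Rightarrow> complex" where
  "schwarzian f z = (deriv ^^ 3) f z / deriv f z - 3 / 2 * ((deriv ^^ 2) f z / deriv f z)\<^sup>2"

text \<open>\<open>P' - P = \<kappa> {w', w} (dw)\<^sup>2\<close>, where \<open>w\<close> and \<open>w' = f \<circ> w\<close> are finite-valued local charts of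
  \<open>P\<close> and \<open>P'\<close> on a common domain \<open>W\<close>, so that \<open>{w', w}\<close> is the Schwarzian derivative of \<open>f\<close>. Every
  point lies in such a \<open>W\<close> if \<open>P\<close> and \<open>P'\<close> define the same transversely complex structure, since the
  charts of a structure can be composed with Moebius transformations.\<close>

definition structure_difference ::
    "('m::topological_space, 'e::euclidean_space) chart set \<Rightarrow> ('m \<Rightarrow> 'e set) \<Rightarrow> 'm tdata set \<Rightarrow>
     complex \<Rightarrow> 'm tdata set \<Rightarrow> 'm tdata set \<Rightarrow> ('m, 'e) ksection \<Rightarrow> bool" where
  "structure_difference A F T \<kappa> P' P q \<longleftrightarrow>
     (\<forall>(U, \<sigma>)\<in>\<Union>P. \<forall>(U', \<sigma>')\<in>\<Union>P'. \<forall>W w w' f.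
        open W \<and> W \<subseteq> U \<inter> U' \<and> (\<forall>p\<in>W. \<sigma> p = Cpt (w p) \<and> \<sigma>' p = Cpt (w' p)) \<and>
        f holomorphic_on (w ` W) \<and> (\<forall>p\<in>W. w' p = f (w p)) \<longrightarrow>
        (\<forall>p\<in>W. \<forall>m\<in>normal10 A F T p. \<forall>n\<in>normal10 A F T p.
           q p m n = \<kappa> * schwarzian f (w p) * cext (descend (dfun A w p)) m
                                            * cext (descend (dfun A w p)) n))"

definition affine_space_for ::
    "'v::ab_group_add set \<Rightarrow> ('v \<Rightarrow> 's \<Rightarrow> 's) \<Rightarrow> 's set \<Rightarrow> bool" where
  "affine_space_for V act S \<longleftrightarrow> S \<noteq> {} \<and>
     (\<forall>v\<in>V. \<forall>s\<in>S. act v s \<in> S) \<and>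
     (\<forall>s\<in>S. act 0 s = s) \<and> (\<forall>u\<in>V. \<forall>v\<in>V. \<forall>s\<in>S. act (u + v) s = act u (act v s)) \<and>
     (\<forall>v\<in>V. \<forall>s\<in>S. act v s = s \<longrightarrow> v = 0) \<and>
     (\<forall>s\<in>S. \<forall>t\<in>S. \<exists>v\<in>V. act v s = t)"

end

theory Submission
  imports Defs "HOL-Complex_Analysis.Complex_Analysis"
begin

text \<open>Around each point, a compatible transversely projective structure is an atlas of holomorphic coordinates
  \<open>w\<close> of the leaf space, any two of which differ by a Moebius transformation. Let \<open>w\<close> and \<open>w' = f \<circ> w\<close> be
  coordinates of two such structures, and let \<open>S f\<close> be the Schwarzian derivative of \<open>f\<close>. Everything rests
  on three facts about it.

  The first is the chain rule \<open>S (g \<circ> f) = (S g \<circ> f) f'\<^sup>2 + S f\<close> (\<open>schwarzian_compose\<close>). As the Schwarzian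
  derivative of a Moebius transformation is zero, it shows that the quadratic differential \<open>S f (dw)\<^sup>2\<close> does
  not change when \<open>w\<close> and \<open>w'\<close> are replaced by other coordinates of their structures
  (\<open>dz_square_pair_change\<close>), so that two structures have a difference, which is a global section
  (\<open>difference_exists\<close>). It also shows that differences add up (\<open>difference_add\<close>).

  The second is that \<open>S f = 0\<close> only for Moebius transformations (\<open>schwarzian_zero_imp_moebius\<close>). Hence
  structures with difference zero are equal, and a structure is determined by its difference from a given
  one (\<open>deformation_unique\<close>).

  The third is that \<open>S \<phi> = h\<close> can be solved locally for every holomorphic \<open>h\<close> (\<open>schwarzian_solution\<close>): if
  \<open>\<phi>' = 1 / u\<^sup>2\<close>, the equation becomes the linear equation \<open>u'' = - (h / 2) u\<close>, which has power series
  solutions. Given a structure and a section \<open>q\<close>, equal to \<open>\<kappa> h (dw)\<^sup>2\<close> in a coordinate \<open>w\<close>, the functions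
  \<open>\<phi> \<circ> w\<close> are the charts of a structure with difference \<open>q\<close> from the given one; their transition maps are
  Moebius transformations by the first two facts (\<open>deformation_exists\<close>).

  Two reductions lead to this local picture. An equivalence class of projective data is determined by
  the set of all charts that occur in it, and whether a chart belongs to this set can be seen from
  germs: a Moebius transformation is determined by its values on any nonempty open set, and therefore
  transition maps that are Moebius transformations near each point are so on each connected component
  (\<open>moebius_dataI\<close>, \<open>projective_maximal\<close>). Secondly, the differential of a coordinate \<open>w\<close> identifies each
  normal space with the complex numbers, compatibly with the complex structures (\<open>normal10_eq\<close>). Sections
  of the square of the bundle \<open>K\<close> become functions times \<open>(dw)\<^sup>2\<close>, and the transversely holomorphic ones are those
  with coefficients \<open>h \<circ> w\<close> for holomorphic \<open>h\<close> (\<open>H0_K2_iff\<close>).\<close>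

section \<open>Functions of class \<open>C\<^sup>k\<close>\<close>

lemma C_k_on_cong:
  assumes "open S" "\<And>x. x \<in> S \<Longrightarrow> f x = g x" "C_k_on k f S"
  shows "C_k_on k g S"
  using assms(2,3)
proof (induction k arbitrary: f g)
  case 0
  then show ?case
    using continuous_on_eq by simp
next
  case (Suc k)
  have d: "g differentiable (at x)" "frechet_derivative f (at x) = frechet_derivative g (at x)"
    if "x \<in> S" for x
  proof -
    have f: "f differentiable (at x)"
      using Suc.prems that by auto
    show "frechet_derivative f (at x) = frechet_derivative g (at x)"
      by (rule frechet_derivative_transform_within_open[OF f assms(1) that Suc.prems(1)])
    obtain f' where f': "(f has_derivative f') (at x)"
      using f differentiable_def by blast
    have "(g has_derivative f') (at x)"
      by (rule has_derivative_transform_within_open[OF f' assms(1) that Suc.prems(1)])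
    then show "g differentiable (at x)"
      by (rule differentiableI)
  qed
  have "C_k_on k (\<lambda>x. frechet_derivative g (at x) v) S" for v
  proof (rule Suc.IH)
    show "frechet_derivative f (at x) v = frechet_derivative g (at x) v" if "x \<in> S" for x
      by (rule fun_cong[OF d(2)[OF that]])
    show "C_k_on k (\<lambda>x. frechet_derivative f (at x) v) S"
      using Suc.prems(2) by simp
  qed
  then show ?case
    using d(1) by auto
qed

lemma C_k_on_Suc_imp: "C_k_on (Suc k) f S \<Longrightarrow> C_k_on k f S"
proof (induction k arbitrary: f)
  case 0
  then show ?case
    by (simp add: continuous_at_imp_continuous_on differentiable_imp_continuous_within)
next
  case (Suc k)
  have "C_k_on k (\<lambda>x. frechet_derivative f (at x) v) S" for v
    using Suc.prems unfolding C_k_on.simps(2)[of "Suc k"] by (intro Suc.IH) blast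
  then show ?case
    using Suc.prems unfolding C_k_on.simps(2) by blast
qed

lemma C_k_on_subset: "C_k_on k f S \<Longrightarrow> S' \<subseteq> S \<Longrightarrow> C_k_on k f S'"
proof (induction k arbitrary: f)
  case 0
  then show ?case
    using continuous_on_subset by simp
next
  case (Suc k)
  then show ?case
    by (simp add: subset_iff)
qed

lemma C_k_on_add:
  assumes "open S"
  shows "C_k_on k f S \<Longrightarrow> C_k_on k g S \<Longrightarrow> C_k_on k (\<lambda>x. f x + g x) S"
proof (induction k arbitrary: f g)
  case 0
  then show ?case by (simp add: continuous_on_add)
next
  case (Suc k)
  have "C_k_on k (\<lambda>x. frechet_derivative (\<lambda>x. f x + g x) (at x) v) S" for v
  proof (rule C_k_on_cong[OF assms])
    show "C_k_on k (\<lambda>x. frechet_derivative f (at x) v + frechet_derivative g (at x) v) S"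
      using Suc by simp
    show "frechet_derivative f (at x) v + frechet_derivative g (at x) v
       = frechet_derivative (\<lambda>x. f x + g x) (at x) v" if "x \<in> S" for x
    proof -
      have "((\<lambda>x. f x + g x) has_derivative
          (\<lambda>v. frechet_derivative f (at x) v + frechet_derivative g (at x) v)) (at x)"
        using Suc.prems that by (intro has_derivative_add) (simp_all add: frechet_derivative_works)
      from frechet_derivative_at[OF this] show ?thesis by metis
    qed
  qed
  then show ?case
    using Suc.prems by (simp add: differentiable_add)
qed

lemma C_k_on_mult:
  fixes f g :: "'a::euclidean_space \<Rightarrow> complex"
  assumes "open S"
  shows "C_k_on k f S \<Longrightarrow> C_k_on k g S \<Longrightarrow> C_k_on k (\<lambda>x. f x * g x) S"
proof (induction k arbitrary: f g)
  case 0
  then show ?case by (simp add: continuous_on_mult)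
next
  case (Suc k)
  have "C_k_on k (\<lambda>x. frechet_derivative (\<lambda>x. f x * g x) (at x) v) S" for v
  proof (rule C_k_on_cong[OF assms])
    show "C_k_on k (\<lambda>x. f x * frechet_derivative g (at x) v + frechet_derivative f (at x) v * g x) S"
      using Suc.prems by (intro C_k_on_add[OF assms] Suc.IH) (auto intro: C_k_on_Suc_imp)
    show "f x * frechet_derivative g (at x) v + frechet_derivative f (at x) v * g x
       = frechet_derivative (\<lambda>x. f x * g x) (at x) v" if "x \<in> S" for x
    proof -
      have "((\<lambda>x. f x * g x) has_derivative
          (\<lambda>v. f x * frechet_derivative g (at x) v + frechet_derivative f (at x) v * g x)) (at x)"
        using Suc.prems that by (intro has_derivative_mult) (simp_all add: frechet_derivative_works)
      from frechet_derivative_at[OF this] show ?thesis by metis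
    qed
  qed
  then show ?case
    using Suc.prems by (simp add: differentiable_mult)
qed

lemma has_derivative_compose_field:
  assumes "(f has_field_derivative D) (at (g x))" "(g has_derivative g') (at x)"
  shows "((\<lambda>y. f (g y)) has_derivative (\<lambda>v. D * g' v)) (at x)"
  by (rule has_derivative_compose[OF assms(2) assms(1)[unfolded has_field_derivative_def]])

text \<open>The derivative of \<open>\<phi> \<circ> g\<close> in direction \<open>v\<close> is the product of \<open>\<phi>' \<circ> g\<close> and the derivative of \<open>g\<close>. The
  induction therefore has to treat all \<open>\<phi>\<close> at once, in order to apply to \<open>\<phi>'\<close>.\<close>

lemma C_k_on_holomorphic_compose:
  fixes g :: "'a::euclidean_space \<Rightarrow> complex"
  assumes "open S" "open \<Omega>" "g ` S \<subseteq> \<Omega>"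
  shows "\<phi> holomorphic_on \<Omega> \<Longrightarrow> C_k_on k g S \<Longrightarrow> C_k_on k (\<lambda>x. \<phi> (g x)) S"
proof (induction k arbitrary: \<phi>)
  case 0
  then show ?case
    using continuous_on_compose2[OF holomorphic_on_imp_continuous_on _ assms(3)] by simp
next
  case (Suc k)
  have d: "((\<lambda>x. \<phi> (g x)) has_derivative (\<lambda>v. deriv \<phi> (g x) * frechet_derivative g (at x) v)) (at x)"
    if "x \<in> S" for x
  proof (rule has_derivative_compose_field[where f = \<phi> and g = g])
    show "(\<phi> has_field_derivative deriv \<phi> (g x)) (at (g x))"
      using Suc.prems(1) assms(2,3) that by (intro holomorphic_derivI[of _ \<Omega>]) auto
    show "(g has_derivative frechet_derivative g (at x)) (at x)"
      using Suc.prems(2) that by (simp add: frechet_derivative_works)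
  qed
  have "C_k_on k (\<lambda>x. frechet_derivative (\<lambda>x. \<phi> (g x)) (at x) v) S" for v
  proof (rule C_k_on_cong[OF assms(1)])
    show "C_k_on k (\<lambda>x. deriv \<phi> (g x) * frechet_derivative g (at x) v) S"
    proof (rule C_k_on_mult[OF assms(1)])
      show "C_k_on k (\<lambda>x. deriv \<phi> (g x)) S"
        by (rule Suc.IH[OF holomorphic_deriv[OF Suc.prems(1) assms(2)] C_k_on_Suc_imp[OF Suc.prems(2)]])
      show "C_k_on k (\<lambda>x. frechet_derivative g (at x) v) S"
        using Suc.prems(2) by simp
    qed
    show "deriv \<phi> (g x) * frechet_derivative g (at x) v
       = frechet_derivative (\<lambda>x. \<phi> (g x)) (at x) v" if "x \<in> S" for x
      using frechet_derivative_at[OF d[OF that]] by metis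
  qed
  moreover have "\<forall>x\<in>S. (\<lambda>x. \<phi> (g x)) differentiable (at x)"
    using d unfolding differentiable_def by blast
  ultimately show ?case
    by simp
qed

lemma smooth_on_holomorphic_compose:
  assumes "open S" "open \<Omega>" "g ` S \<subseteq> \<Omega>" "\<phi> holomorphic_on \<Omega>" "smooth_on g S"
  shows "smooth_on (\<lambda>x. \<phi> (g x)) S"
  using assms C_k_on_holomorphic_compose unfolding smooth_on_def by blast

section \<open>Charts of the complex projective line\<close>

abbreviation affine_coord :: "cp1 \<Rightarrow> complex" where
  "affine_coord \<equiv> case_cp1 (\<lambda>z. z) 0"

abbreviation inverse_coord :: "cp1 \<Rightarrow> complex" where
  "inverse_coord \<equiv> case_cp1 (\<lambda>z. 1 / z) 0"

lemma cp1_atlas_cases: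
  assumes "c \<in> cp1_atlas"
  obtains "c = (- {Infty}, affine_coord)" | "c = (- {Cpt 0}, inverse_coord)"
  using assms unfolding cp1_atlas_def by auto

lemma affine_chart_in [simp]: "(- {Infty}, affine_coord) \<in> cp1_atlas"
  and inverse_chart_in [simp]: "(- {Cpt 0}, inverse_coord) \<in> cp1_atlas"
  by (simp_all add: cp1_atlas_def)

lemma not_Infty_iff: "z \<noteq> Infty \<longleftrightarrow> (\<exists>w. z = Cpt w)"
  by (cases z) auto

lemma chart_inv_affine: "chart_inv (- {Infty}, affine_coord) = Cpt"
proof
  fix z
  show "chart_inv (- {Infty}, affine_coord) z = Cpt z"
    unfolding chart_inv_def
    by (rule inv_into_f_eq) (auto simp: inj_on_def not_Infty_iff)
qed

lemma chart_inv_inverse: "chart_inv (- {Cpt 0}, inverse_coord) = cp1_inf"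
proof
  fix z
  show "chart_inv (- {Cpt 0}, inverse_coord) z = cp1_inf z"
    unfolding chart_inv_def
    by (rule inv_into_f_eq) (auto simp: inj_on_def cp1_inf_def split: cp1.splits if_splits)
qed

lemma open_vimage_Cpt: "open U \<Longrightarrow> open (Cpt -` U)"
  and open_vimage_cp1_inf: "open U \<Longrightarrow> open (cp1_inf -` U)"
  by (simp_all add: open_cp1_def)

lemma continuous_on_Cpt: "continuous_on S Cpt"
  by (rule continuous_on_subset[of UNIV])
     (simp_all add: continuous_on_open_vimage open_vimage_Cpt)

lemma continuous_on_cp1_inf: "continuous_on S cp1_inf"
  by (rule continuous_on_subset[of UNIV])
     (simp_all add: continuous_on_open_vimage open_vimage_cp1_inf)

lemma open_Cpt_image:
  assumes "open S" shows "open (Cpt ` S)"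
proof -
  have 1: "Cpt -` Cpt ` S = S"
    by auto
  have 2: "cp1_inf -` Cpt ` S = inverse -` S \<inter> - {0}"
    by (auto simp: cp1_inf_def inverse_eq_divide split: if_splits)
  have "continuous_on (- {0::complex}) inverse"
    by (intro continuous_intros) auto
  then have "open (inverse -` S \<inter> - {0::complex})"
    using assms by (simp add: continuous_on_open_vimage open_Compl)
  with 1 2 assms show ?thesis
    by (simp add: open_cp1_def)
qed

lemma open_affine_domain: "open (- {Infty})"
proof -
  have "- {Infty} = Cpt ` UNIV"
    by (auto simp: image_iff) (metis cp1.exhaust)
  then show ?thesis
    using open_Cpt_image[of UNIV] by simp
qed

lemma open_inverse_domain: "open (- {Cpt 0})"
proof -
  have "Cpt -` (- {Cpt 0}) = - {0}" "cp1_inf -` (- {Cpt 0}) = UNIV"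
    by (auto simp: cp1_inf_def)
  then show ?thesis
    by (simp add: open_cp1_def open_Compl)
qed

lemma open_cp1_chart_domain: "c \<in> cp1_atlas \<Longrightarrow> open (fst c)"
  by (erule cp1_atlas_cases) (auto simp: open_affine_domain open_inverse_domain)

lemma continuous_on_affine_coord: "continuous_on (- {Infty}) affine_coord"
proof -
  have "open (affine_coord -` S \<inter> - {Infty})" if "open S" for S
  proof -
    have "affine_coord -` S \<inter> - {Infty} = Cpt ` S"
      by (auto simp: not_Infty_iff split: cp1.splits)
    then show ?thesis
      using open_Cpt_image[OF that] by simp
  qed
  then show ?thesis
    by (simp add: continuous_on_open_vimage open_affine_domain)
qed

lemma cp1_chart_cover: "\<exists>c\<in>cp1_atlas. z \<in> fst c"
  by (cases "z = Infty") (auto simp: cp1_atlas_def)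

lemma chart_at_cp1: "chart_at cp1_atlas z \<in> cp1_atlas" "z \<in> fst (chart_at cp1_atlas z)"
proof -
  have "\<exists>c. c \<in> cp1_atlas \<and> z \<in> fst c"
    using cp1_chart_cover by blast
  from someI_ex[OF this] show "chart_at cp1_atlas z \<in> cp1_atlas" "z \<in> fst (chart_at cp1_atlas z)"
    unfolding chart_at_def by auto
qed

lemma infinite_Cpt_in_open:
  assumes "open U" "z \<in> U"
  shows "infinite {w. Cpt w \<in> U}"
proof (cases "\<exists>w. Cpt w \<in> U")
  case True
  then obtain w where "w \<in> Cpt -` U"
    by auto
  then have "infinite (Cpt -` U)"
    using open_vimage_Cpt[OF assms(1)] uncountable_infinite open_minus_countable
    by (metis empty_iff finite_imp_not_open)
  then show ?thesis
    by (simp add: vimage_def)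
next
  case False
  then have "cp1_inf -` U = {0}"
    using assms(2) by (cases z) (auto simp: cp1_inf_def split: if_splits)
  then show ?thesis
    using open_vimage_cp1_inf[OF assms(1)] by (metis finite.emptyI finite_imp_not_open finite_insert insert_not_empty)
qed


section \<open>Moebius transformations\<close>

lemma moebius_id: "moebius 1 0 0 1 z = z"
  by (cases z) auto

lemma moebius_inverse:
  assumes "a * d - b * c = 1"
  shows "moebius d (- b) (- c) a (moebius a b c d z) = z"
proof (cases z)
  case (Cpt w)
  show ?thesis
  proof (cases "c * w + d = 0")
    case True
    have "c \<noteq> 0"
      using True assms by auto
    moreover have "w = - d / c"
      using True \<open>c \<noteq> 0\<close> by (simp add: field_simps eq_neg_iff_add_eq_0)
    ultimately show ?thesis
      using Cpt True by simp
  next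
    case False
    have 1: "- c * ((a * w + b) / (c * w + d)) + a = 1 / (c * w + d)"
      using False assms by (simp add: field_simps)
    have 2: "d * ((a * w + b) / (c * w + d)) + - b = w / (c * w + d)"
      using False assms by (simp add: field_simps) (algebra)
    show ?thesis
      using Cpt False unfolding Cpt moebius.simps
      by (simp only: if_False moebius.simps 1 2) (simp add: field_simps)
  qed
next
  case Infty
  show ?thesis
  proof (cases "c = 0")
    case True
    then show ?thesis using Infty by simp
  next
    case False
    then show ?thesis using Infty by simp
  qed
qed

lemma moebius_compose:
  assumes "a * d - b * c = 1" "a' * d' - b' * c' = 1"
  shows "moebius a' b' c' d' (moebius a b c d z)
       = moebius (a' * a + b' * c) (a' * b + b' * d) (c' * a + d' * c) (c' * b + d' * d) z"
proof (cases z)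
  case (Cpt w)
  show ?thesis
  proof (cases "c * w + d = 0")
    case True
    have nz: "a * w + b \<noteq> 0"
    proof
      assume "a * w + b = 0"
      with True have "a * (c * w + d) - c * (a * w + b) = 0" by simp
      then show False using assms(1) by (simp add: algebra_simps)
    qed
    have 1: "(c' * a + d' * c) * w + (c' * b + d' * d) = c' * (a * w + b)"
      using True by algebra
    have 2: "(a' * a + b' * c) * w + (a' * b + b' * d) = a' * (a * w + b)"
      using True by algebra
    show ?thesis
      using Cpt True nz unfolding Cpt moebius.simps by (simp only: 1 2) simp
  next
    case False
    have 1: "(c' * a + d' * c) * w + (c' * b + d' * d)
        = (c' * ((a * w + b) / (c * w + d)) + d') * (c * w + d)"
      using False by (simp add: field_simps)
    have 2: "(a' * a + b' * c) * w + (a' * b + b' * d)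
        = (a' * ((a * w + b) / (c * w + d)) + b') * (c * w + d)"
      using False by (simp add: field_simps)
    show ?thesis
      using Cpt False unfolding Cpt moebius.simps by (simp only: 1 2) simp
  qed
next
  case Infty
  show ?thesis
  proof (cases "c = 0")
    case True
    then have "a \<noteq> 0"
      using assms(1) by auto
    then show ?thesis
      using Infty True by simp
  next
    case False
    have 1: "c' * a + d' * c = (c' * (a / c) + d') * c" "a' * a + b' * c = (a' * (a / c) + b') * c"
      using False by (simp_all add: field_simps)
    show ?thesis
      using Infty False by (simp only: moebius.simps 1) simp
  qed
qed

lemma moebius_compose_det:
  fixes a b c d :: complex
  assumes "a * d - b * c = 1" "a' * d' - b' * c' = 1"
  shows "(a' * a + b' * c) * (c' * b + d' * d) - (a' * b + b' * d) * (c' * a + d' * c) = 1"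
  using assms by algebra

text \<open>At a finite point \<open>w\<close> the two transformations agree only if a certain polynomial of degree at most two
  vanishes there. A nonempty open set contains infinitely many finite points, so that the polynomial is
  zero, and the relations between the entries of the matrices obtained in this way hold at every point.\<close>

lemma moebius_determined_by_open_set:
  assumes det: "a * d - b * c = 1" "a' * d' - b' * c' = 1"
    and U: "open U" "z0 \<in> U"
    and eq: "\<And>z. z \<in> U \<Longrightarrow> moebius a b c d z = moebius a' b' c' d' z"
  shows "moebius a b c d z = moebius a' b' c' d' z"
proof -
  let ?p = "[: b * d' - b' * d, a * d' + b * c' - a' * d - b' * c, a * c' - a' * c :]"
  have "poly ?p w = 0" if "Cpt w \<in> U" for w
  proof -
    have "(a * w + b) * (c' * w + d') = (a' * w + b') * (c * w + d)"
      using eq[OF that] by (auto simp: divide_eq_eq eq_divide_eq split: if_splits)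
    then show ?thesis
      by (simp add: algebra_simps)
  qed
  then have "{w. Cpt w \<in> U} \<subseteq> {w. poly ?p w = 0}"
    by auto
  then have "infinite {w. poly ?p w = 0}"
    using infinite_Cpt_in_open[OF U] finite_subset by blast
  then have "?p = 0"
    using poly_roots_finite by blast
  then have co: "b * d' = b' * d" "a * d' + b * c' = a' * d + b' * c" "a * c' = a' * c"
    by (auto simp: algebra_simps)
  show ?thesis
  proof (cases z)
    case (Cpt w)
    have cross: "(a * w + b) * (c' * w + d') = (a' * w + b') * (c * w + d)"
      using co by algebra
    have nz: "\<not> (a * w + b = 0 \<and> c * w + d = 0)" "\<not> (a' * w + b' = 0 \<and> c' * w + d' = 0)"
      using det by algebra+
    show ?thesis
      using Cpt cross nz by (auto simp: frac_eq_eq)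
  next
    case Infty
    have nz: "\<not> (a = 0 \<and> c = 0)" "\<not> (a' = 0 \<and> c' = 0)"
      using det by auto
    show ?thesis
      using Infty co(3) nz by (auto simp: frac_eq_eq)
  qed
qed

lemma continuous_on_cp1I:
  assumes "continuous_on UNIV (f \<circ> Cpt)" "continuous_on UNIV (f \<circ> cp1_inf)"
  shows "continuous_on UNIV f"
  using assms by (simp add: continuous_on_open_vimage open_cp1_def vimage_comp o_def)

text \<open>Near a pole the value is given by the reciprocal of the quotient, in the chart around \<open>Infty\<close>.\<close>

lemma continuous_on_moebius_Cpt:
  assumes "a * d - b * c \<noteq> 0"
  shows "continuous_on UNIV (\<lambda>z. moebius a b c d (Cpt z))"
proof -
  let ?A = "{z. c * z + d \<noteq> 0}" and ?B = "{z. a * z + b \<noteq> 0}"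
  have op: "open ?A" "open ?B"
    by (intro open_Collect_neq continuous_intros)+
  have cover: "?A \<union> ?B = UNIV"
  proof -
    have "\<not> (c * z + d = 0 \<and> a * z + b = 0)" for z
      using assms by algebra
    then show ?thesis by auto
  qed
  have "continuous_on ?A (\<lambda>z. moebius a b c d (Cpt z))"
  proof (rule continuous_on_eq)
    show "continuous_on ?A (\<lambda>z. Cpt ((a * z + b) / (c * z + d)))"
      by (rule continuous_on_compose2[OF continuous_on_Cpt[of UNIV]]) (auto intro!: continuous_intros)
  qed auto
  moreover have "continuous_on ?B (\<lambda>z. moebius a b c d (Cpt z))"
  proof (rule continuous_on_eq)
    show "continuous_on ?B (\<lambda>z. cp1_inf ((c * z + d) / (a * z + b)))"
      by (rule continuous_on_compose2[OF continuous_on_cp1_inf[of UNIV]]) (auto intro!: continuous_intros)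
  qed (auto simp: cp1_inf_def)
  ultimately show ?thesis
    using continuous_on_open_Un[OF op] cover by metis
qed

text \<open>Seen in the chart around \<open>Infty\<close>, a Moebius transformation is again one, with the columns of its matrix
  exchanged. This reduces questions at \<open>Infty\<close> to questions at finite points.\<close>

lemma moebius_cp1_inf: "moebius a b c d (cp1_inf w) = moebius b a d c (Cpt w)"
proof (cases "w = 0")
  case False
  have "a * (1 / w) + b = (b * w + a) / w" "c * (1 / w) + d = (d * w + c) / w"
    using False by (simp_all add: field_simps)
  with False show ?thesis
    by (simp add: cp1_inf_def)
qed (simp add: cp1_inf_def)

lemma continuous_on_moebius:
  assumes "a * d - b * c = 1"
  shows "continuous_on S (moebius a b c d)"
proof -
  have "continuous_on UNIV (moebius a b c d \<circ> Cpt)"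
    using continuous_on_moebius_Cpt[of a d b c] assms by (simp add: o_def)
  moreover have "b * c - a * d \<noteq> 0"
    using assms by (metis minus_diff_eq neg_equal_0_iff_equal zero_neq_one)
  then have "continuous_on UNIV (moebius a b c d \<circ> cp1_inf)"
    using continuous_on_moebius_Cpt[of b c a d] by (simp add: o_def moebius_cp1_inf)
  ultimately show ?thesis
    using continuous_on_cp1I continuous_on_subset by blast
qed

lemma chart_moebius_holomorphic:
  assumes "a * d - b * c \<noteq> 0"
  shows "(affine_coord \<circ> moebius a b c d \<circ> Cpt) holomorphic_on {z. moebius a b c d (Cpt z) \<noteq> Infty}"
    and "(inverse_coord \<circ> moebius a b c d \<circ> Cpt) holomorphic_on {z. moebius a b c d (Cpt z) \<noteq> Cpt 0}"
proof -
  have "(\<lambda>z. (a * z + b) / (c * z + d)) holomorphic_on {z. c * z + d \<noteq> 0}"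
    by (auto intro!: holomorphic_intros)
  moreover have "{z. moebius a b c d (Cpt z) \<noteq> Infty} = {z. c * z + d \<noteq> 0}"
    by auto
  ultimately show "(affine_coord \<circ> moebius a b c d \<circ> Cpt) holomorphic_on {z. moebius a b c d (Cpt z) \<noteq> Infty}"
    by (auto intro: holomorphic_transform)
  have nz: "\<not> (c * z + d = 0 \<and> a * z + b = 0)" for z
    using assms by algebra
  have "(\<lambda>z. (c * z + d) / (a * z + b)) holomorphic_on {z. a * z + b \<noteq> 0}"
    by (auto intro!: holomorphic_intros)
  moreover have "{z. moebius a b c d (Cpt z) \<noteq> Cpt 0} = {z. a * z + b \<noteq> 0}"
    using nz by auto
  ultimately show "(inverse_coord \<circ> moebius a b c d \<circ> Cpt) holomorphic_on {z. moebius a b c d (Cpt z) \<noteq> Cpt 0}"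
    by (auto intro: holomorphic_transform)
qed

lemma cp1_holomorphic_on_subset:
  assumes "cp1_holomorphic_on f S" "S' \<subseteq> S"
  shows "cp1_holomorphic_on f S'"
  unfolding cp1_holomorphic_on_def
proof (intro conjI ballI)
  show "continuous_on S' f"
    using assms continuous_on_subset unfolding cp1_holomorphic_on_def by blast
  fix c c' assume c: "c \<in> cp1_atlas" "c' \<in> cp1_atlas"
  have "(snd c' \<circ> f \<circ> chart_inv c) holomorphic_on snd c ` {z \<in> S \<inter> fst c. f z \<in> fst c'}"
    using assms(1) c unfolding cp1_holomorphic_on_def by blast
  then show "(snd c' \<circ> f \<circ> chart_inv c) holomorphic_on snd c ` {z \<in> S' \<inter> fst c. f z \<in> fst c'}"
    by (rule holomorphic_on_subset) (use assms(2) in blast)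
qed

lemma cp1_holomorphic_moebius:
  assumes "a * d - b * c = 1"
  shows "cp1_holomorphic_on (moebius a b c d) S"
proof (rule cp1_holomorphic_on_subset)
  have det: "a * d - b * c \<noteq> 0" "b * c - a * d \<noteq> 0"
    using assms by (simp, metis minus_diff_eq neg_equal_0_iff_equal zero_neq_one)
  have "(snd c' \<circ> moebius a b c d \<circ> chart_inv ch) holomorphic_on
      snd ch ` {z \<in> UNIV \<inter> fst ch. moebius a b c d z \<in> fst c'}"
    if "ch \<in> cp1_atlas" "c' \<in> cp1_atlas" for ch c'
    using that(1)
  proof (cases rule: cp1_atlas_cases)
    case 1
    have sub: "snd ch ` {z \<in> UNIV \<inter> fst ch. moebius a b c d z \<in> fst c'}
        \<subseteq> {z. moebius a b c d (Cpt z) \<in> fst c'}"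
      unfolding 1 by (auto simp: not_Infty_iff)
    show ?thesis
      unfolding 1 chart_inv_affine
      using that(2) chart_moebius_holomorphic[OF det(1)] sub[unfolded 1]
      by (cases rule: cp1_atlas_cases) (auto elim!: holomorphic_on_subset)
  next
    case 2
    have eq: "moebius a b c d \<circ> cp1_inf = moebius b a d c \<circ> Cpt"
      by (simp add: fun_eq_iff moebius_cp1_inf)
    have *: "moebius a b c d z = moebius b a d c (Cpt (inverse_coord z))" if "z \<noteq> Cpt 0" for z
      using that moebius_cp1_inf[of a b c d "inverse_coord z"]
      by (cases z) (auto simp: cp1_inf_def)
    have sub: "snd ch ` {z \<in> UNIV \<inter> fst ch. moebius a b c d z \<in> fst c'}
        \<subseteq> {z. moebius b a d c (Cpt z) \<in> fst c'}"
      unfolding 2 using * by auto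
    show ?thesis
      unfolding 2 chart_inv_inverse comp_assoc eq
      using that(2) chart_moebius_holomorphic[OF det(2)] sub[unfolded 2]
      by (cases rule: cp1_atlas_cases) (auto elim!: holomorphic_on_subset simp: comp_assoc)
  qed
  then show "cp1_holomorphic_on (moebius a b c d) UNIV"
    unfolding cp1_holomorphic_on_def using continuous_on_moebius[OF assms] by blast
qed simp

text \<open>By this lemma, transition maps between finite-valued charts can be constructed as holomorphic functions
  on plane domains, without regard to the chart around \<open>Infty\<close>.\<close>

lemma cp1_holomorphic_Cpt:
  assumes "open S" "f holomorphic_on S"
  shows "cp1_holomorphic_on (\<lambda>z. Cpt (f (affine_coord z))) (Cpt ` S)"
proof -
  let ?F = "\<lambda>z. Cpt (f (affine_coord z))"
  have cont: "continuous_on (Cpt ` S) ?F"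
  proof (rule continuous_on_compose2[OF continuous_on_Cpt[of UNIV]])
    have "continuous_on (Cpt ` S) affine_coord"
      by (rule continuous_on_subset[OF continuous_on_affine_coord]) auto
    then show "continuous_on (Cpt ` S) (\<lambda>z. f (affine_coord z))"
      by (rule continuous_on_compose2[OF holomorphic_on_imp_continuous_on[OF assms(2)]]) auto
  qed simp
  have hol: "(snd c' \<circ> ?F \<circ> chart_inv c) holomorphic_on snd c ` {z \<in> Cpt ` S \<inter> fst c. ?F z \<in> fst c'}"
    if "c \<in> cp1_atlas" "c' \<in> cp1_atlas" for c c'
    using that(1)
  proof (cases rule: cp1_atlas_cases)
    case 1
    show ?thesis
      using that(2)
    proof (cases rule: cp1_atlas_cases)
      case c': 1
      have "f holomorphic_on affine_coord ` {z \<in> Cpt ` S \<inter> - {Infty}. ?F z \<in> - {Infty}}"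
        by (rule holomorphic_on_subset[OF assms(2)]) auto
      then show ?thesis
        unfolding 1 c' chart_inv_affine by (simp add: o_def)
    next
      case c': 2
      have "(\<lambda>z. 1 / f z) holomorphic_on affine_coord ` {z \<in> Cpt ` S \<inter> - {Infty}. ?F z \<in> - {Cpt 0}}"
        by (intro holomorphic_intros holomorphic_on_subset[OF assms(2)]) auto
      then show ?thesis
        unfolding 1 c' chart_inv_affine by (simp add: o_def)
    qed
  next
    case 2
    have inv: "affine_coord (cp1_inf w) = 1 / w" for w
      by (simp add: cp1_inf_def)
    have hi: "(\<lambda>z. f (1 / z)) holomorphic_on inverse_coord ` (Cpt ` S \<inter> - {Cpt 0})"
    proof -
      have "(f \<circ> (\<lambda>z. 1 / z)) holomorphic_on inverse_coord ` (Cpt ` S \<inter> - {Cpt 0})"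
        by (rule holomorphic_on_compose_gen[OF _ assms(2)]) (auto intro!: holomorphic_intros)
      then show ?thesis by (simp add: o_def)
    qed
    show ?thesis
      using that(2)
    proof (cases rule: cp1_atlas_cases)
      case c': 1
      have "(\<lambda>z. f (1 / z)) holomorphic_on inverse_coord ` {z \<in> Cpt ` S \<inter> - {Cpt 0}. ?F z \<in> - {Infty}}"
        by (rule holomorphic_on_subset[OF hi]) auto
      then show ?thesis
        unfolding 2 c' chart_inv_inverse by (simp add: o_def inv)
    next
      case c': 2
      have "(\<lambda>z. 1 / f (1 / z)) holomorphic_on inverse_coord ` {z \<in> Cpt ` S \<inter> - {Cpt 0}. ?F z \<in> - {Cpt 0}}"
        by (intro holomorphic_intros holomorphic_on_subset[OF hi]) auto
      then show ?thesis
        unfolding 2 c' chart_inv_inverse by (simp add: o_def inv)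
    qed
  qed
  show ?thesis
    unfolding cp1_holomorphic_on_def using cont hol by blast
qed

section \<open>The Schwarzian derivative\<close>

lemma schwarzian_deriv:
  "schwarzian f z = deriv (deriv (deriv f)) z / deriv f z - 3 / 2 * (deriv (deriv f) z / deriv f z)\<^sup>2"
  by (simp add: schwarzian_def numeral_3_eq_3 numeral_2_eq_2)

lemma deriv_eq_on_open:
  assumes "open U" "z \<in> U" "\<And>z. z \<in> U \<Longrightarrow> f z = g z"
  shows "deriv f z = deriv g z"
proof (rule deriv_cong_ev)
  show "\<forall>\<^sub>F x in nhds z. f x = g x"
    using assms eventually_nhds by blast
qed simp

lemma schwarzian_cong:
  assumes "open U" "\<And>z. z \<in> U \<Longrightarrow> f z = g z" "z \<in> U"
  shows "schwarzian f z = schwarzian g z"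
proof -
  have 1: "deriv f z = deriv g z" if "z \<in> U" for z
    by (rule deriv_eq_on_open[OF assms(1) that]) (rule assms(2))
  have 2: "deriv (deriv f) z = deriv (deriv g) z" if "z \<in> U" for z
    by (rule deriv_eq_on_open[OF assms(1) that]) (rule 1)
  have 3: "deriv (deriv (deriv f)) z = deriv (deriv (deriv g)) z"
    by (rule deriv_eq_on_open[OF assms(1,3)]) (rule 2)
  show ?thesis
    using 1[OF assms(3)] 2[OF assms(3)] 3 by (simp add: schwarzian_deriv)
qed

lemma holomorphic_on_schwarzian:
  assumes "open U" "f holomorphic_on U" "\<And>z. z \<in> U \<Longrightarrow> deriv f z \<noteq> 0"
  shows "schwarzian f holomorphic_on U"
proof -
  have "(\<lambda>z. deriv (deriv (deriv f)) z / deriv f z - 3 / 2 * (deriv (deriv f) z / deriv f z)\<^sup>2)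
      holomorphic_on U"
    using assms by (intro holomorphic_intros holomorphic_deriv) auto
  then show ?thesis
    by (rule holomorphic_transform) (simp add: schwarzian_deriv)
qed

text \<open>In the Schwarzian derivative of the composite, the terms that contain both \<open>f''\<close> and \<open>g''\<close> cancel. What is
  left is the cocycle property on which the affine structure is built.\<close>

lemma schwarzian_compose:
  assumes U: "open U" "f holomorphic_on U" and V: "open V" "g holomorphic_on V" "f ` U \<subseteq> V"
    and z: "z \<in> U" "deriv f z \<noteq> 0" "deriv g (f z) \<noteq> 0"
  shows "schwarzian (\<lambda>x. g (f x)) z = schwarzian g (f z) * (deriv f z)\<^sup>2 + schwarzian f z"
proof -
  define f1 f2 f3 where "f1 = deriv f" and "f2 = deriv f1" and "f3 = deriv f2"
  define g1 g2 g3 where "g1 = deriv g" and "g2 = deriv g1" and "g3 = deriv g2"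
  have hol: "f1 holomorphic_on U" "f2 holomorphic_on U" "g1 holomorphic_on V" "g2 holomorphic_on V"
    unfolding f1_def f2_def g1_def g2_def by (intro holomorphic_deriv U V)+
  have df: "(f has_field_derivative f1 x) (at x)" "(f1 has_field_derivative f2 x) (at x)"
      "(f2 has_field_derivative f3 x) (at x)" if "x \<in> U" for x
    using holomorphic_derivI[OF U(2,1) that] holomorphic_derivI[OF hol(1) U(1) that]
      holomorphic_derivI[OF hol(2) U(1) that] by (simp_all only: f1_def f2_def f3_def)
  have dg: "((\<lambda>x. g (f x)) has_field_derivative g1 (f x) * f1 x) (at x)"
      "((\<lambda>x. g1 (f x)) has_field_derivative g2 (f x) * f1 x) (at x)"
      "((\<lambda>x. g2 (f x)) has_field_derivative g3 (f x) * f1 x) (at x)" if "x \<in> U" for x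
  proof -
    have fx: "f x \<in> V"
      using that V(3) by auto
    show "((\<lambda>x. g (f x)) has_field_derivative g1 (f x) * f1 x) (at x)"
      unfolding g1_def by (rule DERIV_chain2[OF holomorphic_derivI[OF V(2,1) fx] df(1)[OF that]])
    show "((\<lambda>x. g1 (f x)) has_field_derivative g2 (f x) * f1 x) (at x)"
      unfolding g2_def by (rule DERIV_chain2[OF holomorphic_derivI[OF hol(3) V(1) fx] df(1)[OF that]])
    show "((\<lambda>x. g2 (f x)) has_field_derivative g3 (f x) * f1 x) (at x)"
      unfolding g3_def by (rule DERIV_chain2[OF holomorphic_derivI[OF hol(4) V(1) fx] df(1)[OF that]])
  qed
  have 1: "deriv (\<lambda>x. g (f x)) x = g1 (f x) * f1 x" if "x \<in> U" for x
    using dg(1)[OF that] by (rule DERIV_imp_deriv)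
  have 2: "deriv (deriv (\<lambda>x. g (f x))) x = g2 (f x) * (f1 x)\<^sup>2 + g1 (f x) * f2 x" if "x \<in> U" for x
  proof -
    have "((\<lambda>x. g1 (f x) * f1 x) has_field_derivative
        g2 (f x) * f1 x * f1 x + f2 x * g1 (f x)) (at x)"
      by (rule DERIV_mult[OF dg(2) df(2)]) (use that in auto)
    from DERIV_imp_deriv[OF this]
    have "deriv (\<lambda>x. g1 (f x) * f1 x) x = g2 (f x) * (f1 x)\<^sup>2 + g1 (f x) * f2 x"
      by (simp add: power2_eq_square algebra_simps)
    moreover have "deriv (deriv (\<lambda>x. g (f x))) x = deriv (\<lambda>x. g1 (f x) * f1 x) x"
      by (rule deriv_eq_on_open[OF U(1) that]) (rule 1)
    ultimately show ?thesis
      by simp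
  qed
  have 3: "deriv (deriv (deriv (\<lambda>x. g (f x)))) z
      = g3 (f z) * (f1 z)^3 + 3 * g2 (f z) * f1 z * f2 z + g1 (f z) * f3 z"
  proof -
    have "((\<lambda>x. g2 (f x) * (f1 x)\<^sup>2 + g1 (f x) * f2 x) has_field_derivative
        g3 (f z) * f1 z * (f1 z)\<^sup>2 + (2 * f1 z * f2 z) * g2 (f z) + (g2 (f z) * f1 z * f2 z + f3 z * g1 (f z))) (at z)"
      by (rule DERIV_add[OF DERIV_mult DERIV_mult]) (use dg df z(1) in \<open>auto intro!: derivative_eq_intros\<close>)
    from DERIV_imp_deriv[OF this]
    have "deriv (\<lambda>x. g2 (f x) * (f1 x)\<^sup>2 + g1 (f x) * f2 x) z
        = g3 (f z) * (f1 z)^3 + 3 * g2 (f z) * f1 z * f2 z + g1 (f z) * f3 z"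
      by (simp add: power2_eq_square power3_eq_cube algebra_simps)
    moreover have "deriv (deriv (deriv (\<lambda>x. g (f x)))) z = deriv (\<lambda>x. g2 (f x) * (f1 x)\<^sup>2 + g1 (f x) * f2 x) z"
      by (rule deriv_eq_on_open[OF U(1) z(1)]) (rule 2)
    ultimately show ?thesis
      by simp
  qed
  have nz: "f1 z \<noteq> 0" "g1 (f z) \<noteq> 0"
    using z by (simp_all add: f1_def g1_def)
  have S: "schwarzian f z = f3 z / f1 z - 3 / 2 * (f2 z / f1 z)\<^sup>2"
    "schwarzian g (f z) = g3 (f z) / g1 (f z) - 3 / 2 * (g2 (f z) / g1 (f z))\<^sup>2"
    unfolding schwarzian_deriv f1_def f2_def f3_def g1_def g2_def g3_def by simp_all
  have "schwarzian (\<lambda>x. g (f x)) z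
      = (g3 (f z) * (f1 z)^3 + 3 * g2 (f z) * f1 z * f2 z + g1 (f z) * f3 z) / (g1 (f z) * f1 z)
        - 3 / 2 * ((g2 (f z) * (f1 z)\<^sup>2 + g1 (f z) * f2 z) / (g1 (f z) * f1 z))\<^sup>2"
    by (simp only: schwarzian_deriv 3 2[OF z(1)] 1[OF z(1)])
  also have "\<dots> = (g3 (f z) / g1 (f z) - 3 / 2 * (g2 (f z) / g1 (f z))\<^sup>2) * (f1 z)\<^sup>2
        + (f3 z / f1 z - 3 / 2 * (f2 z / f1 z)\<^sup>2)"
    using nz by (simp add: divide_simps) algebra
  finally show ?thesis
    unfolding S f1_def[symmetric] .
qed

text \<open>If \<open>f' = 1 / u\<^sup>2\<close> then \<open>f'' / f' = - 2 u' / u\<close>, and in the Schwarzian derivative the squares of \<open>u' / u\<close>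
  cancel. The nonlinear equation \<open>schwarzian f = h\<close> thus becomes \<open>u'' = - (h / 2) u\<close>, which is linear.\<close>

lemma schwarzian_inverse_square:
  assumes U: "open U" "u holomorphic_on U" "\<And>z. z \<in> U \<Longrightarrow> u z \<noteq> 0"
    and f: "\<And>z. z \<in> U \<Longrightarrow> (f has_field_derivative 1 / (u z)\<^sup>2) (at z)"
    and z: "z \<in> U"
  shows "schwarzian f z = - 2 * deriv (deriv u) z / u z"
proof -
  define u1 u2 where "u1 = deriv u" and "u2 = deriv u1"
  have du: "(u has_field_derivative u1 x) (at x)" "(u1 has_field_derivative u2 x) (at x)" if "x \<in> U" for x
    unfolding u2_def using holomorphic_derivI[OF U(2,1) that]
      holomorphic_derivI[OF holomorphic_deriv[OF U(2,1)] U(1) that] by (simp_all add: u1_def)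
  have 1: "deriv f x = 1 / (u x)\<^sup>2" if "x \<in> U" for x
    using f[OF that] by (rule DERIV_imp_deriv)
  have 2: "deriv (deriv f) x = - 2 * u1 x / (u x)^3" if "x \<in> U" for x
  proof -
    have "((\<lambda>x. 1 / (u x)\<^sup>2) has_field_derivative - 2 * u1 x / (u x)^3) (at x)"
      using U(3)[OF that]
      by (auto intro!: derivative_eq_intros du that simp: field_simps power2_eq_square power3_eq_cube)
    moreover have "deriv (deriv f) x = deriv (\<lambda>x. 1 / (u x)\<^sup>2) x"
      by (rule deriv_eq_on_open[OF U(1) that]) (rule 1)
    ultimately show ?thesis
      using DERIV_imp_deriv by simp
  qed
  have 3: "deriv (deriv (deriv f)) z = - 2 * u2 z / (u z)^3 + 6 * (u1 z)\<^sup>2 / (u z)^4"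
  proof -
    have "((\<lambda>x. - 2 * u1 x / (u x)^3) has_field_derivative
        ((- 2 * u2 z) * (u z)^3 - (- 2 * u1 z) * (3 * (u z)\<^sup>2 * u1 z)) / ((u z)^3 * (u z)^3)) (at z)"
      by (rule DERIV_divide)
         (use U(3)[OF z] in \<open>auto intro!: derivative_eq_intros du z simp: numeral_2_eq_2\<close>)
    from DERIV_imp_deriv[OF this]
    have "deriv (\<lambda>x. - 2 * u1 x / (u x)^3) z
        = ((- 2 * u2 z) * (u z)^3 - (- 2 * u1 z) * (3 * (u z)\<^sup>2 * u1 z)) / ((u z)^3 * (u z)^3)" .
    also have "\<dots> = - 2 * u2 z / (u z)^3 + 6 * (u1 z)\<^sup>2 / (u z)^4"
      using U(3)[OF z] by (simp add: divide_simps) algebra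
    also have "deriv (\<lambda>x. - 2 * u1 x / (u x)^3) z = deriv (deriv (deriv f)) z"
      by (rule deriv_eq_on_open[OF U(1) z, symmetric]) (rule 2)
    finally show ?thesis .
  qed
  show ?thesis
    unfolding schwarzian_deriv 3 2[OF z] 1[OF z] u1_def[symmetric] u2_def[symmetric]
    using U(3)[OF z] by (simp add: divide_simps) algebra
qed

lemma moebius_has_derivative:
  fixes a b c d z :: complex
  assumes "a * d - b * c = 1" "c * z + d \<noteq> 0"
  shows "((\<lambda>z. (a * z + b) / (c * z + d)) has_field_derivative 1 / (c * z + d)\<^sup>2) (at z)"
proof -
  have "((\<lambda>z. (a * z + b) / (c * z + d)) has_field_derivative
      (a * (c * z + d) - (a * z + b) * c) / ((c * z + d) * (c * z + d))) (at z)"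
    using assms(2) by (auto intro!: derivative_eq_intros)
  moreover have "a * (c * z + d) - (a * z + b) * c = 1"
    using assms(1) by algebra
  ultimately show ?thesis
    by (simp add: power2_eq_square)
qed

lemma schwarzian_moebius:
  fixes a b c d :: complex
  assumes U: "open U" "z \<in> U" and det: "a * d - b * c = 1"
    and f: "\<And>x. x \<in> U \<Longrightarrow> c * x + d \<noteq> 0 \<and> f x = (a * x + b) / (c * x + d)"
  shows "schwarzian f z = 0"
proof -
  have d1: "deriv (\<lambda>x. c * x + d) = (\<lambda>x. c)"
    by (rule ext, rule DERIV_imp_deriv) (auto intro!: derivative_eq_intros)
  have "schwarzian (\<lambda>x. (a * x + b) / (c * x + d)) z
      = - 2 * deriv (deriv (\<lambda>x. c * x + d)) z / (c * z + d)"
    by (rule schwarzian_inverse_square[OF U(1) _ _ _ U(2)])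
       (use f det in \<open>auto intro!: holomorphic_intros moebius_has_derivative\<close>)
  then show ?thesis
    using schwarzian_cong[OF U(1) _ U(2), of f] f by (simp add: d1)
qed

text \<open>On a disc, \<open>f'\<close> has a holomorphic square root, so \<open>f' = 1 / u\<^sup>2\<close> for some \<open>u\<close>. The hypothesis says \<open>u'' = 0\<close>,
  that is \<open>u = c z + d\<close>, and a primitive of \<open>1 / (c z + d)\<^sup>2\<close> is a Moebius transformation.\<close>

lemma schwarzian_zero_imp_moebius:
  assumes f: "f holomorphic_on ball z0 r" "\<And>z. z \<in> ball z0 r \<Longrightarrow> deriv f z \<noteq> 0"
    and S: "\<And>z. z \<in> ball z0 r \<Longrightarrow> schwarzian f z = 0" and r: "r > 0"
  obtains a b c d where "a * d - b * c = 1"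
    "\<And>z. z \<in> ball z0 r \<Longrightarrow> c * z + d \<noteq> 0 \<and> f z = (a * z + b) / (c * z + d)"
proof -
  let ?B = "ball z0 r"
  obtain v where v: "v holomorphic_on ?B" "\<And>z. z \<in> ?B \<Longrightarrow> deriv f z = (v z)\<^sup>2"
    using contractible_imp_holomorphic_sqrt[OF holomorphic_deriv[OF f(1) open_ball] _ f(2)]
    by (metis convex_ball convex_imp_contractible)
  define u where "u = (\<lambda>z. 1 / v z)"
  have vnz: "v z \<noteq> 0" if "z \<in> ?B" for z
    using v(2)[OF that] f(2)[OF that] by auto
  have unz: "u z \<noteq> 0" if "z \<in> ?B" for z
    using vnz[OF that] by (simp add: u_def)
  have u: "u holomorphic_on ?B"
    unfolding u_def using v(1) vnz by (intro holomorphic_intros) auto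
  have df: "(f has_field_derivative 1 / (u z)\<^sup>2) (at z)" if "z \<in> ?B" for z
    using holomorphic_derivI[OF f(1) open_ball that] v(2)[OF that] by (simp add: u_def power_divide)
  have ddu: "deriv (deriv u) z = 0" if "z \<in> ?B" for z
    using schwarzian_inverse_square[OF open_ball u unz df that] S[OF that] unz[OF that] by simp
  have u': "deriv u holomorphic_on ?B"
    by (rule holomorphic_deriv[OF u open_ball])
  obtain c where c: "\<And>z. z \<in> ?B \<Longrightarrow> deriv u z = c"
  proof -
    have "(deriv u has_field_derivative 0) (at z within ?B)" if "z \<in> ?B" for z
      using holomorphic_derivI[OF u' open_ball that] ddu[OF that]
      by (simp add: has_field_derivative_at_within)
    then have "\<exists>c. \<forall>z\<in>?B. deriv u z = c"
      by (rule has_field_derivative_zero_constant[OF convex_ball])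
    then show ?thesis
      using that by blast
  qed
  obtain d where d: "\<And>z. z \<in> ?B \<Longrightarrow> u z = c * z + d"
  proof -
    have "((\<lambda>z. u z - c * z) has_field_derivative 0) (at z within ?B)" if "z \<in> ?B" for z
    proof -
      have "((\<lambda>z. u z - c * z) has_field_derivative c - c * 1) (at z)"
        using holomorphic_derivI[OF u open_ball that] c[OF that]
        by (intro DERIV_diff DERIV_cmult DERIV_ident) simp
      then show ?thesis
        by (simp add: has_field_derivative_at_within)
    qed
    then have "\<exists>d. \<forall>z\<in>?B. u z - c * z = d"
      by (rule has_field_derivative_zero_constant[OF convex_ball])
    then obtain d where d: "\<forall>z\<in>?B. u z - c * z = d"
      by blast
    show ?thesis
      by (rule that[of d]) (use d in \<open>auto simp: algebra_simps\<close>)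
  qed
  have z0: "z0 \<in> ?B"
    using r by simp
  define u0 where "u0 = c * z0 + d"
  have u0: "u0 \<noteq> 0"
    using unz[OF z0] d[OF z0] by (simp add: u0_def)
  \<comment> \<open>The primitive of \<open>1 / (c z + d)\<^sup>2\<close> vanishing at \<open>z0\<close> is \<open>(z - z0) / (u0 (c z + d))\<close>.\<close>
  obtain k where k: "\<And>z. z \<in> ?B \<Longrightarrow> f z - (z - z0) / (u0 * (c * z + d)) = k"
  proof -
    have "((\<lambda>z. f z - (z - z0) / (u0 * (c * z + d))) has_field_derivative 0) (at z within ?B)"
      if "z \<in> ?B" for z
    proof -
      have nz: "c * z + d \<noteq> 0"
        using unz[OF that] d[OF that] by simp
      have "((\<lambda>z. (z - z0) / (u0 * (c * z + d))) has_field_derivative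
          (u0 * (c * z + d) - (z - z0) * (u0 * c)) / ((u0 * (c * z + d)) * (u0 * (c * z + d)))) (at z)"
        using nz u0 by (auto intro!: derivative_eq_intros)
      moreover have "(u0 * (c * z + d) - (z - z0) * (u0 * c)) / ((u0 * (c * z + d)) * (u0 * (c * z + d)))
          = 1 / (u z)\<^sup>2"
      proof -
        have "u0 * (c * z + d) - (z - z0) * (u0 * c) = u0 * u0"
          unfolding u0_def by algebra
        then show ?thesis
          using nz u0 d[OF that] by (simp add: power2_eq_square)
      qed
      ultimately have "((\<lambda>z. f z - (z - z0) / (u0 * (c * z + d))) has_field_derivative
          1 / (u z)\<^sup>2 - 1 / (u z)\<^sup>2) (at z)"
        using df[OF that] by (intro DERIV_diff) simp_all
      then show ?thesis
        by (simp add: has_field_derivative_at_within)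
    qed
    then have "\<exists>k. \<forall>z\<in>?B. f z - (z - z0) / (u0 * (c * z + d)) = k"
      by (rule has_field_derivative_zero_constant[OF convex_ball])
    then show ?thesis
      using that by blast
  qed
  show ?thesis
  proof (rule that)
    show "(k * c + 1 / u0) * d - (k * d - z0 / u0) * c = 1"
      using u0 by (simp add: field_simps) (simp add: u0_def algebra_simps)
    show "c * z + d \<noteq> 0 \<and> f z = ((k * c + 1 / u0) * z + (k * d - z0 / u0)) / (c * z + d)" if "z \<in> ?B" for z
    proof
      show nz: "c * z + d \<noteq> 0"
        using unz[OF that] d[OF that] by simp
      have "f z = k + (z - z0) / (u0 * (c * z + d))"
        using k[OF that] by (simp add: algebra_simps)
      also have "\<dots> = ((k * c + 1 / u0) * z + (k * d - z0 / u0)) / (c * z + d)"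
        using nz u0 by (simp add: divide_simps) algebra
      finally show "f z = \<dots>" .
    qed
  qed
qed

text \<open>If \<open>g k\<close> are the Taylor coefficients of a function \<open>G\<close>, these are the Taylor coefficients of the solution
  of \<open>u'' = - G u\<close> with \<open>u(0) = 1\<close> and \<open>u'(0) = 0\<close>.\<close>

fun linear_ode_coeff :: "(nat \<Rightarrow> complex) \<Rightarrow> nat \<Rightarrow> complex" where
  "linear_ode_coeff g 0 = 1"
| "linear_ode_coeff g (Suc 0) = 0"
| "linear_ode_coeff g (Suc (Suc n)) =
     - (\<Sum>k\<le>n. g k * linear_ode_coeff g (n - k)) / (of_nat (Suc n) * of_nat (Suc (Suc n)))"

text \<open>The exponent \<open>k + 2\<close> matches the shift by two in the recursion: each of the \<open>n + 1\<close> summands is at most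
  \<open>K ^ (n + 2)\<close>, and their number is compensated by the denominator. So the same \<open>K\<close> works at every step.\<close>

lemma linear_ode_coeff_bound:
  assumes g: "\<And>k. norm (g k) \<le> K ^ (k + 2)" and K: "K \<ge> 1"
  shows "norm (linear_ode_coeff g n) \<le> K ^ n"
proof (induction n rule: less_induct)
  case (less n)
  consider "n = 0" | "n = Suc 0" | m where "n = Suc (Suc m)"
    by (metis not0_implies_Suc)
  then show ?case
  proof cases
    case 3
    have "norm (\<Sum>k\<le>m. g k * linear_ode_coeff g (m - k)) \<le> (\<Sum>k\<le>m. K ^ (m + 2))"
    proof (rule sum_norm_le)
      fix k assume "k \<in> {..m}"
      then have k: "k \<le> m" by simp
      have "norm (g k * linear_ode_coeff g (m - k)) \<le> K ^ (k + 2) * K ^ (m - k)"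
        unfolding norm_mult using g[of k] less.IH[of "m - k"] 3 K
        by (intro mult_mono) auto
      also have "\<dots> = K ^ (m + 2)"
        using k by (simp flip: power_add)
      finally show "norm (g k * linear_ode_coeff g (m - k)) \<le> K ^ (m + 2)" .
    qed
    then have sum: "norm (\<Sum>k\<le>m. g k * linear_ode_coeff g (m - k)) \<le> real (Suc m) * K ^ (m + 2)"
      by simp
    have "norm (linear_ode_coeff g n)
        = norm (\<Sum>k\<le>m. g k * linear_ode_coeff g (m - k)) / (real (Suc m) * real (Suc (Suc m)))"
      unfolding 3 linear_ode_coeff.simps norm_divide norm_minus_cancel norm_mult norm_of_nat ..
    also have "\<dots> \<le> real (Suc m) * K ^ (m + 2) / (real (Suc m) * real (Suc (Suc m)))"
      by (rule divide_right_mono[OF sum]) simp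
    also have "\<dots> = K ^ (m + 2) / real (Suc (Suc m))"
      by (simp add: divide_simps)
    also have "\<dots> \<le> K ^ (m + 2) / 1"
      by (rule divide_left_mono) (use K in auto)
    finally show ?thesis
      by (simp add: 3)
  qed (use K in auto)
qed

lemma fps_coeff_power_bound:
  fixes G :: "complex fps"
  assumes "fps_conv_radius G > 0"
  obtains K :: real where "K \<ge> 1" "\<And>k. norm (fps_nth G k) \<le> K ^ (k + 2)"
proof -
  obtain r where r: "0 < r" "ereal r < fps_conv_radius G"
    using assms by (metis ereal_dense2 ereal_less(2) less_ereal.simps(1) zero_ereal_def)
  have "summable (\<lambda>n. fps_nth G n * of_real r ^ n)"
    by (rule summable_fps) (use r in auto)
  then have "(\<lambda>n. fps_nth G n * of_real r ^ n) \<longlonglongrightarrow> 0"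
    by (rule summable_LIMSEQ_zero)
  then have "Bseq (\<lambda>n. fps_nth G n * of_real r ^ n)"
    using convergentI convergent_imp_Bseq by blast
  then obtain B where B: "B > 0" "\<And>n. norm (fps_nth G n * of_real r ^ n) \<le> B"
    using BseqD by blast
  define K where "K = max 1 (max B (1 / r))"
  have K: "K \<ge> 1" "K \<ge> B" "K \<ge> 1 / r"
    by (auto simp: K_def)
  have "norm (fps_nth G k) \<le> K ^ (k + 2)" for k
  proof -
    have "norm (fps_nth G k) * r ^ k \<le> B"
      using B(2)[of k] r(1) by (simp add: norm_mult norm_power)
    then have "norm (fps_nth G k) \<le> B * (1 / r) ^ k"
      using r(1) by (simp add: field_simps power_divide)
    also have "\<dots> \<le> K * K ^ k"
      using K B(1) r(1) by (intro mult_mono power_mono) auto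
    also have "\<dots> \<le> K ^ (k + 2)"
      using K(1) by (simp add: mult_left_mono mult_right_mono power_increasing flip: power_Suc)
    finally show ?thesis .
  qed
  with K(1) that show ?thesis by blast
qed

lemma linear_ode_solution:
  assumes "open U" "g holomorphic_on U" "z0 \<in> U"
  obtains u r where "r > 0" "ball z0 r \<subseteq> U" "u holomorphic_on ball z0 r" "u z0 = 1"
    "\<And>z. z \<in> ball z0 r \<Longrightarrow> deriv (deriv u) z = - g z * u z"
proof -
  have "g analytic_on {z0}"
    using assms analytic_at by blast
  then have exp: "(\<lambda>x. g (z0 + x)) has_fps_expansion fps_expansion g z0"
    by (rule analytic_at_imp_has_fps_expansion)
  define G where "G = fps_expansion g z0"
  have Gr: "fps_conv_radius G > 0" and "\<forall>\<^sub>F x in nhds 0. eval_fps G x = g (z0 + x)"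
    using exp unfolding G_def has_fps_expansion_def by auto
  then obtain e where e: "e > 0" "\<And>x. norm x < e \<Longrightarrow> eval_fps G x = g (z0 + x)"
    unfolding eventually_nhds_metric by (auto simp: dist_norm)
  obtain e' where e': "e' > 0" "ball z0 e' \<subseteq> U"
    using assms open_contains_ball by blast
  obtain K where K: "K \<ge> 1" "\<And>k. norm (fps_nth G k) \<le> K ^ (k + 2)"
    by (rule fps_coeff_power_bound[OF Gr]) (rule that)
  define V where "V = Abs_fps (linear_ode_coeff (fps_nth G))"
  have "conv_radius (fps_nth V) \<ge> ereal (1 / K)"
  proof (rule conv_radius_geI_ex')
    fix r :: real assume r: "0 < r" "ereal r < ereal (1 / K)"
    show "summable (\<lambda>n. fps_nth V n * of_real r ^ n)"
    proof (rule summable_comparison_test')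
      show "summable (\<lambda>n. (K * r) ^ n)"
        using r K(1) by (intro summable_geometric) (simp add: field_simps)
      show "norm (fps_nth V n * of_real r ^ n) \<le> (K * r) ^ n" if "n \<ge> 0" for n
        using linear_ode_coeff_bound[OF K(2,1), of n] r(1)
        by (simp add: V_def norm_mult norm_power power_mult_distrib mult_right_mono)
    qed
  qed
  then have Vr: "fps_conv_radius V \<ge> ereal (1 / K)"
    by (simp add: fps_conv_radius_def)
  have ode: "fps_deriv (fps_deriv V) = - (G * V)"
  proof (rule fps_ext)
    fix n
    have "fps_nth (fps_deriv (fps_deriv V)) n
        = of_nat (Suc n) * (of_nat (Suc (Suc n)) * linear_ode_coeff (fps_nth G) (Suc (Suc n)))"
      by (simp add: V_def fps_deriv_nth)
    also have "\<dots> = - (\<Sum>k\<le>n. fps_nth G k * linear_ode_coeff (fps_nth G) (n - k))"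
    proof -
      have "(of_nat (Suc n) :: complex) \<noteq> 0" "(of_nat (Suc (Suc n)) :: complex) \<noteq> 0"
        using of_nat_neq_0 by blast+
      moreover have "p * (q * (- s / (p * q))) = - s" if "p \<noteq> 0" "q \<noteq> 0" for p q s :: complex
        using that by simp
      ultimately show ?thesis
        unfolding linear_ode_coeff.simps by blast
    qed
    also have "\<dots> = fps_nth (- (G * V)) n"
      by (simp add: fps_mult_nth V_def atMost_atLeast0)
    finally show "fps_nth (fps_deriv (fps_deriv V)) n = fps_nth (- (G * V)) n" .
  qed
  obtain r0 where r0: "0 < r0" "ereal r0 < fps_conv_radius G"
    using Gr by (metis ereal_dense2 ereal_less(2) less_ereal.simps(1) zero_ereal_def)
  define r where "r = min (min e e') (min r0 (1 / K))"
  have r: "r > 0" "r \<le> e" "r \<le> e'" "r \<le> r0" "r \<le> 1 / K"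
    using e(1) e'(1) r0(1) K(1) by (auto simp: r_def)
  define u where "u = (\<lambda>z. eval_fps V (z - z0))"
  have inV: "ereal (norm (z - z0)) < fps_conv_radius V" and inG: "ereal (norm (z - z0)) < fps_conv_radius G"
    if "z \<in> ball z0 r" for z
  proof -
    have n: "norm (z - z0) < r"
      using that by (simp add: dist_norm norm_minus_commute)
    have "ereal (norm (z - z0)) < ereal (1 / K)"
      using n r(5) by simp
    then show "ereal (norm (z - z0)) < fps_conv_radius V"
      using Vr by (rule less_le_trans)
    have "ereal (norm (z - z0)) < ereal r0"
      using n r(4) by simp
    then show "ereal (norm (z - z0)) < fps_conv_radius G"
      using r0(2) by (rule less_trans)
  qed
  have shift: "((\<lambda>z. eval_fps W (z - z0)) has_field_derivative eval_fps (fps_deriv W) (z - z0)) (at z)"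
    if "ereal (norm (z - z0)) < fps_conv_radius W" for W z
  proof -
    have "((\<lambda>z. eval_fps W (z - z0)) has_field_derivative eval_fps (fps_deriv W) (z - z0) * 1) (at z)"
    proof (rule DERIV_chain2[where f = "eval_fps W" and g = "\<lambda>z. z - z0"])
      show "(eval_fps W has_field_derivative eval_fps (fps_deriv W) (z - z0)) (at (z - z0))"
        by (rule has_field_derivative_eval_fps) (use that in simp)
      show "((\<lambda>z. z - z0) has_field_derivative 1) (at z)"
        by (auto intro!: derivative_eq_intros)
    qed
    then show ?thesis by simp
  qed
  have du: "(u has_field_derivative eval_fps (fps_deriv V) (z - z0)) (at z)" if "z \<in> ball z0 r" for z
    unfolding u_def by (rule shift[OF inV[OF that]])
  have ddu: "((\<lambda>z. eval_fps (fps_deriv V) (z - z0)) has_field_derivative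
      eval_fps (fps_deriv (fps_deriv V)) (z - z0)) (at z)" if "z \<in> ball z0 r" for z
    by (rule shift) (use inV[OF that] fps_conv_radius_deriv[of V] in \<open>auto intro: less_le_trans\<close>)
  have "u holomorphic_on ball z0 r"
    unfolding holomorphic_on_open[OF open_ball] using du by blast
  moreover have "u z0 = 1"
    by (simp add: u_def V_def eval_fps_at_0)
  moreover have "deriv (deriv u) z = - g z * u z" if "z \<in> ball z0 r" for z
  proof -
    have "deriv (deriv u) z = deriv (\<lambda>z. eval_fps (fps_deriv V) (z - z0)) z"
      by (rule deriv_eq_on_open[OF open_ball that]) (rule DERIV_imp_deriv[OF du])
    also have "\<dots> = eval_fps (fps_deriv (fps_deriv V)) (z - z0)"
      by (rule DERIV_imp_deriv[OF ddu[OF that]])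
    also have "\<dots> = eval_fps ((- G) * V) (z - z0)"
      unfolding ode by simp
    also have "\<dots> = - (eval_fps G (z - z0) * eval_fps V (z - z0))"
      using inV[OF that] inG[OF that] by (subst eval_fps_mult) (simp_all add: eval_fps_minus)
    also have "eval_fps G (z - z0) = g z"
      using e(2)[of "z - z0"] that r(2) by (simp add: dist_norm norm_minus_commute)
    finally show ?thesis
      by (simp add: u_def)
  qed
  moreover have "ball z0 r \<subseteq> U"
    using e'(2) r(3) by (meson subset_ball subset_trans)
  ultimately show ?thesis
    using that r(1) by blast
qed

text \<open>The function \<open>\<phi>\<close> is a primitive of \<open>1 / u\<^sup>2\<close>, where \<open>u'' = - (h / 2) u\<close> and \<open>u(z0) = 1\<close>.\<close>

lemma schwarzian_solution:
  assumes "open U" "h holomorphic_on U" "z0 \<in> U"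
  obtains \<phi> r where "r > 0" "ball z0 r \<subseteq> U" "\<phi> holomorphic_on ball z0 r" "inj_on \<phi> (ball z0 r)"
    "\<And>z. z \<in> ball z0 r \<Longrightarrow> deriv \<phi> z \<noteq> 0"
    "\<And>z. z \<in> ball z0 r \<Longrightarrow> schwarzian \<phi> z = h z"
proof -
  have half: "(\<lambda>z. h z / 2) holomorphic_on U"
    using assms(2) by (intro holomorphic_intros) auto
  obtain u r where u: "r > 0" "ball z0 r \<subseteq> U" "u holomorphic_on ball z0 r" "u z0 = 1"
      "\<And>z. z \<in> ball z0 r \<Longrightarrow> deriv (deriv u) z = - (h z / 2) * u z"
    by (rule linear_ode_solution[OF assms(1) half assms(3)]) (rule that)
  have "continuous (at z0) u"
  proof -
    have "\<forall>z\<in>ball z0 r. isCont u z"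
      using holomorphic_on_imp_continuous_on[OF u(3)] by (simp add: continuous_on_eq_continuous_at)
    then show ?thesis
      using u(1) by simp
  qed
  moreover have "u z0 \<noteq> 0"
    using u(4) by simp
  ultimately obtain s where s: "s > 0" "\<And>z. z \<in> ball z0 s \<Longrightarrow> u z \<noteq> 0"
    using continuous_at_avoid[of z0 u 0] by auto
  define t where "t = min r s"
  have t: "t > 0" "ball z0 t \<subseteq> ball z0 r" "ball z0 t \<subseteq> ball z0 s"
    using u(1) s(1) by (auto simp: t_def)
  have ut: "u holomorphic_on ball z0 t" "\<And>z. z \<in> ball z0 t \<Longrightarrow> u z \<noteq> 0"
    using u(3) t(2,3) s(2) holomorphic_on_subset by auto
  have "(\<lambda>z. 1 / (u z)\<^sup>2) holomorphic_on ball z0 t"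
    using ut by (intro holomorphic_intros) auto
  then obtain \<phi> where "\<And>z. z \<in> ball z0 t \<Longrightarrow> (\<phi> has_field_derivative 1 / (u z)\<^sup>2) (at z within ball z0 t)"
    using holomorphic_convex_primitive'[OF convex_ball open_ball] by blast
  then have \<phi>: "(\<phi> has_field_derivative 1 / (u z)\<^sup>2) (at z)" if "z \<in> ball z0 t" for z
    using that by (metis at_within_open open_ball)
  have hol: "\<phi> holomorphic_on ball z0 t"
    unfolding holomorphic_on_open[OF open_ball] using \<phi> by blast
  have nz: "deriv \<phi> z \<noteq> 0" if "z \<in> ball z0 t" for z
    using DERIV_imp_deriv[OF \<phi>[OF that]] ut(2)[OF that] by simp
  have S: "schwarzian \<phi> z = h z" if "z \<in> ball z0 t" for z
    using schwarzian_inverse_square[OF open_ball ut \<phi> that] u(5)[of z] t(2) that ut(2)[OF that] by auto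
  have z0: "z0 \<in> ball z0 t"
    using t(1) by simp
  obtain q where q: "q > 0" "ball z0 q \<subseteq> ball z0 t" "inj_on \<phi> (ball z0 q)"
    using has_complex_derivative_locally_injective[OF hol z0 open_ball nz[OF z0]] .
  show ?thesis
  proof (rule that[OF q(1) _ _ q(3)])
    show "ball z0 q \<subseteq> U"
      using q(2) t(2) u(2) by blast
    show "\<phi> holomorphic_on ball z0 q"
      by (rule holomorphic_on_subset[OF hol q(2)])
    show "deriv \<phi> z \<noteq> 0" "schwarzian \<phi> z = h z" if "z \<in> ball z0 q" for z
      using that q(2) nz S by auto
  qed
qed

section \<open>Submersions\<close>

lemma cp1_chart_change:
  assumes "c \<in> cp1_atlas" "c' \<in> cp1_atlas"
  obtains f where "f holomorphic_on (snd c ` (fst c \<inter> fst c'))"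
    "\<And>z. z \<in> fst c \<inter> fst c' \<Longrightarrow> snd c' z = f (snd c z)"
    "\<And>z. z \<in> fst c \<inter> fst c' \<Longrightarrow> \<exists>D. D \<noteq> 0 \<and> (f has_field_derivative D) (at (snd c z))"
proof (cases "c = c'")
  case True
  show ?thesis
    by (rule that[of "\<lambda>z. z"]) (use True in \<open>auto intro!: exI[of _ 1]\<close>)
next
  case False
  have nz: "snd c z \<noteq> 0" "snd c' z = 1 / snd c z" if "z \<in> fst c \<inter> fst c'" for z
    using assms that False unfolding cp1_atlas_def by (auto split: cp1.splits)
  have der: "((\<lambda>z. 1 / z) has_field_derivative - 1 / x\<^sup>2) (at x)" if "x \<noteq> 0" for x :: complex
    using that by (auto intro!: derivative_eq_intros simp: power2_eq_square)
  show ?thesis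
  proof (rule that[of "\<lambda>z. 1 / z"])
    show "(\<lambda>z. 1 / z) holomorphic_on (snd c ` (fst c \<inter> fst c'))"
      using nz(1) by (intro holomorphic_intros) auto
    show "\<exists>D. D \<noteq> 0 \<and> ((\<lambda>z. 1 / z) has_field_derivative D) (at (snd c z))"
      if "z \<in> fst c \<inter> fst c'" for z
      by (rule exI[of _ "- 1 / (snd c z)\<^sup>2"]) (use der[OF nz(1)[OF that]] nz(1)[OF that] in simp)
  qed (use nz(2) in auto)
qed

text \<open>The finite-valued counterpart of the charts of a transverse structure. Complex-valued functions can be
  composed with holomorphic functions of a plane domain, with no case distinction at \<open>Infty\<close>.\<close>

definition complex_submersion ::
    "('m::topological_space, 'e::euclidean_space) chart set \<Rightarrow> ('m \<Rightarrow> 'e set) \<Rightarrow>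
     'm set \<Rightarrow> ('m \<Rightarrow> complex) \<Rightarrow> bool" where
  "complex_submersion A F W w \<longleftrightarrow> open W \<and>
     (\<forall>c\<in>A. smooth_on (w \<circ> chart_inv c) (snd c ` (W \<inter> fst c))) \<and>
     (\<forall>p\<in>W. surj (dfun A w p) \<and> {v. dfun A w p v = 0} = F p)"

text \<open>What a transverse datum demands of each chart separately, as opposed to the transition maps.\<close>

definition submersion_chart ::
    "('m::topological_space, 'e::euclidean_space) chart set \<Rightarrow> ('m \<Rightarrow> 'e set) \<Rightarrow>
     'm set \<Rightarrow> ('m \<Rightarrow> cp1) \<Rightarrow> bool" where
  "submersion_chart A F U \<sigma> \<longleftrightarrow> open U \<and> smooth_map A cp1_atlas U \<sigma> \<and> open (\<sigma> ` U) \<and>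
     (\<forall>p\<in>U. surj (tangent_map A cp1_atlas \<sigma> p) \<and> {v. tangent_map A cp1_atlas \<sigma> p v = 0} = F p)"

definition differentiable_at_point ::
    "('m, 'e::euclidean_space) chart set \<Rightarrow> ('m \<Rightarrow> complex) \<Rightarrow> 'm \<Rightarrow> bool" where
  "differentiable_at_point A w p \<longleftrightarrow>
     (w \<circ> chart_inv (chart_at A p)) differentiable (at (snd (chart_at A p) p))"

lemma scaled_functional:
  fixes g :: "'e \<Rightarrow> complex"
  assumes "D \<noteq> 0" "surj g"
  shows "surj (\<lambda>v. D * g v)" "{v. D * g v = 0} = {v. g v = 0}"
proof -
  have "\<exists>v. D * g v = y" for y
    using assms by (metis nonzero_mult_div_cancel_left surjD times_divide_eq_right)
  then show "surj (\<lambda>v. D * g v)"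
    by (metis surjI)
qed (use assms in auto)

lemma open_chart_preimage:
  fixes \<sigma> :: "'m::topological_space \<Rightarrow> cp1"
  assumes "open U" "continuous_on U \<sigma>" "c \<in> cp1_atlas"
  shows "open {p \<in> U. \<sigma> p \<in> fst c}"
proof -
  have "open (\<sigma> -` fst c \<inter> U)"
    using assms open_cp1_chart_domain by (simp add: continuous_on_open_vimage)
  moreover have "\<sigma> -` fst c \<inter> U = {p \<in> U. \<sigma> p \<in> fst c}"
    by auto
  ultimately show ?thesis
    by simp
qed

lemma smooth_on_subset: "smooth_on g S \<Longrightarrow> S' \<subseteq> S \<Longrightarrow> smooth_on g S'"
  unfolding smooth_on_def using C_k_on_subset by blast

lemma smooth_on_imp_differentiable:
  assumes "smooth_on g S" "x \<in> S" shows "g differentiable (at x)"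
proof -
  have "C_k_on (Suc 0) g S"
    using assms(1) unfolding smooth_on_def by blast
  then show ?thesis
    using assms(2) by simp
qed

lemma smooth_on_imp_continuous: "smooth_on g S \<Longrightarrow> continuous_on S g"
  unfolding smooth_on_def using C_k_on.simps(1) by blast

lemma smooth_on_cong:
  assumes "open S" "\<And>x. x \<in> S \<Longrightarrow> f x = g x" "smooth_on f S"
  shows "smooth_on g S"
  unfolding smooth_on_def
proof
  fix k
  show "C_k_on k g S"
    by (rule C_k_on_cong[OF assms(1)], rule assms(2))
       (use assms(3) in \<open>auto simp: smooth_on_def\<close>)
qed

locale smooth_manifold =
  fixes A :: "('m::t2_space, 'e::euclidean_space) chart set"
  assumes atlas: "smooth_atlas A"
begin

lemma chart_at_in: "chart_at A p \<in> A" "p \<in> fst (chart_at A p)"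
proof -
  have "p \<in> (\<Union>c\<in>A. fst c)"
    using atlas unfolding smooth_atlas_def by simp
  then have "\<exists>c. c \<in> A \<and> p \<in> fst c"
    by blast
  from someI_ex[OF this] show "chart_at A p \<in> A" "p \<in> fst (chart_at A p)"
    unfolding chart_at_def by auto
qed

lemma chart_homeomorphism: "c \<in> A \<Longrightarrow> homeomorphism (fst c) (snd c ` fst c) (snd c) (chart_inv c)"
  and open_chart_domain: "c \<in> A \<Longrightarrow> open (fst c)"
  and open_chart_range: "c \<in> A \<Longrightarrow> open (snd c ` fst c)"
  using atlas unfolding smooth_atlas_def by blast+

lemma chart_inv_chart: "c \<in> A \<Longrightarrow> x \<in> fst c \<Longrightarrow> chart_inv c (snd c x) = x"
  using homeomorphism_apply1[OF chart_homeomorphism] .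

lemma open_chart_image:
  assumes "c \<in> A" "open V" shows "open (snd c ` (V \<inter> fst c))"
proof -
  have "openin (top_of_set (fst c)) (V \<inter> fst c)"
    using assms(2) by (auto simp: openin_open)
  then have "openin (top_of_set (snd c ` fst c)) (snd c ` (V \<inter> fst c))"
    by (rule homeomorphism_imp_open_map[OF chart_homeomorphism[OF assms(1)]])
  then show ?thesis
    using open_chart_range[OF assms(1)] openin_open_trans by blast
qed

lemma open_chart_inv_image:
  assumes "c \<in> A" "open B" "B \<subseteq> snd c ` fst c" shows "open (chart_inv c ` B)"
proof -
  have "openin (top_of_set (snd c ` fst c)) B"
    using assms(2,3) by (auto simp: openin_open)
  then have "openin (top_of_set (fst c)) (chart_inv c ` B)"
    using homeomorphism_imp_open_map[of "snd c ` fst c" "fst c" "chart_inv c" "snd c"]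
      chart_homeomorphism[OF assms(1)] homeomorphism_sym by blast
  then show ?thesis
    using open_chart_domain[OF assms(1)] openin_open_trans by blast
qed

text \<open>The set \<open>W\<close> is the inverse image of a small ball under a chart.\<close>

lemma connected_neighbourhood:
  fixes p :: 'm
  assumes "open U" "p \<in> U"
  obtains W where "open W" "connected W" "p \<in> W" "W \<subseteq> U"
proof -
  define c where "c = chart_at A p"
  have c: "c \<in> A" "p \<in> fst c"
    using chart_at_in by (auto simp: c_def)
  have "snd c p \<in> snd c ` (U \<inter> fst c)"
    using assms(2) c by blast
  then obtain e where e: "e > 0" "ball (snd c p) e \<subseteq> snd c ` (U \<inter> fst c)"
    using open_chart_image[OF c(1) assms(1)] open_contains_ball by blast
  show ?thesis
  proof (rule that)
    show "open (chart_inv c ` ball (snd c p) e)"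
      by (rule open_chart_inv_image[OF c(1) open_ball]) (use e in blast)
    have "continuous_on (ball (snd c p) e) (chart_inv c)"
      by (rule continuous_on_subset[OF homeomorphism_cont2[OF chart_homeomorphism[OF c(1)]]])
         (use e(2) in blast)
    then show "connected (chart_inv c ` ball (snd c p) e)"
      using connected_continuous_image connected_ball by blast
    show "p \<in> chart_inv c ` ball (snd c p) e"
      by (rule image_eqI[of _ _ "snd c p"]) (use chart_inv_chart[OF c] e(1) in auto)
    show "chart_inv c ` ball (snd c p) e \<subseteq> U"
    proof
      fix x assume "x \<in> chart_inv c ` ball (snd c p) e"
      then obtain y where y: "y \<in> ball (snd c p) e" "x = chart_inv c y"
        by blast
      then obtain x' where "x' \<in> U \<inter> fst c" "y = snd c x'"
        using e(2) by blast
      then show "x \<in> U"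
        using y(2) chart_inv_chart[OF c(1)] by auto
    qed
  qed
qed

lemma differentiable_at_pointI:
  assumes "open W" "p \<in> W" "\<forall>c\<in>A. smooth_on (w \<circ> chart_inv c) (snd c ` (W \<inter> fst c))"
  shows "differentiable_at_point A w p"
  unfolding differentiable_at_point_def
proof (rule smooth_on_imp_differentiable)
  show "smooth_on (w \<circ> chart_inv (chart_at A p)) (snd (chart_at A p) ` (W \<inter> fst (chart_at A p)))"
    using assms(3) chart_at_in by blast
qed (use assms(2) chart_at_in in blast)

lemma dfun_has_derivative:
  assumes "differentiable_at_point A w p"
  shows "(w \<circ> chart_inv (chart_at A p) has_derivative dfun A w p) (at (snd (chart_at A p) p))"
  using assms unfolding differentiable_at_point_def dfun_def frechet_derivative_works .

lemma dfun_linear: "differentiable_at_point A w p \<Longrightarrow> linear (dfun A w p)"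
  using dfun_has_derivative has_derivative_linear by blast

lemma dfun_compose:
  assumes "open W" "p \<in> W" "differentiable_at_point A w p"
    and f: "(f has_field_derivative D) (at (w p))"
    and eq: "\<And>x. x \<in> W \<Longrightarrow> w' x = f (w x)"
  shows "differentiable_at_point A w' p" and "dfun A w' p = (\<lambda>v. D * dfun A w p v)"
proof -
  define c where "c = chart_at A p"
  have c: "c \<in> A" "p \<in> fst c"
    using chart_at_in by (auto simp: c_def)
  have d: "((\<lambda>y. f ((w \<circ> chart_inv c) y)) has_derivative (\<lambda>v. D * dfun A w p v)) (at (snd c p))"
  proof (rule has_derivative_compose_field[where f = f and g = "w \<circ> chart_inv c"])
    show "(f has_field_derivative D) (at ((w \<circ> chart_inv c) (snd c p)))"
      using f chart_inv_chart[OF c] by simp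
    show "(w \<circ> chart_inv c has_derivative dfun A w p) (at (snd c p))"
      using dfun_has_derivative[OF assms(3)] by (simp add: c_def)
  qed
  have "(w' \<circ> chart_inv c has_derivative (\<lambda>v. D * dfun A w p v)) (at (snd c p))"
  proof (rule has_derivative_transform_within_open[OF d open_chart_image[OF c(1) assms(1)]])
    show "snd c p \<in> snd c ` (W \<inter> fst c)"
      using assms(2) c by blast
    show "f ((w \<circ> chart_inv c) y) = (w' \<circ> chart_inv c) y" if "y \<in> snd c ` (W \<inter> fst c)" for y
      using that eq chart_inv_chart[OF c(1)] by auto
  qed
  then show "differentiable_at_point A w' p" and "dfun A w' p = (\<lambda>v. D * dfun A w p v)"
    using frechet_derivative_at differentiableI
    unfolding differentiable_at_point_def dfun_def c_def by (blast, metis)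
qed

lemma submersion_open: "complex_submersion A F W w \<Longrightarrow> open W"
  unfolding complex_submersion_def by blast

lemma submersion_differentiable:
  "complex_submersion A F W w \<Longrightarrow> p \<in> W \<Longrightarrow> differentiable_at_point A w p"
  unfolding complex_submersion_def using differentiable_at_pointI by blast

lemma submersion_dfun:
  assumes "complex_submersion A F W w" "p \<in> W"
  shows "linear (dfun A w p)" "surj (dfun A w p)" "dfun A w p v = 0 \<longleftrightarrow> v \<in> F p"
  using dfun_linear[OF submersion_differentiable[OF assms]] assms
  unfolding complex_submersion_def by blast+

lemma submersion_continuous:
  assumes "complex_submersion A F W w" shows "continuous_on W w"
proof -
  have "isCont w p" if p: "p \<in> W" for p
  proof -
    define c where "c = chart_at A p"
    have c: "c \<in> A" "p \<in> fst c"
      using chart_at_in by (auto simp: c_def)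
    have W: "open W"
      using submersion_open[OF assms] .
    have 1: "continuous_on (W \<inter> fst c) (snd c)"
      by (rule continuous_on_subset[OF homeomorphism_cont1[OF chart_homeomorphism[OF c(1)]]]) simp
    have 2: "continuous_on (snd c ` (W \<inter> fst c)) (w \<circ> chart_inv c)"
      by (rule smooth_on_imp_continuous) (use assms c(1) in \<open>simp add: complex_submersion_def\<close>)
    have "continuous_on (W \<inter> fst c) (\<lambda>x. (w \<circ> chart_inv c) (snd c x))"
      by (rule continuous_on_compose2[OF 2 1]) simp
    then have "continuous_on (W \<inter> fst c) w"
      by (rule continuous_on_eq) (use chart_inv_chart[OF c(1)] in auto)
    then show ?thesis
      using continuous_on_eq_continuous_at[OF open_Int[OF W open_chart_domain[OF c(1)]], of w] p c(2)
      by blast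
  qed
  then show ?thesis
    by (simp add: continuous_at_imp_continuous_on)
qed

lemma submersion_restrict:
  assumes "complex_submersion A F W w" "open V" "V \<subseteq> W"
  shows "complex_submersion A F V w"
proof -
  have "smooth_on (w \<circ> chart_inv c) (snd c ` (V \<inter> fst c))" if "c \<in> A" for c
  proof (rule smooth_on_subset)
    show "smooth_on (w \<circ> chart_inv c) (snd c ` (W \<inter> fst c))"
      using assms(1) that unfolding complex_submersion_def by blast
  qed (use assms(3) in blast)
  then show ?thesis
    using assms unfolding complex_submersion_def by blast
qed

text \<open>The differential has a linear right inverse at every point, so the open mapping theorem for maps with
  surjective derivative applies in a chart of the manifold.\<close>

lemma submersion_open_map:
  assumes w: "complex_submersion A F W w" and V: "open V" "V \<subseteq> W"
  shows "open (w ` V)"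
proof (subst open_subopen, intro ballI)
  fix y assume "y \<in> w ` V"
  then obtain p where p: "p \<in> V" "y = w p"
    by blast
  define c where "c = chart_at A p"
  have c: "c \<in> A" "p \<in> fst c"
    using chart_at_in by (auto simp: c_def)
  have wV: "complex_submersion A F V w"
    by (rule submersion_restrict[OF w V])
  let ?S = "snd c ` (V \<inter> fst c)"
  have S: "open ?S" "snd c p \<in> ?S"
    using open_chart_image[OF c(1) V(1)] p(1) c by auto
  have cont: "continuous_on ?S (w \<circ> chart_inv c)"
    by (rule smooth_on_imp_continuous) (use wV c(1) in \<open>simp add: complex_submersion_def\<close>)
  have der: "(w \<circ> chart_inv c has_derivative dfun A w p) (at (snd c p))"
    using dfun_has_derivative[OF submersion_differentiable[OF wV p(1)]] by (simp add: c_def)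
  obtain g where g: "linear g" "dfun A w p \<circ> g = id"
    using linear_surjective_right_inverse[OF submersion_dfun(1,2)[OF wV p(1)]] by blast
  have "(w \<circ> chart_inv c) (snd c p) \<in> interior ((w \<circ> chart_inv c) ` ?S)"
    by (rule sussmann_open_mapping[OF S(1) cont S(2) der linear_conv_bounded_linear[THEN iffD1, OF g(1)] g(2)])
       (use S in \<open>auto simp: interior_open\<close>)
  moreover have "(w \<circ> chart_inv c) ` ?S \<subseteq> w ` V"
    using chart_inv_chart[OF c(1)] by auto
  moreover have "(w \<circ> chart_inv c) (snd c p) = y"
    using chart_inv_chart[OF c] p(2) by simp
  ultimately have "y \<in> interior (w ` V)"
    using interior_mono by blast
  then show "\<exists>T. open T \<and> y \<in> T \<and> T \<subseteq> w ` V"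
    using interior_subset open_interior by blast
qed

lemma submersion_compose:
  assumes w: "complex_submersion A F W w" and f: "open \<Omega>" "f holomorphic_on \<Omega>" "w ` W \<subseteq> \<Omega>"
    and nz: "\<And>x. x \<in> W \<Longrightarrow> deriv f (w x) \<noteq> 0" and eq: "\<And>x. x \<in> W \<Longrightarrow> w' x = f (w x)"
  shows "complex_submersion A F W w'"
proof -
  have "smooth_on (w' \<circ> chart_inv c) (snd c ` (W \<inter> fst c))" if c: "c \<in> A" for c
  proof (rule smooth_on_cong)
    show op: "open (snd c ` (W \<inter> fst c))"
      by (rule open_chart_image[OF c submersion_open[OF w]])
    show "smooth_on (\<lambda>y. f ((w \<circ> chart_inv c) y)) (snd c ` (W \<inter> fst c))"
    proof (rule smooth_on_holomorphic_compose[OF op f(1) _ f(2)])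
      show "(w \<circ> chart_inv c) ` snd c ` (W \<inter> fst c) \<subseteq> \<Omega>"
        using f(3) chart_inv_chart[OF c] by auto
      show "smooth_on (w \<circ> chart_inv c) (snd c ` (W \<inter> fst c))"
        using w c unfolding complex_submersion_def by blast
    qed
    show "f ((w \<circ> chart_inv c) y) = (w' \<circ> chart_inv c) y" if "y \<in> snd c ` (W \<inter> fst c)" for y
      using that eq chart_inv_chart[OF c] by auto
  qed
  moreover have "surj (dfun A w' p) \<and> {v. dfun A w' p v = 0} = F p" if p: "p \<in> W" for p
  proof -
    have "(f has_field_derivative deriv f (w p)) (at (w p))"
      by (rule holomorphic_derivI[OF f(2,1)]) (use f(3) p in blast)
    from dfun_compose(2)[OF submersion_open[OF w] p submersion_differentiable[OF w p] this eq]
    have d: "dfun A w' p = (\<lambda>v. deriv f (w p) * dfun A w p v)" .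
    have "surj (dfun A w p)" "{v. dfun A w p v = 0} = F p"
      using w p unfolding complex_submersion_def by blast+
    then show ?thesis
      unfolding d using scaled_functional[OF nz[OF p]] by blast
  qed
  ultimately show ?thesis
    using w unfolding complex_submersion_def by blast
qed

lemma dfun_transition:
  assumes w: "complex_submersion A F W w" and f: "f holomorphic_on (w ` W)"
    and eq: "\<And>x. x \<in> W \<Longrightarrow> w' x = f (w x)" and p: "p \<in> W"
  shows "dfun A w' p = (\<lambda>v. deriv f (w p) * dfun A w p v)"
proof -
  have "(f has_field_derivative deriv f (w p)) (at (w p))"
    by (rule holomorphic_derivI[OF f submersion_open_map[OF w submersion_open[OF w] order_refl]])
       (use p in blast)
  from dfun_compose(2)[OF submersion_open[OF w] p submersion_differentiable[OF w p] this eq]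
  show ?thesis .
qed

text \<open>At a zero of \<open>f'\<close> the chain rule would make the differential of \<open>w'\<close> zero.\<close>

lemma transition_deriv_nonzero:
  assumes w: "complex_submersion A F W w" and w': "complex_submersion A F W w'"
    and f: "f holomorphic_on (w ` W)" and eq: "\<And>x. x \<in> W \<Longrightarrow> w' x = f (w x)" and p: "p \<in> W"
  shows "deriv f (w p) \<noteq> 0"
proof
  assume "deriv f (w p) = 0"
  then have "dfun A w' p = (\<lambda>v. 0)"
    using dfun_transition[OF w f eq p] by simp
  then show False
    using submersion_dfun(2)[OF w' p] by (metis surjD zero_neq_one)
qed

lemma submersion_of_chart:
  assumes \<sigma>: "submersion_chart A F U \<sigma>" and c: "c \<in> cp1_atlas"
  shows "complex_submersion A F {p \<in> U. \<sigma> p \<in> fst c} (snd c \<circ> \<sigma>)"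
proof -
  have U: "open U" and cont: "continuous_on U \<sigma>"
    using \<sigma> unfolding submersion_chart_def smooth_map_def by blast+
  note opn = open_chart_preimage[OF U cont]
  have smooth: "\<forall>a\<in>A. smooth_on (snd c \<circ> \<sigma> \<circ> chart_inv a) (snd a ` ({p \<in> U. \<sigma> p \<in> fst c} \<inter> fst a))"
    if "c \<in> cp1_atlas" for c
  proof
    fix a assume "a \<in> A"
    then have "smooth_on (snd c \<circ> \<sigma> \<circ> chart_inv a) (snd a ` {p \<in> U \<inter> fst a. \<sigma> p \<in> fst c})"
      using \<sigma> that unfolding submersion_chart_def smooth_map_def by blast
    moreover have "{p \<in> U \<inter> fst a. \<sigma> p \<in> fst c} = {p \<in> U. \<sigma> p \<in> fst c} \<inter> fst a"
      by auto
    ultimately show "smooth_on (snd c \<circ> \<sigma> \<circ> chart_inv a) (snd a ` ({p \<in> U. \<sigma> p \<in> fst c} \<inter> fst a))"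
      by simp
  qed
  have "surj (dfun A (snd c \<circ> \<sigma>) p) \<and> {v. dfun A (snd c \<circ> \<sigma>) p v = 0} = F p"
    if p: "p \<in> {p \<in> U. \<sigma> p \<in> fst c}" for p
  proof -
    define c0 where "c0 = chart_at cp1_atlas (\<sigma> p)"
    have c0: "c0 \<in> cp1_atlas" "\<sigma> p \<in> fst c0"
      using chart_at_cp1 by (auto simp: c0_def)
    have s0: "surj (dfun A (snd c0 \<circ> \<sigma>) p)" "{v. dfun A (snd c0 \<circ> \<sigma>) p v = 0} = F p"
      using \<sigma> p unfolding submersion_chart_def tangent_map_def c0_def by auto
    obtain f where f: "\<And>z. z \<in> fst c0 \<inter> fst c \<Longrightarrow> snd c z = f (snd c0 z)"
      "\<And>z. z \<in> fst c0 \<inter> fst c \<Longrightarrow> \<exists>D. D \<noteq> 0 \<and> (f has_field_derivative D) (at (snd c0 z))"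
      by (rule cp1_chart_change[OF c0(1) c]) (rule that)
    have in0: "\<sigma> p \<in> fst c0 \<inter> fst c"
      using p c0(2) by simp
    obtain D where D: "D \<noteq> 0" "(f has_field_derivative D) (at ((snd c0 \<circ> \<sigma>) p))"
      using f(2)[OF in0] by auto
    let ?V = "{p \<in> U. \<sigma> p \<in> fst c0} \<inter> {p \<in> U. \<sigma> p \<in> fst c}"
    have pV: "p \<in> {p \<in> U. \<sigma> p \<in> fst c0}" "p \<in> ?V"
      using p c0(2) by auto
    have d: "dfun A (snd c \<circ> \<sigma>) p = (\<lambda>v. D * dfun A (snd c0 \<circ> \<sigma>) p v)"
    proof (rule dfun_compose(2)[where W = ?V and f = f])
      show "open ?V"
        using opn[OF c] opn[OF c0(1)] by (rule open_Int[rotated])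
      show "p \<in> ?V" "(f has_field_derivative D) (at ((snd c0 \<circ> \<sigma>) p))"
        using pV(2) D(2) .
      show "differentiable_at_point A (snd c0 \<circ> \<sigma>) p"
        by (rule differentiable_at_pointI[OF opn[OF c0(1)] pV(1) smooth[OF c0(1)]])
      show "(snd c \<circ> \<sigma>) x = f ((snd c0 \<circ> \<sigma>) x)" if "x \<in> ?V" for x
        using f(1)[of "\<sigma> x"] that by simp
    qed
    show ?thesis
      unfolding d using scaled_functional[OF D(1) s0(1)] s0(2) by blast
  qed
  with opn[OF c] smooth[OF c] show ?thesis
    unfolding complex_submersion_def by blast
qed

lemma chart_of_submersion:
  assumes w: "complex_submersion A F W w" and \<sigma>: "\<And>p. p \<in> W \<Longrightarrow> \<sigma> p = Cpt (w p)"
  shows "submersion_chart A F W \<sigma>"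
proof -
  have W: "open W" and cw: "continuous_on W w"
    using submersion_open[OF w] submersion_continuous[OF w] .
  have cont: "continuous_on W \<sigma>"
  proof (rule continuous_on_eq)
    show "continuous_on W (\<lambda>p. Cpt (w p))"
      by (rule continuous_on_compose2[OF continuous_on_Cpt[of UNIV] cw]) simp
  qed (use \<sigma> in auto)
  note opn = open_chart_preimage[OF W cont]
  have sub: "complex_submersion A F {p \<in> W. \<sigma> p \<in> fst c} (snd c \<circ> \<sigma>)" if c: "c \<in> cp1_atlas" for c
  proof -
    obtain f where f: "f holomorphic_on (affine_coord ` (- {Infty} \<inter> fst c))"
      "\<And>z. z \<in> - {Infty} \<inter> fst c \<Longrightarrow> snd c z = f (affine_coord z)"
      "\<And>z. z \<in> - {Infty} \<inter> fst c \<Longrightarrow> \<exists>D. D \<noteq> 0 \<and> (f has_field_derivative D) (at (affine_coord z))"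
      using cp1_chart_change[OF affine_chart_in c] unfolding fst_conv snd_conv by metis
    have op: "open (affine_coord ` (- {Infty} \<inter> fst c))"
    proof -
      have "affine_coord ` (- {Infty} \<inter> fst c) = Cpt -` fst c"
      proof (intro set_eqI iffI)
        fix x assume "x \<in> affine_coord ` (- {Infty} \<inter> fst c)"
        then obtain z where "x = affine_coord z" "z \<noteq> Infty" "z \<in> fst c"
          by auto
        then show "x \<in> Cpt -` fst c"
          by (cases z) auto
      next
        fix x assume "x \<in> Cpt -` fst c"
        then show "x \<in> affine_coord ` (- {Infty} \<inter> fst c)"
          by (intro image_eqI[of _ _ "Cpt x"]) auto
      qed
      then show ?thesis
        using open_vimage_Cpt[OF open_cp1_chart_domain[OF c]] by simp
    qed
    show ?thesis
    proof (rule submersion_compose[OF submersion_restrict[OF w opn[OF c]] op f(1)])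
      show "w ` {p \<in> W. \<sigma> p \<in> fst c} \<subseteq> affine_coord ` (- {Infty} \<inter> fst c)"
        using \<sigma> by (force simp: image_iff)
      show "deriv f (w x) \<noteq> 0" if "x \<in> {p \<in> W. \<sigma> p \<in> fst c}" for x
        using f(3)[of "Cpt (w x)"] that \<sigma> DERIV_imp_deriv by force
      show "(snd c \<circ> \<sigma>) x = f (w x)" if "x \<in> {p \<in> W. \<sigma> p \<in> fst c}" for x
        using f(2)[of "Cpt (w x)"] that \<sigma> by auto
    qed auto
  qed
  have "smooth_map A cp1_atlas W \<sigma>"
    unfolding smooth_map_def
  proof (intro conjI ballI)
    fix a c assume a: "a \<in> A" and c: "c \<in> cp1_atlas"
    have "{p \<in> W \<inter> fst a. \<sigma> p \<in> fst c} = {p \<in> W. \<sigma> p \<in> fst c} \<inter> fst a"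
      by auto
    then show "smooth_on (snd c \<circ> \<sigma> \<circ> chart_inv a) (snd a ` {p \<in> W \<inter> fst a. \<sigma> p \<in> fst c})"
      using sub[OF c] a unfolding complex_submersion_def by simp
  qed (rule cont)
  moreover have "open (\<sigma> ` W)"
  proof -
    have "\<sigma> ` W = Cpt ` w ` W"
      using \<sigma> by (auto simp: image_iff)
    then show ?thesis
      using open_Cpt_image[OF submersion_open_map[OF w W order_refl]] by simp
  qed
  moreover have "surj (tangent_map A cp1_atlas \<sigma> p) \<and> {v. tangent_map A cp1_atlas \<sigma> p v = 0} = F p"
    if "p \<in> W" for p
    using sub[OF chart_at_cp1(1)[of "\<sigma> p"]] that chart_at_cp1(2)[of "\<sigma> p"]
    unfolding complex_submersion_def tangent_map_def by blast
  ultimately show ?thesis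
    using W unfolding submersion_chart_def by blast
qed

lemma submersion_chart_restrict:
  assumes \<sigma>: "submersion_chart A F U \<sigma>" and V: "open V" "V \<subseteq> U"
  shows "submersion_chart A F V \<sigma>"
proof -
  have "continuous_on V \<sigma>"
  proof (rule continuous_on_subset[OF _ V(2)])
    show "continuous_on U \<sigma>"
      using \<sigma> unfolding submersion_chart_def smooth_map_def by blast
  qed
  moreover have "smooth_on (snd c \<circ> \<sigma> \<circ> chart_inv a) (snd a ` {p \<in> V \<inter> fst a. \<sigma> p \<in> fst c})"
    if "a \<in> A" "c \<in> cp1_atlas" for a c
  proof (rule smooth_on_subset)
    show "smooth_on (snd c \<circ> \<sigma> \<circ> chart_inv a) (snd a ` {p \<in> U \<inter> fst a. \<sigma> p \<in> fst c})"
      using \<sigma> that unfolding submersion_chart_def smooth_map_def by blast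
  qed (use V(2) in blast)
  moreover have "open (\<sigma> ` V)"
  proof -
    have op: "open ((snd c \<circ> \<sigma>) ` {p \<in> V. \<sigma> p \<in> fst c})" if "c \<in> cp1_atlas" for c
    proof (rule submersion_open_map[OF submersion_of_chart[OF \<sigma> that]])
      show "open {p \<in> V. \<sigma> p \<in> fst c}"
        by (rule open_chart_preimage[OF V(1) \<open>continuous_on V \<sigma>\<close> that])
    qed (use V(2) in blast)
    have key: "inv -` (\<sigma> ` V) = (co \<circ> \<sigma>) ` {p \<in> V. \<sigma> p \<in> D}"
      if "\<And>w. co (inv w) = w" "\<And>w. inv w \<in> D" "\<And>z. z \<in> D \<Longrightarrow> inv (co z) = z"
      for inv and co :: "cp1 \<Rightarrow> complex" and D
    proof (intro set_eqI iffI)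
      fix x assume "x \<in> inv -` (\<sigma> ` V)"
      then obtain p where p: "p \<in> V" "inv x = \<sigma> p"
        by auto
      then show "x \<in> (co \<circ> \<sigma>) ` {p \<in> V. \<sigma> p \<in> D}"
        using that(1)[of x] that(2)[of x] by (intro image_eqI[of _ _ p]) auto
    next
      fix x assume "x \<in> (co \<circ> \<sigma>) ` {p \<in> V. \<sigma> p \<in> D}"
      then show "x \<in> inv -` (\<sigma> ` V)"
        using that(3) by auto
    qed
    have "Cpt -` (\<sigma> ` V) = (affine_coord \<circ> \<sigma>) ` {p \<in> V. \<sigma> p \<in> - {Infty}}"
      by (rule key) (auto simp: not_Infty_iff)
    moreover have "cp1_inf -` (\<sigma> ` V) = (inverse_coord \<circ> \<sigma>) ` {p \<in> V. \<sigma> p \<in> - {Cpt 0}}"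
      by (rule key) (auto simp: cp1_inf_def split: cp1.splits)
    ultimately show ?thesis
      using op[OF affine_chart_in] op[OF inverse_chart_in] by (simp add: open_cp1_def)
  qed
  ultimately show ?thesis
    using \<sigma> V unfolding submersion_chart_def smooth_map_def by blast
qed

end

section \<open>Germs of transition maps\<close>

definition moebius_transformations :: "(cp1 \<Rightarrow> cp1) set" where
  "moebius_transformations = {moebius a b c d | a b c d. a * d - b * c = 1}"

lemma moebius_transformation_id: "(\<lambda>z. z) \<in> moebius_transformations"
  unfolding moebius_transformations_def
  by (rule CollectI, rule exI[of _ 1], rule exI[of _ 0], rule exI[of _ 0], rule exI[of _ 1])
     (auto simp: moebius_id)

lemma moebius_transformation_compose:
  assumes "m \<in> moebius_transformations" "n \<in> moebius_transformations"
  shows "(\<lambda>z. n (m z)) \<in> moebius_transformations"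
proof -
  obtain a b c d a' b' c' d' where det: "a * d - b * c = 1" "a' * d' - b' * c' = 1"
    and "m = moebius a b c d" "n = moebius a' b' c' d'"
    using assms unfolding moebius_transformations_def by blast
  then have "(\<lambda>z. n (m z))
      = moebius (a' * a + b' * c) (a' * b + b' * d) (c' * a + d' * c) (c' * b + d' * d)"
    using moebius_compose[OF det] by auto
  then show ?thesis
    unfolding moebius_transformations_def using moebius_compose_det[OF det] by blast
qed

lemma moebius_transformation_inverse:
  assumes "m \<in> moebius_transformations"
  obtains n where "n \<in> moebius_transformations" "\<And>z. n (m z) = z"
proof -
  obtain a b c d where det: "a * d - b * c = 1" and m: "m = moebius a b c d"
    using assms unfolding moebius_transformations_def by blast
  have "d * a - (- b) * (- c) = 1"
    using det by (simp add: mult.commute)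
  then have "moebius d (- b) (- c) a \<in> moebius_transformations"
    unfolding moebius_transformations_def by blast
  then show ?thesis
    using that moebius_inverse[OF det] m by blast
qed

lemma moebius_transformation_determined:
  assumes "m \<in> moebius_transformations" "n \<in> moebius_transformations"
    and "open U" "z0 \<in> U" "\<And>z. z \<in> U \<Longrightarrow> m z = n z"
  shows "m = n"
proof -
  obtain a b c d a' b' c' d' where det: "a * d - b * c = 1" "a' * d' - b' * c' = 1"
    and mn: "m = moebius a b c d" "n = moebius a' b' c' d'"
    using assms(1,2) unfolding moebius_transformations_def by blast
  show ?thesis
  proof
    fix z
    show "m z = n z"
      unfolding mn
      by (rule moebius_determined_by_open_set[OF det assms(3,4)]) (use assms(5) mn in auto)
  qed
qed

lemma moebius_transformation_moebius_on:
  "m \<in> moebius_transformations \<Longrightarrow> cp1_moebius_on m S"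
  unfolding moebius_transformations_def cp1_moebius_on_def
  using cp1_holomorphic_moebius by blast

text \<open>The transition maps of a datum live on connected components of intersections, which is an awkward
  condition to compose. Its local version is an equivalence relation between charts around \<open>p\<close>.\<close>

definition moebius_germ ::
    "'m::topological_space \<Rightarrow> ('m \<Rightarrow> cp1) \<Rightarrow> ('m \<Rightarrow> cp1) \<Rightarrow> bool" where
  "moebius_germ p \<sigma> \<tau> \<longleftrightarrow>
     (\<exists>W m. open W \<and> p \<in> W \<and> m \<in> moebius_transformations \<and> (\<forall>x\<in>W. \<tau> x = m (\<sigma> x)))"

definition holomorphic_germ ::
    "'m::topological_space \<Rightarrow> ('m \<Rightarrow> complex) \<Rightarrow> ('m \<Rightarrow> complex) \<Rightarrow> bool" where
  "holomorphic_germ p w w' \<longleftrightarrow>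
     (\<exists>W f. open W \<and> p \<in> W \<and> f holomorphic_on (w ` W) \<and> (\<forall>x\<in>W. w' x = f (w x)))"

lemma moebius_germ_eq:
  assumes "open W" "p \<in> W" "\<And>x. x \<in> W \<Longrightarrow> \<tau> x = \<sigma> x"
  shows "moebius_germ p \<sigma> \<tau>"
  unfolding moebius_germ_def using assms moebius_transformation_id by blast

lemma moebius_germ_refl: "moebius_germ p \<sigma> \<sigma>"
  by (rule moebius_germ_eq[of UNIV]) auto

lemma moebius_germ_sym:
  assumes "moebius_germ p \<sigma> \<tau>" shows "moebius_germ p \<tau> \<sigma>"
proof -
  obtain W m where m: "open W" "p \<in> W" "m \<in> moebius_transformations" "\<forall>x\<in>W. \<tau> x = m (\<sigma> x)"
    using assms unfolding moebius_germ_def by blast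
  obtain n where n: "n \<in> moebius_transformations" "\<And>z. n (m z) = z"
    by (rule moebius_transformation_inverse[OF m(3)]) (rule that)
  have "\<forall>x\<in>W. \<sigma> x = n (\<tau> x)"
    using m(4) n(2) by simp
  then show ?thesis
    unfolding moebius_germ_def using m(1,2) n(1) by blast
qed

lemma moebius_germ_trans:
  assumes "moebius_germ p \<sigma> \<tau>" "moebius_germ p \<tau> \<upsilon>" shows "moebius_germ p \<sigma> \<upsilon>"
proof -
  obtain W m where m: "open W" "p \<in> W" "m \<in> moebius_transformations" "\<forall>x\<in>W. \<tau> x = m (\<sigma> x)"
    using assms(1) unfolding moebius_germ_def by blast
  obtain V n where n: "open V" "p \<in> V" "n \<in> moebius_transformations" "\<forall>x\<in>V. \<upsilon> x = n (\<tau> x)"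
    using assms(2) unfolding moebius_germ_def by blast
  have "open (W \<inter> V)" "p \<in> W \<inter> V" "\<forall>x\<in>W \<inter> V. \<upsilon> x = (\<lambda>z. n (m z)) (\<sigma> x)"
    using m n by auto
  then show ?thesis
    unfolding moebius_germ_def using moebius_transformation_compose[OF m(3) n(3)] by blast
qed

lemma holomorphic_germ_trans:
  assumes "holomorphic_germ p u v" "holomorphic_germ p v w" shows "holomorphic_germ p u w"
proof -
  obtain W f where f: "open W" "p \<in> W" "f holomorphic_on (u ` W)" "\<forall>x\<in>W. v x = f (u x)"
    using assms(1) unfolding holomorphic_germ_def by blast
  obtain V g where g: "open V" "p \<in> V" "g holomorphic_on (v ` V)" "\<forall>x\<in>V. w x = g (v x)"
    using assms(2) unfolding holomorphic_germ_def by blast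
  have "(g \<circ> f) holomorphic_on (u ` (W \<inter> V))"
  proof (rule holomorphic_on_compose_gen[OF _ g(3)])
    show "f holomorphic_on u ` (W \<inter> V)"
      by (rule holomorphic_on_subset[OF f(3)]) auto
    show "f ` u ` (W \<inter> V) \<subseteq> v ` V"
      using f(4) by force
  qed
  moreover have "open (W \<inter> V)" "p \<in> W \<inter> V" "\<forall>x\<in>W \<inter> V. w x = (g \<circ> f) (u x)"
    using f g by auto
  ultimately show ?thesis
    unfolding holomorphic_germ_def by blast
qed

lemma moebius_germ_Cpt:
  assumes "moebius_germ p (Cpt \<circ> w) (Cpt \<circ> w')"
  obtains V a b c d where "open V" "p \<in> V" "a * d - b * c = 1"
    "\<And>x. x \<in> V \<Longrightarrow> c * w x + d \<noteq> 0 \<and> w' x = (a * w x + b) / (c * w x + d)"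
proof -
  obtain V m where V: "open V" "p \<in> V" "m \<in> moebius_transformations"
      "\<forall>x\<in>V. (Cpt \<circ> w') x = m ((Cpt \<circ> w) x)"
    using assms unfolding moebius_germ_def by blast
  obtain a b c d where m: "a * d - b * c = 1" "m = moebius a b c d"
    using V(3) unfolding moebius_transformations_def by blast
  show ?thesis
    by (rule that[OF V(1,2) m(1)]) (use V(4) m(2) in \<open>auto split: if_splits\<close>)
qed

lemma moebius_germ_CptI:
  assumes "open V" "p \<in> V" "a * d - b * c = 1"
    "\<And>x. x \<in> V \<Longrightarrow> c * w x + d \<noteq> 0 \<and> w' x = (a * w x + b) / (c * w x + d)"
  shows "moebius_germ p (Cpt \<circ> w) (Cpt \<circ> w')"
proof -
  have "\<forall>x\<in>V. (Cpt \<circ> w') x = moebius a b c d ((Cpt \<circ> w) x)"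
    using assms(4) by auto
  moreover have "moebius a b c d \<in> moebius_transformations"
    unfolding moebius_transformations_def using assms(3) by blast
  ultimately show ?thesis
    unfolding moebius_germ_def using assms(1,2) by blast
qed


section \<open>Transverse structures as maximal atlases\<close>

lemma transverse_data_iff:
  "transverse_data A F G D \<longleftrightarrow>
     (\<forall>(U, \<sigma>)\<in>D. submersion_chart A F U \<sigma>) \<and> (\<Union>(U, \<sigma>)\<in>D. U) = UNIV \<and>
     (\<forall>(U, \<sigma>)\<in>D. \<forall>(V, \<tau>)\<in>D. \<forall>C\<in>components (U \<inter> V).
        \<exists>f. G f (\<sigma> ` C) \<and> (\<forall>p\<in>C. f (\<sigma> p) = \<tau> p))"
proof -
  have rearrange: "((\<forall>s\<in>D. P s) \<and> Q \<and> (\<forall>s\<in>D. R s) \<and> S) = ((\<forall>s\<in>D. P s \<and> R s) \<and> Q \<and> S)"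
    for P R :: "'a set \<times> ('a \<Rightarrow> cp1) \<Rightarrow> bool" and Q S
    by blast
  show ?thesis
    unfolding transverse_data_def submersion_chart_def case_prod_unfold by (rule rearrange)
qed

lemma transverse_data_chart: "transverse_data A F G D \<Longrightarrow> (U, \<sigma>) \<in> D \<Longrightarrow> submersion_chart A F U \<sigma>"
  unfolding transverse_data_iff by blast

lemma transverse_data_cover:
  assumes "transverse_data A F G D"
  obtains U \<sigma> where "(U, \<sigma>) \<in> D" "p \<in> U"
  using assms unfolding transverse_data_iff by blast

lemma transverse_data_mono:
  assumes "\<And>f S. G f S \<Longrightarrow> H f S" "transverse_data A F G D"
  shows "transverse_data A F H D"
proof -
  have "\<forall>(U, \<sigma>)\<in>D. \<forall>(V, \<tau>)\<in>D. \<forall>C\<in>components (U \<inter> V). \<exists>f. H f (\<sigma> ` C) \<and> (\<forall>p\<in>C. f (\<sigma> p) = \<tau> p)"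
  proof (clarify)
    fix U \<sigma> V \<tau> C assume "(U, \<sigma>) \<in> D" "(V, \<tau>) \<in> D" "C \<in> components (U \<inter> V)"
    then have "\<exists>f. G f (\<sigma> ` C) \<and> (\<forall>p\<in>C. f (\<sigma> p) = \<tau> p)"
      using assms(2) unfolding transverse_data_iff by blast
    then show "\<exists>f. H f (\<sigma> ` C) \<and> (\<forall>p\<in>C. f (\<sigma> p) = \<tau> p)"
      using assms(1) by blast
  qed
  then show ?thesis
    using assms(2) unfolding transverse_data_iff by blast
qed

lemma moebius_on_imp_holomorphic_on: "cp1_moebius_on f S \<Longrightarrow> cp1_holomorphic_on f S"
  unfolding cp1_moebius_on_def by blast

abbreviation transverse_step where
  "transverse_step A F G \<equiv> {(D, D'). transverse_data A F G D \<and> transverse_data A F G D' \<and>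
     transverse_data A F G (D \<union> D')}"

lemma transverse_equiv_sym: "(D, D') \<in> transverse_equiv A F G \<Longrightarrow> (D', D) \<in> transverse_equiv A F G"
proof -
  have "sym (transverse_step A F G)"
    by (auto simp: sym_def Un_commute)
  then have "sym (transverse_equiv A F G)"
    unfolding transverse_equiv_def by (rule sym_trancl)
  then show "(D, D') \<in> transverse_equiv A F G \<Longrightarrow> (D', D) \<in> transverse_equiv A F G"
    by (rule symD)
qed

lemma transverse_equiv_trans:
  "(D, D') \<in> transverse_equiv A F G \<Longrightarrow> (D', D'') \<in> transverse_equiv A F G
    \<Longrightarrow> (D, D'') \<in> transverse_equiv A F G"
  unfolding transverse_equiv_def by (rule trancl_trans)

lemma transverse_equiv_step:
  "transverse_data A F G D \<Longrightarrow> transverse_data A F G D' \<Longrightarrow> transverse_data A F G (D \<union> D')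
    \<Longrightarrow> (D, D') \<in> transverse_equiv A F G"
  unfolding transverse_equiv_def by (rule r_into_trancl) simp

lemma transverse_equiv_data:
  assumes "(D, D') \<in> transverse_equiv A F G"
  shows "transverse_data A F G D" "transverse_data A F G D'"
  using assms unfolding transverse_equiv_def
  by (induction rule: trancl_induct) auto

lemma structure_class:
  assumes "T \<in> transverse_structures A F G" "D \<in> T"
  shows "T = transverse_equiv A F G `` {D}" "transverse_data A F G D"
proof -
  obtain D0 where T: "T = transverse_equiv A F G `` {D0}"
    using assms(1) unfolding transverse_structures_def by (auto elim!: quotientE)
  then have D: "(D0, D) \<in> transverse_equiv A F G"
    using assms(2) by simp
  then show "transverse_data A F G D"
    by (rule transverse_equiv_data)
  show "T = transverse_equiv A F G `` {D}"
    unfolding T using D transverse_equiv_sym transverse_equiv_trans by blast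
qed

lemma structure_nonempty:
  assumes "T \<in> transverse_structures A F G"
  obtains D where "D \<in> T" "transverse_data A F G D"
proof -
  obtain D0 where T: "T = transverse_equiv A F G `` {D0}" "transverse_data A F G D0"
    using assms unfolding transverse_structures_def by (auto elim!: quotientE)
  then have "D0 \<in> T"
    using transverse_equiv_step[of A F G D0 D0] by simp
  then show ?thesis
    using that T(2) by blast
qed

lemma structure_memI:
  assumes "T \<in> transverse_structures A F G" "D \<in> T" "transverse_data A F G D'"
    "transverse_data A F G (D \<union> D')"
  shows "D' \<in> T"
  using structure_class[OF assms(1,2)] transverse_equiv_step[OF _ assms(3,4)] by blast

lemma structure_of_data:
  assumes "transverse_data A F G D"
  shows "transverse_equiv A F G `` {D} \<in> transverse_structures A F G"
    "D \<in> transverse_equiv A F G `` {D}"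
  unfolding transverse_structures_def
  using assms transverse_equiv_step[OF assms assms] by (auto intro: quotientI)

lemma structure_chart:
  assumes "T \<in> transverse_structures A F G" "(U, \<sigma>) \<in> \<Union>T"
  shows "submersion_chart A F U \<sigma>"
  using assms structure_class(2) transverse_data_chart by blast

lemma structure_cover:
  assumes "T \<in> transverse_structures A F G"
  obtains U \<sigma> where "(U, \<sigma>) \<in> \<Union>T" "p \<in> U"
proof -
  obtain D where D: "D \<in> T" "transverse_data A F G D"
    by (rule structure_nonempty[OF assms]) (rule that)
  obtain U \<sigma> where "(U, \<sigma>) \<in> D" "p \<in> U"
    by (rule transverse_data_cover[OF D(2)]) (rule that)
  then show ?thesis
    using that D(1) by blast
qed

text \<open>The members of a class are joined by chains of data, each of which covers the manifold. A transitive
  relation between charts around \<open>p\<close> can be passed along such a chain.\<close>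

lemma structure_germ:
  assumes data: "\<And>D U \<sigma> V \<tau> p. transverse_data A F G D \<Longrightarrow> (U, \<sigma>) \<in> D \<Longrightarrow> (V, \<tau>) \<in> D \<Longrightarrow>
      p \<in> U \<inter> V \<Longrightarrow> R p \<sigma> \<tau>"
    and trans: "\<And>p \<sigma> \<tau> \<upsilon>. R p \<sigma> \<tau> \<Longrightarrow> R p \<tau> \<upsilon> \<Longrightarrow> R p \<sigma> \<upsilon>"
    and T: "T \<in> transverse_structures A F G"
    and ch: "(U, \<sigma>) \<in> \<Union>T" "(V, \<tau>) \<in> \<Union>T" "p \<in> U \<inter> V"
  shows "R p \<sigma> \<tau>"
proof -
  obtain D D' where D: "D \<in> T" "(U, \<sigma>) \<in> D" and D': "D' \<in> T" "(V, \<tau>) \<in> D'"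
    using ch(1,2) by blast
  have "(D, D') \<in> (transverse_step A F G)\<^sup>+"
    using structure_class(1)[OF T D(1)] D'(1) unfolding transverse_equiv_def by blast
  then show ?thesis
    using D'(2) ch(3)
  proof (induction arbitrary: V \<tau> rule: trancl_induct)
    case (base D')
    have "transverse_data A F G (D \<union> D')"
      using base(1) by simp
    then show ?case
      by (rule data[where U = U and V = V]) (use base D(2) in auto)
  next
    case (step D1 D2)
    have d: "transverse_data A F G D1" "transverse_data A F G (D1 \<union> D2)"
      using step.hyps(2) by simp_all
    obtain V1 \<tau>1 where 1: "(V1, \<tau>1) \<in> D1" "p \<in> V1"
      by (rule transverse_data_cover[OF d(1)]) (rule that)
    have "R p \<sigma> \<tau>1"
      by (rule step.IH[OF 1(1)]) (use step.prems(2) 1(2) in simp)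
    moreover have "R p \<tau>1 \<tau>"
      by (rule data[OF d(2), where U = V1 and V = V]) (use step.prems 1 in auto)
    ultimately show ?case
      by (rule trans)
  qed
qed

text \<open>The charts are compared through the coordinates of the projective line that are defined at their
  values, because for complex-valued functions transitivity is the composition of holomorphic functions.\<close>

definition holomorphic_chart_germ ::
    "'m::topological_space \<Rightarrow> ('m \<Rightarrow> cp1) \<Rightarrow> ('m \<Rightarrow> cp1) \<Rightarrow> bool" where
  "holomorphic_chart_germ p \<sigma> \<tau> \<longleftrightarrow> (\<forall>c\<in>cp1_atlas. \<forall>c'\<in>cp1_atlas.
     \<sigma> p \<in> fst c \<longrightarrow> \<tau> p \<in> fst c' \<longrightarrow> holomorphic_germ p (snd c \<circ> \<sigma>) (snd c' \<circ> \<tau>))"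

lemma holomorphic_chart_germ_trans:
  assumes "holomorphic_chart_germ p \<sigma> \<tau>" "holomorphic_chart_germ p \<tau> \<upsilon>"
  shows "holomorphic_chart_germ p \<sigma> \<upsilon>"
  unfolding holomorphic_chart_germ_def
proof (intro ballI impI)
  fix c c' assume c: "c \<in> cp1_atlas" "c' \<in> cp1_atlas" "\<sigma> p \<in> fst c" "\<upsilon> p \<in> fst c'"
  obtain c0 where c0: "c0 \<in> cp1_atlas" "\<tau> p \<in> fst c0"
    using cp1_chart_cover by blast
  have "holomorphic_germ p (snd c \<circ> \<sigma>) (snd c0 \<circ> \<tau>)" "holomorphic_germ p (snd c0 \<circ> \<tau>) (snd c' \<circ> \<upsilon>)"
    using assms c c0 unfolding holomorphic_chart_germ_def by blast+
  then show "holomorphic_germ p (snd c \<circ> \<sigma>) (snd c' \<circ> \<upsilon>)"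
    by (rule holomorphic_germ_trans)
qed

context smooth_manifold
begin

lemma component_neighbourhood:
  fixes p :: 'm
  assumes "open S" "p \<in> S"
  obtains C W where "C \<in> components S" "open W" "p \<in> W" "W \<subseteq> C" "C \<subseteq> S"
proof -
  obtain W where W: "open W" "connected W" "p \<in> W" "W \<subseteq> S"
    by (rule connected_neighbourhood[OF assms]) (rule that)
  show ?thesis
  proof (rule that[of "connected_component_set S p" W])
    show "connected_component_set S p \<in> components S"
      using assms(2) by (auto simp: components_def)
    show "W \<subseteq> connected_component_set S p"
      by (rule connected_component_maximal[OF W(3,2,4)])
    show "connected_component_set S p \<subseteq> S"
      by (rule connected_component_subset)
  qed (use W in auto)
qed

lemma transition_near:
  assumes D: "transverse_data A F G D" "(U, \<sigma>) \<in> D" "(V, \<tau>) \<in> D" "p \<in> U \<inter> V"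
  obtains C W f where "open W" "p \<in> W" "W \<subseteq> C" "C \<subseteq> U \<inter> V" "G f (\<sigma> ` C)" "\<And>x. x \<in> C \<Longrightarrow> f (\<sigma> x) = \<tau> x"
proof -
  have "open U" "open V"
    using transverse_data_chart[OF D(1)] D(2,3) unfolding submersion_chart_def by blast+
  then have "open (U \<inter> V)"
    by (rule open_Int)
  obtain C W where C: "C \<in> components (U \<inter> V)" "open W" "p \<in> W" "W \<subseteq> C" "C \<subseteq> U \<inter> V"
    by (rule component_neighbourhood[OF \<open>open (U \<inter> V)\<close> D(4)]) (rule that)
  have "\<exists>f. G f (\<sigma> ` C) \<and> (\<forall>x\<in>C. f (\<sigma> x) = \<tau> x)"
    using D(1,2,3) C(1) unfolding transverse_data_iff by blast
  then show ?thesis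
    using that C(2-5) by blast
qed

lemma moebius_data_germ:
  assumes D: "transverse_data A F cp1_moebius_on D" "(U, \<sigma>) \<in> D" "(V, \<tau>) \<in> D" "p \<in> U \<inter> V"
  shows "moebius_germ p \<sigma> \<tau>"
proof -
  obtain C W f where W: "open W" "p \<in> W" "W \<subseteq> C" "cp1_moebius_on f (\<sigma> ` C)" "\<And>x. x \<in> C \<Longrightarrow> f (\<sigma> x) = \<tau> x"
    by (rule transition_near[OF D]) (rule that)
  obtain a b c d where m: "a * d - b * c = 1" "\<forall>z\<in>\<sigma> ` C. f z = moebius a b c d z"
    using W(4) unfolding cp1_moebius_on_def by blast
  have "moebius a b c d \<in> moebius_transformations"
    unfolding moebius_transformations_def using m(1) by blast
  moreover have "\<forall>x\<in>W. \<tau> x = moebius a b c d (\<sigma> x)"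
    using W(3,5) m(2) by (metis imageI subsetD)
  ultimately show ?thesis
    unfolding moebius_germ_def using W(1,2) by blast
qed

lemma holomorphic_data_germ:
  assumes D: "transverse_data A F cp1_holomorphic_on D" "(U, \<sigma>) \<in> D" "(V, \<tau>) \<in> D" "p \<in> U \<inter> V"
  shows "holomorphic_chart_germ p \<sigma> \<tau>"
  unfolding holomorphic_chart_germ_def
proof (intro ballI impI)
  fix c c' assume c: "c \<in> cp1_atlas" "c' \<in> cp1_atlas" "\<sigma> p \<in> fst c" "\<tau> p \<in> fst c'"
  obtain C W f where W: "open W" "p \<in> W" "W \<subseteq> C" "C \<subseteq> U \<inter> V" "cp1_holomorphic_on f (\<sigma> ` C)"
      "\<And>x. x \<in> C \<Longrightarrow> f (\<sigma> x) = \<tau> x"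
    by (rule transition_near[OF D]) (rule that)
  let ?W = "W \<inter> {x \<in> U. \<sigma> x \<in> fst c} \<inter> {x \<in> V. \<tau> x \<in> fst c'}"
  have "open {x \<in> U. \<sigma> x \<in> fst c}" "open {x \<in> V. \<tau> x \<in> fst c'}"
    using submersion_open[OF submersion_of_chart[OF transverse_data_chart[OF D(1)]]] D(2,3) c by blast+
  then have op: "open ?W" "p \<in> ?W"
    using W(1,2) D(4) c by auto
  have "(snd c' \<circ> f \<circ> chart_inv c) holomorphic_on (snd c ` {z \<in> \<sigma> ` C \<inter> fst c. f z \<in> fst c'})"
    using W(5) c unfolding cp1_holomorphic_on_def by blast
  then have "(snd c' \<circ> f \<circ> chart_inv c) holomorphic_on ((snd c \<circ> \<sigma>) ` ?W)"
    by (rule holomorphic_on_subset) (use W(3,6) in auto)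
  moreover have "(snd c' \<circ> \<tau>) x = (snd c' \<circ> f \<circ> chart_inv c) ((snd c \<circ> \<sigma>) x)" if "x \<in> ?W" for x
  proof -
    have "chart_inv c (snd c (\<sigma> x)) = \<sigma> x"
      using c(1) that chart_inv_affine chart_inv_inverse
      by (cases rule: cp1_atlas_cases) (auto simp: not_Infty_iff cp1_inf_def split: cp1.splits)
    then show ?thesis
      using that W(3,6) by auto
  qed
  ultimately show "holomorphic_germ p (snd c \<circ> \<sigma>) (snd c' \<circ> \<tau>)"
    unfolding holomorphic_germ_def using op by blast
qed

text \<open>On a connected component of \<open>U \<inter> V\<close>, the Moebius transformation between the two charts is locally
  constant, since the images of open sets under \<open>\<sigma>\<close> are open and it is determined by its values there.
  Hence it is constant, and one transformation serves the whole component.\<close>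

lemma moebius_dataI:
  assumes charts: "\<And>U \<sigma>. (U, \<sigma>) \<in> D \<Longrightarrow> submersion_chart A F U \<sigma>"
    and cover: "\<And>p. \<exists>U \<sigma>. (U, \<sigma>) \<in> D \<and> p \<in> U"
    and germs: "\<And>U \<sigma> V \<tau> p. (U, \<sigma>) \<in> D \<Longrightarrow> (V, \<tau>) \<in> D \<Longrightarrow> p \<in> U \<inter> V \<Longrightarrow> moebius_germ p \<sigma> \<tau>"
  shows "transverse_data A F cp1_moebius_on D"
proof -
  have "\<exists>f. cp1_moebius_on f (\<sigma> ` C) \<and> (\<forall>p\<in>C. f (\<sigma> p) = \<tau> p)"
    if ch: "(U, \<sigma>) \<in> D" "(V, \<tau>) \<in> D" and C: "C \<in> components (U \<inter> V)" for U \<sigma> V \<tau> C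
  proof -
    have CUV: "C \<subseteq> U \<inter> V" and "C \<noteq> {}" and con: "connected C"
      using in_components_subset[OF C] in_components_nonempty[OF C] in_components_connected[OF C] .
    then obtain p0 where p0: "p0 \<in> C"
      by blast
    define near where "near = (\<lambda>m x. \<exists>W. open W \<and> x \<in> W \<and> (\<forall>y\<in>W. \<tau> y = m (\<sigma> y)))"
    have near: "\<exists>m\<in>moebius_transformations. near m x" if "x \<in> C" for x
    proof -
      have "moebius_germ x \<sigma> \<tau>"
        by (rule germs[OF ch]) (use that CUV in blast)
      then show ?thesis
        unfolding moebius_germ_def near_def by blast
    qed
    obtain m0 where m0: "m0 \<in> moebius_transformations" "near m0 p0"
      using near[OF p0] by blast
    define Q where "Q = {x. near m0 x}"
    define R where "R = {x. \<exists>m\<in>moebius_transformations. m \<noteq> m0 \<and> near m x}"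
    have near_open: "open {x. near m x}" for m
    proof (subst open_subopen, intro ballI)
      fix x assume "x \<in> {x. near m x}"
      then obtain W where W: "open W" "x \<in> W" "\<forall>y\<in>W. \<tau> y = m (\<sigma> y)"
        unfolding near_def by blast
      then have "W \<subseteq> {x. near m x}"
        unfolding near_def by blast
      then show "\<exists>W. open W \<and> x \<in> W \<and> W \<subseteq> {x. near m x}"
        using W(1,2) by blast
    qed
    have "open Q"
      unfolding Q_def by (rule near_open)
    moreover have "open R"
    proof -
      have "R = (\<Union>m\<in>moebius_transformations - {m0}. {x. near m x})"
        unfolding R_def by blast
      then show ?thesis
        using near_open by auto
    qed
    moreover have "Q \<inter> R \<inter> C = {}"
    proof (rule ccontr)
      assume "Q \<inter> R \<inter> C \<noteq> {}"
      then obtain x m where x: "x \<in> C" "near m0 x" "near m x" "m \<in> moebius_transformations" "m \<noteq> m0"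
        unfolding Q_def R_def by blast
      obtain W0 where W0: "open W0" "x \<in> W0" "\<forall>y\<in>W0. \<tau> y = m0 (\<sigma> y)"
        using x(2) unfolding near_def by blast
      obtain W where W: "open W" "x \<in> W" "\<forall>y\<in>W. \<tau> y = m (\<sigma> y)"
        using x(3) unfolding near_def by blast
      have U: "open U" "x \<in> U"
        using charts[OF ch(1)] x(1) CUV unfolding submersion_chart_def by blast+
      have "open (\<sigma> ` (W0 \<inter> W \<inter> U))"
        using submersion_chart_restrict[OF charts[OF ch(1)], of "W0 \<inter> W \<inter> U"] W0(1) W(1) U(1)
        unfolding submersion_chart_def by blast
      moreover have "\<sigma> x \<in> \<sigma> ` (W0 \<inter> W \<inter> U)"
        using W0(2) W(2) U(2) by blast
      moreover have "m z = m0 z" if "z \<in> \<sigma> ` (W0 \<inter> W \<inter> U)" for z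
        using that W0(3) W(3) by auto
      ultimately have "m = m0"
        by (rule moebius_transformation_determined[OF x(4) m0(1)])
      with x(5) show False
        by simp
    qed
    moreover have "C \<subseteq> Q \<union> R"
    proof
      fix x assume "x \<in> C"
      then obtain m where "m \<in> moebius_transformations" "near m x"
        using near by blast
      then show "x \<in> Q \<union> R"
        unfolding Q_def R_def by (cases "m = m0") auto
    qed
    moreover have "Q \<inter> C \<noteq> {}"
      using p0 m0(2) unfolding Q_def by blast
    ultimately have "R \<inter> C = {}"
      using connectedD[OF con, of Q R] by (simp add: Int_ac)
    then have "\<forall>p\<in>C. near m0 p"
      using \<open>C \<subseteq> Q \<union> R\<close> unfolding Q_def by blast
    then have "\<forall>p\<in>C. m0 (\<sigma> p) = \<tau> p"
      unfolding near_def by metis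
    then show ?thesis
      using moebius_transformation_moebius_on[OF m0(1)] by blast
  qed
  moreover have "(\<Union>(U, \<sigma>)\<in>D. U) = UNIV"
    using cover by blast
  ultimately show ?thesis
    unfolding transverse_data_iff using charts by blast
qed

lemma projective_germ:
  assumes "P \<in> projective_structures A F" "(U, \<sigma>) \<in> \<Union>P" "(V, \<tau>) \<in> \<Union>P" "p \<in> U \<inter> V"
  shows "moebius_germ p \<sigma> \<tau>"
  by (rule structure_germ[where R = moebius_germ, OF moebius_data_germ moebius_germ_trans assms])

lemma complex_germ:
  assumes "T \<in> complex_structures A F" "(U, \<sigma>) \<in> \<Union>T" "(V, \<tau>) \<in> \<Union>T" "p \<in> U \<inter> V"
  shows "holomorphic_chart_germ p \<sigma> \<tau>"
  by (rule structure_germ[where R = holomorphic_chart_germ,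
        OF holomorphic_data_germ holomorphic_chart_germ_trans assms])

text \<open>Germs of Moebius transformations can be composed and inverted, so that \<open>\<sigma>'\<close> may be added to any datum of
  the class. The union of a projective structure is in this sense a maximal atlas.\<close>

lemma projective_maximal:
  assumes P: "P \<in> projective_structures A F" and \<sigma>': "submersion_chart A F W \<sigma>'"
    and germ: "\<And>x. x \<in> W \<Longrightarrow> \<exists>U \<sigma>. (U, \<sigma>) \<in> \<Union>P \<and> x \<in> U \<and> moebius_germ x \<sigma> \<sigma>'"
  shows "(W, \<sigma>') \<in> \<Union>P"
proof -
  obtain D where D: "D \<in> P" "transverse_data A F cp1_moebius_on D"
    by (rule structure_nonempty[OF P]) (rule that)
  have g: "moebius_germ p \<sigma> \<sigma>'" if V: "(V, \<sigma>) \<in> D" "p \<in> V" "p \<in> W" for V \<sigma> p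
  proof -
    obtain U \<tau> where 1: "(U, \<tau>) \<in> \<Union>P" "p \<in> U" "moebius_germ p \<tau> \<sigma>'"
      using germ[OF V(3)] by blast
    have "moebius_germ p \<sigma> \<tau>"
      by (rule projective_germ[OF P _ 1(1), of V]) (use V D(1) 1(2) in auto)
    then show ?thesis
      using 1(3) by (rule moebius_germ_trans)
  qed
  have "transverse_data A F cp1_moebius_on (insert (W, \<sigma>') D)"
  proof (rule moebius_dataI)
    show "submersion_chart A F U \<sigma>" if "(U, \<sigma>) \<in> insert (W, \<sigma>') D" for U \<sigma>
      using that \<sigma>' transverse_data_chart[OF D(2)] by auto
    show "\<exists>U \<sigma>. (U, \<sigma>) \<in> insert (W, \<sigma>') D \<and> p \<in> U" for p
      using transverse_data_cover[OF D(2), of p] by (metis insertI2)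
    show "moebius_germ p \<sigma> \<tau>"
      if h: "(U, \<sigma>) \<in> insert (W, \<sigma>') D" "(V, \<tau>) \<in> insert (W, \<sigma>') D" "p \<in> U \<inter> V" for U \<sigma> V \<tau> p
    proof -
      consider "(U, \<sigma>) = (W, \<sigma>')" "(V, \<tau>) = (W, \<sigma>')" | "(U, \<sigma>) = (W, \<sigma>')" "(V, \<tau>) \<in> D"
        | "(U, \<sigma>) \<in> D" "(V, \<tau>) = (W, \<sigma>')" | "(U, \<sigma>) \<in> D" "(V, \<tau>) \<in> D"
        using h(1,2) by blast
      then show ?thesis
      proof cases
        case 1
        then show ?thesis by (simp add: moebius_germ_refl)
      next
        case 2
        have "moebius_germ p \<tau> \<sigma>'"
          by (rule g[of V]) (use 2 h(3) in auto)
        then show ?thesis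
          using 2(1) moebius_germ_sym by simp
      next
        case 3
        have "moebius_germ p \<sigma> \<sigma>'"
          by (rule g[of U]) (use 3 h(3) in auto)
        then show ?thesis
          using 3(2) by simp
      next
        case 4
        then show ?thesis
          using moebius_data_germ[OF D(2)] h(3) by blast
      qed
    qed
  qed
  then have "insert (W, \<sigma>') D \<in> P"
    using structure_memI[OF P D(1)] by (simp add: Un_commute insert_absorb sup.absorb2 subset_insertI)
  then show ?thesis
    by blast
qed

lemma projective_memI:
  assumes P: "P \<in> projective_structures A F"
    and D': "transverse_data A F cp1_moebius_on D'" "D' \<subseteq> \<Union>P"
  shows "D' \<in> P"
proof -
  obtain D where D: "D \<in> P" "transverse_data A F cp1_moebius_on D"
    by (rule structure_nonempty[OF P]) (rule that)
  have sub: "D \<union> D' \<subseteq> \<Union>P"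
    using D(1) D'(2) by blast
  have "transverse_data A F cp1_moebius_on (D \<union> D')"
  proof (rule moebius_dataI)
    show "submersion_chart A F U \<sigma>" if "(U, \<sigma>) \<in> D \<union> D'" for U \<sigma>
      by (rule structure_chart[OF P]) (use that sub in blast)
    show "\<exists>U \<sigma>. (U, \<sigma>) \<in> D \<union> D' \<and> p \<in> U" for p
      by (rule transverse_data_cover[OF D(2), of p]) blast
    show "moebius_germ p \<sigma> \<tau>"
      if "(U, \<sigma>) \<in> D \<union> D'" "(V, \<tau>) \<in> D \<union> D'" "p \<in> U \<inter> V" for U \<sigma> V \<tau> p
      by (rule projective_germ[OF P _ _ that(3)]) (use that sub in blast)+
  qed
  then show ?thesis
    by (rule structure_memI[OF P D(1) D'(1)])
qed

lemma projective_eqI: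
  assumes P: "P \<in> projective_structures A F" and P': "P' \<in> projective_structures A F"
    and germ: "\<And>p. \<exists>U \<sigma> V \<tau>. (U, \<sigma>) \<in> \<Union>P \<and> (V, \<tau>) \<in> \<Union>P' \<and> p \<in> U \<inter> V \<and> moebius_germ p \<sigma> \<tau>"
  shows "P = P'"
proof -
  obtain D' where D': "D' \<in> P'" "transverse_data A F cp1_moebius_on D'"
    by (rule structure_nonempty[OF P']) (rule that)
  have "(V, \<tau>) \<in> \<Union>P" if ch: "(V, \<tau>) \<in> D'" for V \<tau>
  proof (rule projective_maximal[OF P transverse_data_chart[OF D'(2) ch]])
    fix p assume p: "p \<in> V"
    obtain U0 \<sigma>0 V0 \<tau>0 where 0: "(U0, \<sigma>0) \<in> \<Union>P" "(V0, \<tau>0) \<in> \<Union>P'" "p \<in> U0 \<inter> V0" "moebius_germ p \<sigma>0 \<tau>0"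
      using germ[of p] by (elim exE conjE) (rule that)
    have "moebius_germ p \<tau>0 \<tau>"
      by (rule projective_germ[OF P' 0(2), of V]) (use ch p 0(3) D'(1) in auto)
    then have "moebius_germ p \<sigma>0 \<tau>"
      by (rule moebius_germ_trans[OF 0(4)])
    then show "\<exists>U \<sigma>. (U, \<sigma>) \<in> \<Union>P \<and> p \<in> U \<and> moebius_germ p \<sigma> \<tau>"
      using 0(1,3) by blast
  qed
  then have "D' \<in> P"
    by (intro projective_memI[OF P D'(2)]) auto
  then show ?thesis
    using structure_class(1)[OF P] structure_class(1)[OF P' D'(1)] by blast
qed

text \<open>Data that are equivalent as projective data are equivalent as complex data. A projective structure
  therefore lies in a single transversely complex structure.\<close>

lemma compatible_iff:
  assumes T: "T \<in> complex_structures A F" and P: "P \<in> projective_structures A F"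
  shows "P \<in> compatible_structures A F T \<longleftrightarrow> P \<inter> T \<noteq> {}"
    and "P \<in> compatible_structures A F T \<longleftrightarrow> P \<subseteq> T"
proof -
  let ?E = "transverse_equiv A F cp1_holomorphic_on"
  have dm: "transverse_data A F cp1_holomorphic_on D" if "transverse_data A F cp1_moebius_on D" for D
    by (rule transverse_data_mono[OF _ that]) (rule moebius_on_imp_holomorphic_on)
  have sub: "transverse_step A F cp1_moebius_on \<subseteq> transverse_step A F cp1_holomorphic_on"
    using dm by auto
  have mono: "(D, D') \<in> ?E" if "(D, D') \<in> transverse_equiv A F cp1_moebius_on" for D D'
    unfolding transverse_equiv_def
    by (rule trancl_mono[OF _ sub]) (use that in \<open>simp add: transverse_equiv_def\<close>)
  obtain D where D: "D \<in> P"
    by (rule structure_nonempty[OF P]) (rule that)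
  have 1: "P \<subseteq> T" if "?E `` P = T"
  proof
    fix D assume "D \<in> P"
    moreover have "transverse_data A F cp1_holomorphic_on D"
      by (rule dm[OF structure_class(2)[OF P \<open>D \<in> P\<close>]])
    then have "(D, D) \<in> ?E"
      using transverse_equiv_step[of A F cp1_holomorphic_on D D] by simp
    ultimately show "D \<in> T"
      using that by blast
  qed
  have 2: "?E `` P = T" if ne: "P \<inter> T \<noteq> {}"
  proof -
    obtain D0 where D0: "D0 \<in> P" "D0 \<in> T"
      using ne by blast
    have TE: "T = ?E `` {D0}"
      by (rule structure_class(1)[OF T D0(2)])
    have "(D0, D1) \<in> ?E" if "D1 \<in> P" for D1
      using mono structure_class(1)[OF P D0(1)] that by blast
    then show ?thesis
      unfolding TE using D0(1) transverse_equiv_trans by blast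
  qed
  have iff: "P \<in> compatible_structures A F T \<longleftrightarrow> ?E `` P = T"
    unfolding compatible_structures_def using P by blast
  show "P \<in> compatible_structures A F T \<longleftrightarrow> P \<inter> T \<noteq> {}"
    using 1 2 D iff by blast
  show "P \<in> compatible_structures A F T \<longleftrightarrow> P \<subseteq> T"
    using 1 2 D iff by blast
qed

section \<open>Finite-valued charts\<close>

lemma submersion_of_finite_chart:
  assumes \<sigma>: "submersion_chart A F U \<sigma>" and W: "open W" "W \<subseteq> U" "\<And>p. p \<in> W \<Longrightarrow> \<sigma> p = Cpt (w p)"
  shows "complex_submersion A F W w"
proof -
  have s: "submersion_chart A F W \<sigma>"
    by (rule submersion_chart_restrict[OF \<sigma> W(1,2)])
  have eq: "{p \<in> W. \<sigma> p \<in> fst (- {Infty}, affine_coord)} = W"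
    using W(3) by auto
  have "complex_submersion A F W (affine_coord \<circ> \<sigma>)"
    using submersion_of_chart[OF s affine_chart_in] unfolding eq by simp
  then show ?thesis
    by (rule submersion_compose[where \<Omega> = UNIV and f = "\<lambda>z. z"]) (use W(3) in auto)
qed

lemma projective_finite_chart:
  assumes P: "P \<in> projective_structures A F" and U: "(U, \<sigma>) \<in> \<Union>P"
    and W: "open W" "W \<subseteq> U" "\<And>p. p \<in> W \<Longrightarrow> \<sigma> p = Cpt (w p)"
  shows "(W, Cpt \<circ> w) \<in> \<Union>P"
proof (rule projective_maximal[OF P])
  have "complex_submersion A F W w"
    by (rule submersion_of_finite_chart[OF structure_chart[OF P U] W])
  then show "submersion_chart A F W (Cpt \<circ> w)"
    by (rule chart_of_submersion) simp
  show "\<exists>U \<sigma>. (U, \<sigma>) \<in> \<Union>P \<and> x \<in> U \<and> moebius_germ x \<sigma> (Cpt \<circ> w)" if "x \<in> W" for x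
    using U W that moebius_germ_eq[of W x "Cpt \<circ> w" \<sigma>] by auto
qed

lemma projective_submersion:
  assumes "P \<in> projective_structures A F" "(W, Cpt \<circ> w) \<in> \<Union>P"
  shows "complex_submersion A F W w"
proof -
  have "submersion_chart A F W (Cpt \<circ> w)"
    by (rule structure_chart[OF assms])
  then show ?thesis
    by (rule submersion_of_finite_chart) (use \<open>submersion_chart A F W (Cpt \<circ> w)\<close> in \<open>auto simp: submersion_chart_def\<close>)
qed

lemma projective_restrict:
  assumes "P \<in> projective_structures A F" "(W, Cpt \<circ> w) \<in> \<Union>P" "open V" "V \<subseteq> W"
  shows "(V, Cpt \<circ> w) \<in> \<Union>P"
  by (rule projective_finite_chart[OF assms]) simp

text \<open>A chart with the value \<open>Infty\<close> at \<open>p\<close> is composed with the inversion \<open>z \<mapsto> 1 / z\<close>.\<close>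

lemma projective_finite_cover:
  assumes P: "P \<in> projective_structures A F"
  obtains W w where "(W, Cpt \<circ> w) \<in> \<Union>P" "p \<in> W"
proof -
  obtain U \<sigma> where U: "(U, \<sigma>) \<in> \<Union>P" "p \<in> U"
    by (rule structure_cover[OF P]) (rule that)
  obtain c where c: "c \<in> cp1_atlas" "\<sigma> p \<in> fst c"
    using cp1_chart_cover by blast
  let ?W = "{x \<in> U. \<sigma> x \<in> fst c}"
  have sub: "complex_submersion A F ?W (snd c \<circ> \<sigma>)"
    by (rule submersion_of_chart[OF structure_chart[OF P U(1)] c(1)])
  obtain m where m: "m \<in> moebius_transformations" "\<And>z. z \<in> fst c \<Longrightarrow> Cpt (snd c z) = m z"
    using c(1)
  proof (cases rule: cp1_atlas_cases)
    case 1
    show ?thesis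
      by (rule that[OF moebius_transformation_id]) (auto simp: 1 not_Infty_iff)
  next
    case 2
    \<comment> \<open>The inversion \<open>z \<mapsto> 1 / z\<close>, normalised to determinant \<open>1\<close>.\<close>
    have "moebius 0 \<i> \<i> 0 \<in> moebius_transformations"
      unfolding moebius_transformations_def by (rule CollectI, intro exI conjI, rule refl) simp
    then show ?thesis
      by (rule that) (auto simp: 2 split: cp1.splits)
  qed
  have "(?W, Cpt \<circ> (snd c \<circ> \<sigma>)) \<in> \<Union>P"
  proof (rule projective_maximal[OF P])
    show "submersion_chart A F ?W (Cpt \<circ> (snd c \<circ> \<sigma>))"
      by (rule chart_of_submersion[OF sub]) simp
    show "\<exists>V \<tau>. (V, \<tau>) \<in> \<Union>P \<and> x \<in> V \<and> moebius_germ x \<tau> (Cpt \<circ> (snd c \<circ> \<sigma>))" if "x \<in> ?W" for x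
    proof -
      have "moebius_germ x \<sigma> (Cpt \<circ> (snd c \<circ> \<sigma>))"
        unfolding moebius_germ_def
        by (rule exI[of _ ?W], rule exI[of _ m]) (use submersion_open[OF sub] that m in auto)
      then show ?thesis
        using U(1) that by blast
    qed
  qed
  then show ?thesis
    by (rule that) (use U(2) c(2) in simp)
qed

text \<open>The functions that serve as local holomorphic coordinates on the leaf space of a transversely
  complex structure.\<close>

definition transverse_coordinate ::
    "('m \<Rightarrow> 'e set) \<Rightarrow> 'm tdata set \<Rightarrow> 'm set \<Rightarrow> ('m \<Rightarrow> complex) \<Rightarrow> bool" where
  "transverse_coordinate F T W w \<longleftrightarrow> complex_submersion A F W w \<and>
     (\<exists>(U, \<sigma>)\<in>\<Union>T. \<exists>c\<in>cp1_atlas. W \<subseteq> {p \<in> U. \<sigma> p \<in> fst c} \<and> (\<forall>p\<in>W. w p = snd c (\<sigma> p)))"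

lemma coordinate_of_chart:
  assumes "T \<in> complex_structures A F" "(U, \<sigma>) \<in> \<Union>T" "c \<in> cp1_atlas"
  shows "transverse_coordinate F T {p \<in> U. \<sigma> p \<in> fst c} (snd c \<circ> \<sigma>)"
  unfolding transverse_coordinate_def
  using submersion_of_chart[OF structure_chart[OF assms(1,2)] assms(3)] assms(2,3) by force

lemma coordinate_submersion: "transverse_coordinate F T W w \<Longrightarrow> complex_submersion A F W w"
  unfolding transverse_coordinate_def by blast

lemma coordinate_germ:
  assumes T: "T \<in> complex_structures A F"
    and w: "transverse_coordinate F T W w" and w': "transverse_coordinate F T W' w'"
    and p: "p \<in> W \<inter> W'"
  shows "holomorphic_germ p w w'"
proof -
  obtain U \<sigma> c where \<sigma>: "(U, \<sigma>) \<in> \<Union>T" "c \<in> cp1_atlas" "W \<subseteq> {p \<in> U. \<sigma> p \<in> fst c}" "\<forall>p\<in>W. w p = snd c (\<sigma> p)"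
    using w unfolding transverse_coordinate_def by blast
  obtain U' \<sigma>' c' where \<sigma>': "(U', \<sigma>') \<in> \<Union>T" "c' \<in> cp1_atlas" "W' \<subseteq> {p \<in> U'. \<sigma>' p \<in> fst c'}"
      "\<forall>p\<in>W'. w' p = snd c' (\<sigma>' p)"
    using w' unfolding transverse_coordinate_def by blast
  have pUU': "p \<in> U \<inter> U'"
    using p \<sigma>(3) \<sigma>'(3) by auto
  have "holomorphic_germ p (snd c \<circ> \<sigma>) (snd c' \<circ> \<sigma>')"
    using complex_germ[OF T \<sigma>(1) \<sigma>'(1) pUU'] \<sigma>(2,3) \<sigma>'(2,3) p
    unfolding holomorphic_chart_germ_def by blast
  then obtain V f where f: "open V" "p \<in> V" "f holomorphic_on ((snd c \<circ> \<sigma>) ` V)"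
      "\<forall>x\<in>V. (snd c' \<circ> \<sigma>') x = f ((snd c \<circ> \<sigma>) x)"
    unfolding holomorphic_germ_def by blast
  let ?V = "V \<inter> W \<inter> W'"
  have op: "open ?V" "p \<in> ?V"
    using f(1,2) p submersion_open[OF coordinate_submersion[OF w]]
      submersion_open[OF coordinate_submersion[OF w']] by auto
  have "w ` ?V \<subseteq> (snd c \<circ> \<sigma>) ` V"
    using \<sigma>(4) by auto
  then have "f holomorphic_on (w ` ?V)"
    by (rule holomorphic_on_subset[OF f(3)])
  moreover have "\<forall>x\<in>?V. w' x = f (w x)"
    using f(4) \<sigma>(4) \<sigma>'(4) by simp
  ultimately show ?thesis
    unfolding holomorphic_germ_def using op by blast
qed

text \<open>The derivative of the transition function has no zeros because both coordinates are submersions.\<close>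

lemma coordinate_transition:
  assumes T: "T \<in> complex_structures A F"
    and w: "transverse_coordinate F T W w" and w': "transverse_coordinate F T W' w'"
    and p: "p \<in> W" "p \<in> W'"
  obtains V f where "open V" "p \<in> V" "V \<subseteq> W \<inter> W'" "open (w ` V)" "f holomorphic_on (w ` V)"
    "\<And>x. x \<in> V \<Longrightarrow> w' x = f (w x)" "\<And>x. x \<in> V \<Longrightarrow> deriv f (w x) \<noteq> 0"
proof -
  obtain V f where f: "open V" "p \<in> V" "f holomorphic_on (w ` V)" "\<forall>x\<in>V. w' x = f (w x)"
    using coordinate_germ[OF T w w'] p unfolding holomorphic_germ_def by blast
  note sw = coordinate_submersion[OF w] and sw' = coordinate_submersion[OF w']
  let ?V = "V \<inter> W \<inter> W'"
  have op: "open ?V" "p \<in> ?V"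
    using f(1,2) p submersion_open[OF sw] submersion_open[OF sw'] by auto
  have hol: "f holomorphic_on (w ` ?V)"
    by (rule holomorphic_on_subset[OF f(3)]) auto
  have sV: "complex_submersion A F ?V w" "complex_submersion A F ?V w'"
    by (rule submersion_restrict[OF sw op(1)], blast) (rule submersion_restrict[OF sw' op(1)], blast)
  show ?thesis
  proof (rule that[OF op _ _ hol])
    show "open (w ` ?V)"
      by (rule submersion_open_map[OF sV(1) op(1) order_refl])
    show "deriv f (w x) \<noteq> 0" if "x \<in> ?V" for x
      by (rule transition_deriv_nonzero[OF sV hol _ that]) (use f(4) in auto)
  qed (use f(4) in auto)
qed

lemma compatible_coordinate:
  assumes T: "T \<in> complex_structures A F" and P: "P \<in> compatible_structures A F T"
    and w: "(W, Cpt \<circ> w) \<in> \<Union>P"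
  shows "transverse_coordinate F T W w"
proof -
  have P': "P \<in> projective_structures A F"
    using P unfolding compatible_structures_def by blast
  have "(W, Cpt \<circ> w) \<in> \<Union>T"
    using w compatible_iff(2)[OF T P'] P by blast
  then show ?thesis
    unfolding transverse_coordinate_def using projective_submersion[OF P' w]
    by (auto intro!: bexI[of _ "(W, Cpt \<circ> w)"] bexI[OF _ affine_chart_in])
qed

end

section \<open>The normal bundle in a coordinate\<close>

definition level_set :: "('e \<Rightarrow> complex) \<Rightarrow> complex \<Rightarrow> 'e set" where
  "level_set g z = {v. g v = z}"

text \<open>The \<open>(1,0)\<close> vectors are those of the form \<open>n - \<i> J n\<close>. If \<open>g\<close> is the differential of a coordinate, this is the one
  for the coset \<open>n\<close> on which \<open>g\<close> has the value \<open>x\<close>.\<close>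

definition lift10 :: "('e \<Rightarrow> complex) \<Rightarrow> complex \<Rightarrow> 'e set \<times> 'e set" where
  "lift10 g x = (level_set g x, level_set g (- \<i> * x))"

text \<open>The differential \<open>g\<close> of a coordinate vanishes exactly along the foliation and hence identifies the normal
  space with the complex numbers; cosets correspond to level sets.\<close>

locale defining_functional =
  fixes F :: "'m \<Rightarrow> 'e::real_vector set" and p :: 'm and g :: "'e \<Rightarrow> complex"
  assumes lin: "linear g" and surj: "surj g" and ker: "\<And>v. g v = 0 \<longleftrightarrow> v \<in> F p"
begin

lemma level_setE: obtains v where "g v = z"
  using surj by (metis surjD)

lemma normal_space_eq: "normal_space F p = range (level_set g)"
proof -
  have "{(u, v). u - v \<in> F p} `` {u} = level_set g (g u)" for u
    by (auto simp: level_set_def linear_diff[OF lin] simp flip: ker)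
  then have "normal_space F p = (\<lambda>u. level_set g (g u)) ` UNIV"
    unfolding normal_space_def quotient_def by auto
  also have "\<dots> = level_set g ` range g"
    by (simp add: image_image)
  finally show ?thesis
    using surj by simp
qed

lemma descend_level_set: "descend (\<lambda>v. D * g v) (level_set g z) = D * z"
proof -
  obtain v where "g v = z"
    by (rule level_setE)
  then have "(\<lambda>v. D * g v) ` level_set g z = {D * z}"
    by (auto simp: level_set_def)
  then show ?thesis
    by (simp add: descend_def)
qed

lemma descend_level_set1: "descend g (level_set g z) = z"
  using descend_level_set[of 1 z] by simp

lemma level_set_eq_iff: "level_set g x = level_set g y \<longleftrightarrow> x = y"
  by (metis descend_level_set1)

lemma nadd_level_set: "nadd (level_set g x) (level_set g y) = level_set g (x + y)"
proof (intro set_eqI iffI)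
  fix v assume "v \<in> nadd (level_set g x) (level_set g y)"
  then show "v \<in> level_set g (x + y)"
    by (auto simp: nadd_def level_set_def linear_add[OF lin])
next
  fix v assume v: "v \<in> level_set g (x + y)"
  obtain u where "g u = x"
    by (rule level_setE)
  then have "v = u + (v - u)" "u \<in> level_set g x" "v - u \<in> level_set g y"
    using v by (auto simp: level_set_def linear_diff[OF lin])
  then show "v \<in> nadd (level_set g x) (level_set g y)"
    unfolding nadd_def by blast
qed

lemma nscale_level_set: "nscale F p r (level_set g x) = level_set g (of_real r * x)"
proof (intro set_eqI iffI)
  fix v assume "v \<in> nscale F p r (level_set g x)"
  then show "v \<in> level_set g (of_real r * x)"
    using ker by (auto simp: nscale_def level_set_def linear_add[OF lin] linear_scale[OF lin] scaleR_conv_of_real)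
next
  fix v assume v: "v \<in> level_set g (of_real r * x)"
  obtain u where u: "g u = x"
    by (rule level_setE)
  have "g (v - r *\<^sub>R u) = 0"
    using v u by (simp add: level_set_def linear_diff[OF lin] linear_scale[OF lin] scaleR_conv_of_real)
  then have "v = r *\<^sub>R u + (v - r *\<^sub>R u)" "u \<in> level_set g x" "v - r *\<^sub>R u \<in> F p"
    using u ker by (auto simp: level_set_def)
  then show "v \<in> nscale F p r (level_set g x)"
    unfolding nscale_def by blast
qed

lemma ncadd_lift10: "ncadd (lift10 g x) (lift10 g y) = lift10 g (x + y)"
  by (simp add: ncadd_def lift10_def nadd_level_set algebra_simps)

lemma ncscale_level_set:
  fixes x y :: complex
  shows "ncscale F p c (level_set g x, level_set g y)
    = (level_set g (Re c * x - Im c * y), level_set g (Im c * x + Re c * y))"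
  by (simp add: ncscale_def nscale_level_set nadd_level_set)

lemma ncscale_lift10: "ncscale F p c (lift10 g x) = lift10 g (c * x)"
proof -
  have c: "c = Re c + \<i> * Im c"
    by (rule complex_eq)
  have "Re c * x - Im c * (- \<i> * x) = (Re c + \<i> * Im c) * x"
    "Im c * x + Re c * (- \<i> * x) = - \<i> * ((Re c + \<i> * Im c) * x)"
    by (simp_all add: algebra_simps)
  then show ?thesis
    unfolding lift10_def ncscale_level_set c[symmetric] by simp
qed

text \<open>The factor \<open>2\<close> arises as \<open>g n - \<i> g (J n) = x - \<i> (\<i> x)\<close>.\<close>

lemma cext_lift10: "cext (descend (\<lambda>v. D * g v)) (lift10 g x) = 2 * D * x"
  unfolding cext_def lift10_def fst_conv snd_conv descend_level_set
  by (simp add: algebra_simps)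

end

context smooth_manifold
begin

definition covector :: "('m \<Rightarrow> complex) \<Rightarrow> 'm \<Rightarrow> 'e set \<times> 'e set \<Rightarrow> complex" where
  "covector w p = cext (descend (dfun A w p))"

text \<open>The element \<open>k (dw)\<^sup>2\<close> of the fibre at \<open>p\<close>.\<close>

definition dz_square ::
    "('m \<Rightarrow> 'e set) \<Rightarrow> 'm tdata set \<Rightarrow> ('m \<Rightarrow> complex) \<Rightarrow> 'm \<Rightarrow> complex \<Rightarrow>
     'e set \<times> 'e set \<Rightarrow> 'e set \<times> 'e set \<Rightarrow> complex" where
  "dz_square F T w p k = (\<lambda>m n. if m \<in> normal10 A F T p \<and> n \<in> normal10 A F T p
     then k * covector w p m * covector w p n else 0)"

lemma dfun_coordinates:
  assumes T: "T \<in> complex_structures A F"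
    and w: "transverse_coordinate F T W w" and w': "transverse_coordinate F T W' w'"
    and p: "p \<in> W" "p \<in> W'"
  obtains D where "D \<noteq> 0" "dfun A w' p = (\<lambda>v. D * dfun A w p v)"
proof -
  obtain V f where V: "open V" "p \<in> V" "V \<subseteq> W \<inter> W'" "open (w ` V)" "f holomorphic_on (w ` V)"
    "\<And>x. x \<in> V \<Longrightarrow> w' x = f (w x)" "\<And>x. x \<in> V \<Longrightarrow> deriv f (w x) \<noteq> 0"
    by (rule coordinate_transition[OF T w w' p]) (rule that)
  have "complex_submersion A F V w"
    by (rule submersion_restrict[OF coordinate_submersion[OF w] V(1)]) (use V(3) in blast)
  from dfun_transition[OF this V(5,6,2)] V(7)[OF V(2)] show ?thesis
    by (rule that[rotated])
qed

lemma coordinate_functional: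
  "transverse_coordinate F T W w \<Longrightarrow> p \<in> W \<Longrightarrow> defining_functional F p (dfun A w p)"
  by (rule defining_functional.intro) (rule submersion_dfun[OF coordinate_submersion]; assumption)+

text \<open>The complex structure on the normal space is defined by one chosen chart. Transition maps being
  holomorphic, the differential of that chart is a complex multiple of the differential of \<open>w\<close>, so that
  both give the same multiplication by \<open>\<i>\<close>.\<close>

lemma normal10_eq:
  assumes T: "T \<in> complex_structures A F" and w: "transverse_coordinate F T W w" and p: "p \<in> W"
  shows "normal10 A F T p = range (lift10 (dfun A w p))"
proof -
  define g where "g = dfun A w p"
  interpret defining_functional F p g
    unfolding g_def by (rule coordinate_functional[OF w p])
  define s where "s = (SOME s. s \<in> \<Union>T \<and> p \<in> fst s)"
  have "\<exists>s. s \<in> \<Union>T \<and> p \<in> fst s"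
    by (rule structure_cover[OF T, of p]) (metis fst_conv)
  then have s: "s \<in> \<Union>T \<and> p \<in> fst s"
    unfolding s_def by (rule someI_ex)
  obtain U \<sigma> where \<sigma>: "s = (U, \<sigma>)" "(U, \<sigma>) \<in> \<Union>T" "p \<in> U"
    using s by (cases s) auto
  define c where "c = chart_at cp1_atlas (\<sigma> p)"
  have c: "c \<in> cp1_atlas" "\<sigma> p \<in> fst c"
    using chart_at_cp1 by (auto simp: c_def)
  obtain D where D: "D \<noteq> 0" "dfun A (snd c \<circ> \<sigma>) p = (\<lambda>v. D * dfun A w p v)"
    by (rule dfun_coordinates[OF T w coordinate_of_chart[OF T \<sigma>(2) c(1)] p])
       (use \<sigma>(3) c(2) in simp, rule that)
  have tm: "tangent_map A cp1_atlas (snd s) p = (\<lambda>v. D * g v)"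
    using D(2) \<sigma>(1) unfolding tangent_map_def c_def g_def by simp
  note N = normal_space_eq
  have J: "normal_J A F T p (level_set g x) = level_set g (\<i> * x)" for x
  proof -
    have "normal_J A F T p (level_set g x)
        = (THE m. m \<in> range (level_set g) \<and> descend (\<lambda>v. D * g v) m = \<i> * descend (\<lambda>v. D * g v) (level_set g x))"
      unfolding normal_J_def Let_def s_def[symmetric] tm N ..
    also have "\<dots> = level_set g (\<i> * x)"
    proof (rule the_equality)
      show "level_set g (\<i> * x) \<in> range (level_set g) \<and>
          descend (\<lambda>v. D * g v) (level_set g (\<i> * x)) = \<i> * descend (\<lambda>v. D * g v) (level_set g x)"
        by (simp add: descend_level_set)
      show "m = level_set g (\<i> * x)"
        if "m \<in> range (level_set g) \<and> descend (\<lambda>v. D * g v) m = \<i> * descend (\<lambda>v. D * g v) (level_set g x)" for m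
        using that D(1) by (auto simp: descend_level_set)
    qed
    finally show ?thesis .
  qed
  have "m \<in> normal10 A F T p \<longleftrightarrow> m \<in> range (lift10 g)" for m
  proof
    assume m: "m \<in> normal10 A F T p"
    then obtain x y where xy: "m = (level_set g x, level_set g y)"
      unfolding normal10_def N by auto
    have "(level_set g (\<i> * x), level_set g (\<i> * y)) = (level_set g (- y), level_set g x)"
      using m unfolding normal10_def xy by (simp add: J ncscale_level_set)
    then have "\<i> * x = - y"
      using level_set_eq_iff by simp
    then have "y = - \<i> * x"
      by (metis minus_equation_iff mult_minus_left)
    then show "m \<in> range (lift10 g)"
      unfolding xy lift10_def by blast
  next
    assume "m \<in> range (lift10 g)"
    then obtain x where "m = lift10 g x"
      by blast
    then show "m \<in> normal10 A F T p"
      unfolding normal10_def N lift10_def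
      by (simp add: J ncscale_level_set flip: mult.assoc)
  qed
  then show ?thesis
    unfolding g_def by blast
qed

lemma covector_lift10:
  assumes w: "transverse_coordinate F T W w" and p: "p \<in> W"
    and D: "dfun A w' p = (\<lambda>v. D * dfun A w p v)"
  shows "covector w' p (lift10 (dfun A w p) x) = 2 * D * x"
  unfolding covector_def D
  by (rule defining_functional.cext_lift10[OF coordinate_functional[OF w p]])

lemma covector_lift10_self:
  assumes w: "transverse_coordinate F T W w" and p: "p \<in> W"
  shows "covector w p (lift10 (dfun A w p) x) = 2 * x"
  using covector_lift10[OF w p, of w 1] by simp

lemma dz_square_fibre:
  assumes T: "T \<in> complex_structures A F" and w: "transverse_coordinate F T W w" and p: "p \<in> W"
  shows "dz_square F T w p k \<in> K2_fibre A F T p"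
proof -
  note g = coordinate_functional[OF w p]
  note eq = normal10_eq[OF T w p]
  let ?l = "lift10 (dfun A w p)"
  have val: "dz_square F T w p k (?l x) (?l y) = k * (2 * x) * (2 * y)" for x y
    by (simp add: dz_square_def eq covector_lift10_self[OF w p])
  have ops: "ncadd (?l x) (?l y) = ?l (x + y)" "ncscale F p c (?l x) = ?l (c * x)" for x y c
    by (rule defining_functional.ncadd_lift10[OF g], rule defining_functional.ncscale_lift10[OF g])
  have "\<forall>l\<in>normal10 A F T p. \<forall>m\<in>normal10 A F T p. \<forall>n\<in>normal10 A F T p. \<forall>c.
        dz_square F T w p k (ncadd l m) n = dz_square F T w p k l n + dz_square F T w p k m n \<and>
        dz_square F T w p k n (ncadd l m) = dz_square F T w p k n l + dz_square F T w p k n m \<and>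
        dz_square F T w p k (ncscale F p c m) n = c * dz_square F T w p k m n \<and>
        dz_square F T w p k m (ncscale F p c n) = c * dz_square F T w p k m n"
    unfolding eq by (simp add: ops val algebra_simps)
  moreover have "\<forall>m n. m \<notin> normal10 A F T p \<or> n \<notin> normal10 A F T p \<longrightarrow> dz_square F T w p k m n = 0"
    by (simp add: dz_square_def)
  ultimately show ?thesis
    unfolding K2_fibre_def by blast
qed

lemma dz_square_eq_iff:
  assumes T: "T \<in> complex_structures A F" and w: "transverse_coordinate F T W w" and p: "p \<in> W"
  shows "dz_square F T w p k = dz_square F T w p k' \<longleftrightarrow> k = k'"
proof
  assume eq: "dz_square F T w p k = dz_square F T w p k'"
  let ?l = "lift10 (dfun A w p) 1"
  have val: "dz_square F T w p k ?l ?l = k * 2 * 2" for k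
    by (simp add: dz_square_def normal10_eq[OF T w p] covector_lift10_self[OF w p])
  have "k * 2 * 2 = dz_square F T w p k ?l ?l"
    by (rule val[symmetric])
  also have "\<dots> = dz_square F T w p k' ?l ?l"
    by (simp only: eq)
  also have "\<dots> = k' * 2 * 2"
    by (rule val)
  finally show "k = k'"
    by simp
qed simp

lemma dz_square_change:
  assumes T: "T \<in> complex_structures A F" and w: "transverse_coordinate F T W w" and p: "p \<in> V"
    and V: "open V" "V \<subseteq> W" and f: "f holomorphic_on (w ` V)" "\<And>x. x \<in> V \<Longrightarrow> w' x = f (w x)"
  shows "dz_square F T w' p k = dz_square F T w p (k * (deriv f (w p))\<^sup>2)"
proof -
  have pW: "p \<in> W"
    using p V(2) by blast
  have D: "dfun A w' p = (\<lambda>v. deriv f (w p) * dfun A w p v)"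
    by (rule dfun_transition[OF submersion_restrict[OF coordinate_submersion[OF w] V] f p])
  have "covector w' p m = deriv f (w p) * covector w p m" if "m \<in> normal10 A F T p" for m
    using that covector_lift10[OF w pW D] covector_lift10_self[OF w pW]
    unfolding normal10_eq[OF T w pW] by auto
  then show ?thesis
    by (auto simp: dz_square_def fun_eq_iff power2_eq_square)
qed

lemma dz_square_add: "dz_square F T w p k + dz_square F T w p k' = dz_square F T w p (k + k')"
  by (auto simp: dz_square_def fun_eq_iff algebra_simps)

lemma dz_square_eqI:
  assumes "\<beta> \<in> K2_fibre A F T p"
    and "\<And>m n. m \<in> normal10 A F T p \<Longrightarrow> n \<in> normal10 A F T p \<Longrightarrow>
      \<beta> m n = k * covector w p m * covector w p n"
  shows "\<beta> = dz_square F T w p k"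
proof (intro ext)
  fix m n
  show "\<beta> m n = dz_square F T w p k m n"
  proof (cases "m \<in> normal10 A F T p \<and> n \<in> normal10 A F T p")
    case True
    then show ?thesis
      using assms(2) by (simp add: dz_square_def)
  next
    case False
    then have "\<beta> m n = 0"
      using assms(1) unfolding K2_fibre_def by blast
    then show ?thesis
      using False by (auto simp: dz_square_def)
  qed
qed

end

section \<open>Holomorphic sections in coordinates\<close>

lemma cp1_chart_inv:
  assumes "c \<in> cp1_atlas"
  shows "chart_inv c y \<in> fst c" "snd c (chart_inv c y) = y" "z \<in> fst c \<Longrightarrow> chart_inv c (snd c z) = z"
    "continuous_on UNIV (chart_inv c)"
proof -
  have "chart_inv c y \<in> fst c \<and> snd c (chart_inv c y) = y \<and>
      (z \<in> fst c \<longrightarrow> chart_inv c (snd c z) = z) \<and> continuous_on UNIV (chart_inv c)"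
    using assms
  proof (cases rule: cp1_atlas_cases)
    case 1
    show ?thesis
      unfolding 1 chart_inv_affine by (cases z) (simp_all add: continuous_on_Cpt)
  next
    case 2
    show ?thesis
      unfolding 2 chart_inv_inverse
      by (intro conjI continuous_on_cp1_inf; cases z) (simp_all add: cp1_inf_def)
  qed
  then show "chart_inv c y \<in> fst c" "snd c (chart_inv c y) = y"
    "z \<in> fst c \<Longrightarrow> chart_inv c (snd c z) = z" "continuous_on UNIV (chart_inv c)"
    by blast+
qed

lemma dfun_cp1:
  assumes c: "c \<in> cp1_atlas" and z: "z \<in> fst c"
    and f: "\<And>x. x \<in> fst (chart_at cp1_atlas z) \<inter> fst c \<Longrightarrow> snd c x = f (snd (chart_at cp1_atlas z) x)"
    and D: "(f has_field_derivative D) (at (snd (chart_at cp1_atlas z) z))"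
  shows "dfun cp1_atlas (snd c) z = (\<lambda>v. D * v)"
proof -
  define c0 where "c0 = chart_at cp1_atlas z"
  have c0: "c0 \<in> cp1_atlas" "z \<in> fst c0"
    using chart_at_cp1 by (auto simp: c0_def)
  let ?S = "chart_inv c0 -` fst c"
  have "open ?S"
    using cp1_chart_inv(4)[OF c0(1)] open_cp1_chart_domain[OF c] by (simp add: continuous_on_open_vimage)
  moreover have "snd c0 z \<in> ?S"
    using cp1_chart_inv(3)[OF c0] z by simp
  moreover have "f y = (snd c \<circ> chart_inv c0) y" if "y \<in> ?S" for y
    using f[folded c0_def, of "chart_inv c0 y"] that cp1_chart_inv(1,2)[OF c0(1)] by simp
  ultimately have "(snd c \<circ> chart_inv c0 has_derivative (*) D) (at (snd c0 z))"
    using has_derivative_transform_within_open[of f "(*) D" "snd c0 z" UNIV ?S "snd c \<circ> chart_inv c0"]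
      D[folded c0_def] unfolding has_field_derivative_def by simp
  from frechet_derivative_at[OF this] show ?thesis
    unfolding dfun_def c0_def by auto
qed

lemma dfun_cp1_change:
  assumes "z \<noteq> Infty" "z \<noteq> Cpt 0"
  shows "dfun cp1_atlas affine_coord z = (\<lambda>v. - 1 / (inverse_coord z)\<^sup>2 * dfun cp1_atlas inverse_coord z v)"
proof -
  have der: "((\<lambda>z. 1 / z) has_field_derivative - 1 / x\<^sup>2) (at x)" if "x \<noteq> 0" for x :: complex
    using that by (auto intro!: derivative_eq_intros simp: power2_eq_square)
  obtain x where x: "z = Cpt x" "x \<noteq> 0"
    using assms by (cases z) auto
  have 1: "dfun cp1_atlas (snd c) z = (\<lambda>v. v)" if "c = chart_at cp1_atlas z" for c
    using dfun_cp1[of c z "\<lambda>y. y" 1] chart_at_cp1[of z] that by simp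
  have 2: "dfun cp1_atlas (snd c) z = (\<lambda>v. - 1 / (snd (chart_at cp1_atlas z) z)\<^sup>2 * v)"
    if "c \<in> cp1_atlas" "c \<noteq> chart_at cp1_atlas z" for c
  proof (rule dfun_cp1)
    show "snd c y = 1 / snd (chart_at cp1_atlas z) y" if "y \<in> fst (chart_at cp1_atlas z) \<inter> fst c" for y
      using \<open>c \<in> cp1_atlas\<close> \<open>c \<noteq> chart_at cp1_atlas z\<close> that chart_at_cp1(1)[of z]
      unfolding cp1_atlas_def by (auto split: cp1.splits)
    show "((\<lambda>z. 1 / z) has_field_derivative - 1 / (snd (chart_at cp1_atlas z) z)\<^sup>2) (at (snd (chart_at cp1_atlas z) z))"
      by (rule der) (use chart_at_cp1(1)[of z] x in \<open>auto elim!: cp1_atlas_cases\<close>)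
    show "z \<in> fst c"
      using that(1) x by (auto elim!: cp1_atlas_cases)
  qed (rule that(1))
  show ?thesis
    using chart_at_cp1(1)[of z]
  proof (cases rule: cp1_atlas_cases)
    case c: 1
    have "dfun cp1_atlas affine_coord z = (\<lambda>v. v)"
      using 1[of "(- {Infty}, affine_coord)"] c by simp
    moreover have "dfun cp1_atlas inverse_coord z = (\<lambda>v. - 1 / x\<^sup>2 * v)"
      using 2[OF inverse_chart_in] c x by auto
    ultimately show ?thesis
      using x by (simp add: power_divide)
  next
    case c: 2
    have "dfun cp1_atlas inverse_coord z = (\<lambda>v. v)"
      using 1[of "(- {Cpt 0}, inverse_coord)"] c by simp
    moreover have "dfun cp1_atlas affine_coord z = (\<lambda>v. - 1 / (1 / x)\<^sup>2 * v)"
      using 2[OF affine_chart_in] c x by auto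
    ultimately show ?thesis
      using x by simp
  qed
qed

lemma cext_scale: "cext (\<lambda>v. D * L v) m = D * cext L m"
  by (simp add: cext_def algebra_simps)

text \<open>With \<open>x = 1 / z\<close> one has \<open>dz = - dx / x\<^sup>2\<close>, so the coefficient in the other chart is \<open>h (1 / x) / x\<^sup>4\<close>. The
  domain does not contain \<open>x = 0\<close>.\<close>

lemma quadratic_differential_of_affine:
  assumes "h holomorphic_on S"
  shows "holomorphic_quadratic_differential (Cpt ` S)
    (\<lambda>z m n. h (affine_coord z) * cext (dfun cp1_atlas affine_coord z) m * cext (dfun cp1_atlas affine_coord z) n)"
  unfolding holomorphic_quadratic_differential_def
proof
  fix c assume "c \<in> cp1_atlas"
  then show "\<exists>h'. h' holomorphic_on snd c ` (Cpt ` S \<inter> fst c) \<and>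
      (\<forall>z\<in>Cpt ` S \<inter> fst c. \<forall>m\<in>cp1_tangent10. \<forall>n\<in>cp1_tangent10.
        h (affine_coord z) * cext (dfun cp1_atlas affine_coord z) m * cext (dfun cp1_atlas affine_coord z) n
        = h' (snd c z) * cext (dfun cp1_atlas (snd c) z) m * cext (dfun cp1_atlas (snd c) z) n)"
  proof (cases rule: cp1_atlas_cases)
    case 1
    have "h holomorphic_on snd c ` (Cpt ` S \<inter> fst c)"
      by (rule holomorphic_on_subset[OF assms]) (auto simp: 1)
    then show ?thesis
      by (intro exI[of _ h]) (simp add: 1)
  next
    case 2
    let ?S = "snd c ` (Cpt ` S \<inter> fst c)"
    have S: "x \<noteq> 0 \<and> 1 / x \<in> S" if "x \<in> ?S" for x
      using that unfolding 2 by auto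
    have "(h \<circ> (\<lambda>x. 1 / x)) holomorphic_on ?S"
      by (rule holomorphic_on_compose_gen[OF _ assms]) (use S in \<open>auto intro!: holomorphic_intros\<close>)
    then have hol: "(\<lambda>x. h (1 / x) * (- 1 / x\<^sup>2)\<^sup>2) holomorphic_on ?S"
      unfolding o_def by (intro holomorphic_intros) (use S in auto)
    show ?thesis
    proof (intro exI[of _ "\<lambda>x. h (1 / x) * (- 1 / x\<^sup>2)\<^sup>2"] conjI hol ballI)
      fix z m n assume z: "z \<in> Cpt ` S \<inter> fst c"
      then have z': "z \<noteq> Infty" "z \<noteq> Cpt 0"
        unfolding 2 by auto
      then have "affine_coord z = 1 / inverse_coord z"
        by (cases z) auto
      then show "h (affine_coord z) * cext (dfun cp1_atlas affine_coord z) m * cext (dfun cp1_atlas affine_coord z) n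
        = h (1 / snd c z) * (- 1 / (snd c z)\<^sup>2)\<^sup>2 * cext (dfun cp1_atlas (snd c) z) m * cext (dfun cp1_atlas (snd c) z) n"
        unfolding dfun_cp1_change[OF z'] cext_scale 2 snd_conv
        by (simp only: power2_eq_square mult_ac)
    qed
  qed
qed

context smooth_manifold
begin

text \<open>The pullback is defined through the preferred chart of the projective line at \<open>\<sigma> p\<close>; the chain rule turns
  it into an expression in the coordinate \<open>snd c \<circ> \<sigma>\<close>.\<close>

lemma pullback_quadratic_coordinate:
  assumes T: "T \<in> complex_structures A F" and \<sigma>: "(U, \<sigma>) \<in> \<Union>T" "p \<in> U"
    and c: "c \<in> cp1_atlas" "\<sigma> p \<in> fst c"
    and \<theta>: "\<And>m n. m \<in> cp1_tangent10 \<Longrightarrow> n \<in> cp1_tangent10 \<Longrightarrow>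
      \<theta> (\<sigma> p) m n = k * cext (dfun cp1_atlas (snd c) (\<sigma> p)) m * cext (dfun cp1_atlas (snd c) (\<sigma> p)) n"
  shows "pullback_quadratic A F T \<sigma> \<theta> p = dz_square F T (snd c \<circ> \<sigma>) p k"
proof -
  define c0 where "c0 = chart_at cp1_atlas (\<sigma> p)"
  have c0: "c0 \<in> cp1_atlas" "\<sigma> p \<in> fst c0"
    using chart_at_cp1 by (auto simp: c0_def)
  let ?W = "{x \<in> U. \<sigma> x \<in> fst c0}"
  have w: "transverse_coordinate F T ?W (snd c0 \<circ> \<sigma>)" and pW: "p \<in> ?W"
    using coordinate_of_chart[OF T \<sigma>(1) c0(1)] \<sigma>(2) c0(2) by auto
  define g where "g = dfun A (snd c0 \<circ> \<sigma>) p"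
  interpret defining_functional F p g
    unfolding g_def by (rule coordinate_functional[OF w pW])
  obtain f where f: "\<And>z. z \<in> fst c0 \<inter> fst c \<Longrightarrow> snd c z = f (snd c0 z)"
    "\<And>z. z \<in> fst c0 \<inter> fst c \<Longrightarrow> \<exists>D. D \<noteq> 0 \<and> (f has_field_derivative D) (at (snd c0 z))"
    by (rule cp1_chart_change[OF c0(1) c(1)]) (rule that)
  obtain D where D: "D \<noteq> 0" "(f has_field_derivative D) (at (snd c0 (\<sigma> p)))"
    using f(2)[of "\<sigma> p"] c0(2) c(2) by auto
  have dc: "dfun cp1_atlas (snd c) (\<sigma> p) = (\<lambda>v. D * v)"
    by (rule dfun_cp1[OF c]) (use f(1) D(2) in \<open>auto simp: c0_def\<close>)
  have dw: "dfun A (snd c \<circ> \<sigma>) p = (\<lambda>v. D * dfun A (snd c0 \<circ> \<sigma>) p v)"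
  proof (rule dfun_compose(2)[where W = "?W \<inter> {x \<in> U. \<sigma> x \<in> fst c}" and f = f])
    show "open (?W \<inter> {x \<in> U. \<sigma> x \<in> fst c})"
      using submersion_open[OF coordinate_submersion[OF w]]
        submersion_open[OF coordinate_submersion[OF coordinate_of_chart[OF T \<sigma>(1) c(1)]]] by (rule open_Int)
    show "p \<in> ?W \<inter> {x \<in> U. \<sigma> x \<in> fst c}"
      using pW c(2) \<sigma>(2) by simp
    show "differentiable_at_point A (snd c0 \<circ> \<sigma>) p"
      by (rule submersion_differentiable[OF coordinate_submersion[OF w] pW])
    show "(f has_field_derivative D) (at ((snd c0 \<circ> \<sigma>) p))"
      using D(2) by simp
    show "(snd c \<circ> \<sigma>) x = f ((snd c0 \<circ> \<sigma>) x)" if "x \<in> ?W \<inter> {x \<in> U. \<sigma> x \<in> fst c}" for x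
      using f(1)[of "\<sigma> x"] that by simp
  qed
  have tm: "tangent_map A cp1_atlas \<sigma> p = g"
    unfolding tangent_map_def g_def c0_def ..
  have image: "map_prod (descend g) (descend g) (lift10 g x) = (x, - \<i> * x)" for x
    by (simp add: lift10_def descend_level_set1)
  have in10: "(x, - \<i> * x) \<in> cp1_tangent10" for x
    by (simp add: cp1_tangent10_def)
  have cx: "cext (dfun cp1_atlas (snd c) (\<sigma> p)) (x, - \<i> * x) = 2 * D * x" for x
    by (simp add: dc cext_def algebra_simps)
  have cov: "covector (snd c \<circ> \<sigma>) p (lift10 g x) = 2 * D * x" for x
    using covector_lift10[OF w pW dw] by (simp add: g_def)
  have N: "normal10 A F T p = range (lift10 g)"
    unfolding g_def by (rule normal10_eq[OF T w pW])
  show ?thesis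
  proof (intro ext)
    fix m n
    show "pullback_quadratic A F T \<sigma> \<theta> p m n = dz_square F T (snd c \<circ> \<sigma>) p k m n"
    proof (cases "m \<in> range (lift10 g) \<and> n \<in> range (lift10 g)")
      case True
      then obtain x y where xy: "m = lift10 g x" "n = lift10 g y"
        by blast
      show ?thesis
        unfolding xy pullback_quadratic_def dz_square_def Let_def N tm image cov \<theta>[OF in10 in10] cx
        by simp
    next
      case False
      then show ?thesis
        unfolding pullback_quadratic_def dz_square_def Let_def N by auto
    qed
  qed
qed

text \<open>Transverse holomorphy does not depend on the coordinate, because a change of coordinates multiplies the
  coefficient by the square of a holomorphic derivative. It may thus be tested in the coordinates of a
  compatible projective structure, in which the differences are expressed.\<close>

lemma H0_K2_iff:
  assumes T: "T \<in> complex_structures A F" and P: "P \<in> compatible_structures A F T"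
  shows "q \<in> H0_K2 A F T \<longleftrightarrow>
    (\<forall>p. \<exists>W w h. p \<in> W \<and> (W, Cpt \<circ> w) \<in> \<Union>P \<and> h holomorphic_on (w ` W) \<and>
       (\<forall>x\<in>W. q x = dz_square F T w x (h (w x))))" (is "_ \<longleftrightarrow> ?R")
proof
  have P': "P \<in> projective_structures A F"
    using P unfolding compatible_structures_def by blast
  {
    assume q: "q \<in> H0_K2 A F T"
    show ?R
    proof
      fix p
      obtain U \<sigma> \<theta> where \<sigma>: "(U, \<sigma>) \<in> \<Union>T" "p \<in> U" "holomorphic_quadratic_differential (\<sigma> ` U) \<theta>"
          "\<forall>x\<in>U. q x = pullback_quadratic A F T \<sigma> \<theta> x"
        using q unfolding H0_K2_def by blast
      obtain c where c: "c \<in> cp1_atlas" "\<sigma> p \<in> fst c"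
        using cp1_chart_cover by blast
      obtain h where h: "h holomorphic_on (snd c ` (\<sigma> ` U \<inter> fst c))"
          "\<forall>z\<in>\<sigma> ` U \<inter> fst c. \<forall>m\<in>cp1_tangent10. \<forall>n\<in>cp1_tangent10.
           \<theta> z m n = h (snd c z) * cext (dfun cp1_atlas (snd c) z) m * cext (dfun cp1_atlas (snd c) z) n"
        using \<sigma>(3) c(1) unfolding holomorphic_quadratic_differential_def by blast
      let ?W = "{x \<in> U. \<sigma> x \<in> fst c}"
      have w1: "transverse_coordinate F T ?W (snd c \<circ> \<sigma>)"
        by (rule coordinate_of_chart[OF T \<sigma>(1) c(1)])
      have q1: "q x = dz_square F T (snd c \<circ> \<sigma>) x (h ((snd c \<circ> \<sigma>) x))" if "x \<in> ?W" for x
      proof -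
        have "q x = pullback_quadratic A F T \<sigma> \<theta> x"
          using \<sigma>(4) that by blast
        also have "\<dots> = dz_square F T (snd c \<circ> \<sigma>) x (h ((snd c \<circ> \<sigma>) x))"
          by (rule pullback_quadratic_coordinate[OF T \<sigma>(1) _ c(1)]) (use that h(2) in auto)
        finally show ?thesis .
      qed
      obtain W2 w2 where w2: "(W2, Cpt \<circ> w2) \<in> \<Union>P" "p \<in> W2"
        by (rule projective_finite_cover[OF P']) (rule that)
      note cw2 = compatible_coordinate[OF T P w2(1)]
      have pW: "p \<in> ?W"
        using \<sigma>(2) c(2) by simp
      obtain V f where V: "open V" "p \<in> V" "V \<subseteq> W2 \<inter> ?W" "open (w2 ` V)" "f holomorphic_on (w2 ` V)"
        "\<And>x. x \<in> V \<Longrightarrow> (snd c \<circ> \<sigma>) x = f (w2 x)" "\<And>x. x \<in> V \<Longrightarrow> deriv f (w2 x) \<noteq> 0"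
        by (rule coordinate_transition[OF T cw2 w1 w2(2) pW]) (rule that)
      have VW2: "V \<subseteq> W2"
        using V(3) by blast
      have "(h \<circ> f) holomorphic_on (w2 ` V)"
      proof (rule holomorphic_on_compose_gen[OF V(5) h(1)])
        show "f ` w2 ` V \<subseteq> snd c ` (\<sigma> ` U \<inter> fst c)"
        proof clarify
          fix x assume x: "x \<in> V"
          then have "f (w2 x) = snd c (\<sigma> x)" "\<sigma> x \<in> \<sigma> ` U \<inter> fst c"
            using V(3,6) by auto
          then show "f (w2 x) \<in> snd c ` (\<sigma> ` U \<inter> fst c)"
            by auto
        qed
      qed
      then have hol: "(\<lambda>z. h (f z) * (deriv f z)\<^sup>2) holomorphic_on (w2 ` V)"
        unfolding o_def by (intro holomorphic_intros holomorphic_deriv[OF V(5,4)])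
      have "q x = dz_square F T w2 x (h (f (w2 x)) * (deriv f (w2 x))\<^sup>2)" if x: "x \<in> V" for x
      proof -
        have "q x = dz_square F T (snd c \<circ> \<sigma>) x (h (f (w2 x)))"
          using q1[of x] V(3) V(6)[OF x] x by auto
        also have "\<dots> = dz_square F T w2 x (h (f (w2 x)) * (deriv f (w2 x))\<^sup>2)"
          by (rule dz_square_change[OF T cw2 x V(1) VW2 V(5,6)])
        finally show ?thesis .
      qed
      then show "\<exists>W w h. p \<in> W \<and> (W, Cpt \<circ> w) \<in> \<Union>P \<and> h holomorphic_on (w ` W) \<and>
          (\<forall>x\<in>W. q x = dz_square F T w x (h (w x)))"
        using V(2) hol projective_restrict[OF P' w2(1) V(1) VW2]
        by (intro exI[of _ V] exI[of _ w2] exI[of _ "\<lambda>z. h (f z) * (deriv f z)\<^sup>2"]) simp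
    qed
  next
    assume R: ?R
    have "q p \<in> K2_fibre A F T p \<and> (\<exists>(U, \<sigma>)\<in>\<Union>T. p \<in> U \<and>
        (\<exists>\<theta>. holomorphic_quadratic_differential (\<sigma> ` U) \<theta> \<and>
             (\<forall>x\<in>U. q x = pullback_quadratic A F T \<sigma> \<theta> x)))" for p
    proof -
      obtain W w h where w: "p \<in> W" "(W, Cpt \<circ> w) \<in> \<Union>P" "h holomorphic_on (w ` W)"
          "\<forall>x\<in>W. q x = dz_square F T w x (h (w x))"
        using spec[OF R, of p] by (elim exE conjE) (rule that)
      note cw = compatible_coordinate[OF T P w(2)]
      have wT: "(W, Cpt \<circ> w) \<in> \<Union>T"
        using w(2) P compatible_iff(2)[OF T P'] by blast
      define \<theta> where "\<theta> = (\<lambda>z m n. h (affine_coord z) * cext (dfun cp1_atlas affine_coord z) m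
        * cext (dfun cp1_atlas affine_coord z) n)"
      have hol: "holomorphic_quadratic_differential ((Cpt \<circ> w) ` W) \<theta>"
        unfolding \<theta>_def image_comp[symmetric] by (rule quadratic_differential_of_affine[OF w(3)])
      have pull: "\<forall>x\<in>W. q x = pullback_quadratic A F T (Cpt \<circ> w) \<theta> x"
      proof
        fix x assume x: "x \<in> W"
        have "pullback_quadratic A F T (Cpt \<circ> w) \<theta> x
            = dz_square F T (snd (- {Infty}, affine_coord) \<circ> (Cpt \<circ> w)) x (h (w x))"
          by (rule pullback_quadratic_coordinate[OF T wT x affine_chart_in]) (simp_all add: \<theta>_def)
        also have "snd (- {Infty}, affine_coord) \<circ> (Cpt \<circ> w) = w"
          by auto
        finally have "pullback_quadratic A F T (Cpt \<circ> w) \<theta> x = dz_square F T w x (h (w x))" .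
        moreover have "q x = dz_square F T w x (h (w x))"
          using w(4) x by (rule bspec)
        ultimately show "q x = pullback_quadratic A F T (Cpt \<circ> w) \<theta> x"
          by (simp only:)
      qed
      have fibre: "q p \<in> K2_fibre A F T p"
        using w(4) w(1) dz_square_fibre[OF T cw w(1)] by simp
      show ?thesis
        by (intro conjI fibre, rule bexI[OF _ wT], unfold prod.case)
           (intro conjI exI[of _ \<theta>] w(1) hol pull)
    qed
    then show "q \<in> H0_K2 A F T"
      unfolding H0_K2_def by blast
  }
qed

end

section \<open>Differences of projective structures\<close>

text \<open>By the chain rule, both sides are the Schwarzian derivative of \<open>g \<circ> m\<close>: it is composed of \<open>m\<close> and \<open>g\<close> as well as
  of \<open>f\<close> and a Moebius transformation, and Moebius transformations contribute zero.\<close>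

lemma schwarzian_moebius_change:
  fixes a b c d a' b' c' d' :: complex
  assumes det: "a * d - b * c = 1" "a' * d' - b' * c' = 1"
    and U: "open U" "z \<in> U" "f holomorphic_on U" "deriv f z \<noteq> 0"
    and V: "open V" "g holomorphic_on V" "\<And>x. x \<in> U \<Longrightarrow> m x \<in> V" "deriv g (m z) \<noteq> 0"
    and m: "\<And>x. x \<in> U \<Longrightarrow> c * x + d \<noteq> 0 \<and> m x = (a * x + b) / (c * x + d)"
    and eq: "\<And>x. x \<in> U \<Longrightarrow> c' * f x + d' \<noteq> 0 \<and> g (m x) = (a' * f x + b') / (c' * f x + d')"
  shows "schwarzian g (m z) * (deriv m z)\<^sup>2 = schwarzian f z"
proof -
  have mder: "(m has_field_derivative 1 / (c * x + d)\<^sup>2) (at x)" if "x \<in> U" for x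
  proof (rule has_field_derivative_transform_within_open[OF moebius_has_derivative[OF det(1)] U(1) that])
    show "c * x + d \<noteq> 0"
      using m[OF that] by blast
    show "(a * y + b) / (c * y + d) = m y" if "y \<in> U" for y
      using m[OF that] by simp
  qed
  have mhol: "m holomorphic_on U"
    unfolding holomorphic_on_open[OF U(1)] using mder by blast
  have mnz: "deriv m z \<noteq> 0"
    using DERIV_imp_deriv[OF mder[OF U(2)]] m[OF U(2)] by simp
  have mS: "schwarzian m z = 0"
    by (rule schwarzian_moebius[OF U(1,2) det(1)]) (rule m)
  have 1: "schwarzian (\<lambda>x. g (m x)) z = schwarzian g (m z) * (deriv m z)\<^sup>2 + schwarzian m z"
    by (rule schwarzian_compose[OF U(1) mhol V(1,2) _ U(2) mnz V(4)]) (use V(3) in blast)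
  define n where "n = (\<lambda>y. (a' * y + b') / (c' * y + d'))"
  define N where "N = {y. c' * y + d' \<noteq> 0}"
  have N: "open N" "f z \<in> N"
    unfolding N_def using eq[OF U(2)] by (auto intro!: open_Collect_neq continuous_intros)
  have nder: "(n has_field_derivative 1 / (c' * y + d')\<^sup>2) (at y)" if "y \<in> N" for y
    unfolding n_def by (rule moebius_has_derivative[OF det(2)]) (use that N_def in simp)
  have nhol: "n holomorphic_on N"
    unfolding holomorphic_on_open[OF N(1)] using nder by blast
  have nnz: "deriv n (f z) \<noteq> 0"
    using DERIV_imp_deriv[OF nder[OF N(2)]] N(2) by (simp add: N_def)
  have nS: "schwarzian n (f z) = 0"
    by (rule schwarzian_moebius[OF N det(2)]) (simp add: n_def N_def)
  have 2: "schwarzian (\<lambda>x. n (f x)) z = schwarzian n (f z) * (deriv f z)\<^sup>2 + schwarzian f z"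
    by (rule schwarzian_compose[OF U(1,3) N(1) nhol _ U(2,4) nnz]) (use eq N_def in blast)
  have "schwarzian (\<lambda>x. g (m x)) z = schwarzian (\<lambda>x. n (f x)) z"
    by (rule schwarzian_cong[OF U(1) _ U(2)]) (use eq n_def in simp)
  then show ?thesis
    using 1 2 mS nS by simp
qed

context smooth_manifold
begin

lemma compatible_projective: "P \<in> compatible_structures A F T \<Longrightarrow> P \<in> projective_structures A F"
  unfolding compatible_structures_def by blast

text \<open>Coordinates of two structures on the same domain, with the transition function \<open>f\<close> whose Schwarzian
  derivative measures how the structures differ there.\<close>

definition coordinate_pair ::
    "'m tdata set \<Rightarrow> 'm tdata set \<Rightarrow> 'm set \<Rightarrow> ('m \<Rightarrow> complex) \<Rightarrow> ('m \<Rightarrow> complex) \<Rightarrow>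
     (complex \<Rightarrow> complex) \<Rightarrow> bool" where
  "coordinate_pair P P' W w w' f \<longleftrightarrow> (W, Cpt \<circ> w) \<in> \<Union>P \<and> (W, Cpt \<circ> w') \<in> \<Union>P' \<and>
     f holomorphic_on (w ` W) \<and> (\<forall>x\<in>W. w' x = f (w x))"

lemma coordinate_pair_facts:
  assumes P: "P \<in> projective_structures A F" and P': "P' \<in> projective_structures A F"
    and c: "coordinate_pair P P' W w w' f"
  shows "open W" "complex_submersion A F W w" "complex_submersion A F W w'" "open (w ` W)"
    "\<And>x. x \<in> W \<Longrightarrow> deriv f (w x) \<noteq> 0"
proof -
  show w: "complex_submersion A F W w" and w': "complex_submersion A F W w'"
    using projective_submersion[OF P] projective_submersion[OF P'] c
    unfolding coordinate_pair_def by blast+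
  show "open W"
    by (rule submersion_open[OF w])
  then show "open (w ` W)"
    by (rule submersion_open_map[OF w _ order_refl])
  show "deriv f (w x) \<noteq> 0" if "x \<in> W" for x
    by (rule transition_deriv_nonzero[OF w w' _ _ that]) (use c in \<open>auto simp: coordinate_pair_def\<close>)
qed

lemma coordinate_pair_restrict:
  assumes P: "P \<in> projective_structures A F" and P': "P' \<in> projective_structures A F"
    and c: "coordinate_pair P P' W w w' f" and V: "open V" "V \<subseteq> W"
  shows "coordinate_pair P P' V w w' f"
  unfolding coordinate_pair_def
proof (intro conjI)
  show "(V, Cpt \<circ> w) \<in> \<Union>P" "(V, Cpt \<circ> w') \<in> \<Union>P'"
    using projective_restrict[OF P _ V] projective_restrict[OF P' _ V] c
    unfolding coordinate_pair_def by blast+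
  show "f holomorphic_on (w ` V)"
    by (rule holomorphic_on_subset[of f "w ` W"]) (use c V(2) in \<open>auto simp: coordinate_pair_def\<close>)
  show "\<forall>x\<in>V. w' x = f (w x)"
    using c V(2) unfolding coordinate_pair_def by blast
qed

lemma coordinate_pair_exists:
  assumes T: "T \<in> complex_structures A F"
    and P: "P \<in> compatible_structures A F T" and P': "P' \<in> compatible_structures A F T"
    and w: "(W, Cpt \<circ> w) \<in> \<Union>P" "p \<in> W" and w': "(W', Cpt \<circ> w') \<in> \<Union>P'" "p \<in> W'"
  obtains V f where "p \<in> V" "V \<subseteq> W \<inter> W'" "coordinate_pair P P' V w w' f"
proof -
  obtain V f where V: "open V" "p \<in> V" "V \<subseteq> W \<inter> W'" "open (w ` V)" "f holomorphic_on (w ` V)"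
    "\<And>x. x \<in> V \<Longrightarrow> w' x = f (w x)" "\<And>x. x \<in> V \<Longrightarrow> deriv f (w x) \<noteq> 0"
    by (rule coordinate_transition[OF T compatible_coordinate[OF T P w(1)]
          compatible_coordinate[OF T P' w'(1)] w(2) w'(2)]) (rule that)
  have "(V, Cpt \<circ> w) \<in> \<Union>P"
    by (rule projective_restrict[OF compatible_projective[OF P] w(1) V(1)]) (use V(3) in blast)
  moreover have "(V, Cpt \<circ> w') \<in> \<Union>P'"
    by (rule projective_restrict[OF compatible_projective[OF P'] w'(1) V(1)]) (use V(3) in blast)
  ultimately have "coordinate_pair P P' V w w' f"
    unfolding coordinate_pair_def using V(5,6) by blast
  then show ?thesis
    by (rule that[OF V(2,3)])
qed

lemma coordinate_pair_cover:
  assumes T: "T \<in> complex_structures A F"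
    and P: "P \<in> compatible_structures A F T" and P': "P' \<in> compatible_structures A F T"
  obtains W w w' f where "p \<in> W" "coordinate_pair P P' W w w' f"
proof -
  obtain W w where w: "(W, Cpt \<circ> w) \<in> \<Union>P" "p \<in> W"
    by (rule projective_finite_cover[OF compatible_projective[OF P]]) (rule that)
  obtain W' w' where w': "(W', Cpt \<circ> w') \<in> \<Union>P'" "p \<in> W'"
    by (rule projective_finite_cover[OF compatible_projective[OF P']]) (rule that)
  show ?thesis
    by (rule coordinate_pair_exists[OF T P P' w w']) (rule that)
qed

lemma projective_coordinate_change:
  assumes P: "P \<in> projective_structures A F"
    and w: "(W, Cpt \<circ> w) \<in> \<Union>P" "p \<in> W" and w': "(W', Cpt \<circ> w') \<in> \<Union>P" "p \<in> W'"
  obtains V a b c d where "open V" "p \<in> V" "a * d - b * c = 1" "V \<subseteq> W \<inter> W'"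
    "\<And>x. x \<in> V \<Longrightarrow> c * w x + d \<noteq> 0 \<and> w' x = (a * w x + b) / (c * w x + d)"
proof -
  have germ: "moebius_germ p (Cpt \<circ> w) (Cpt \<circ> w')"
    by (rule projective_germ[OF P w(1) w'(1)]) (use w(2) w'(2) in blast)
  obtain V a b c d where V: "open V" "p \<in> V" "a * d - b * c = 1"
    "\<And>x. x \<in> V \<Longrightarrow> c * w x + d \<noteq> 0 \<and> w' x = (a * w x + b) / (c * w x + d)"
    by (rule moebius_germ_Cpt[OF germ]) (rule that)
  have op: "open W" "open W'"
    using submersion_open[OF projective_submersion[OF P w(1)]]
      submersion_open[OF projective_submersion[OF P w'(1)]] .
  show ?thesis
    by (rule that[of "V \<inter> W \<inter> W'" a d b c]) (use V op w(2) w'(2) in auto)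
qed

text \<open>A Moebius change \<open>w2 = m \<circ> w1\<close> divides the Schwarzian derivative by \<open>m'\<^sup>2\<close> and multiplies \<open>(dw)\<^sup>2\<close> by the same
  factor, while a Moebius change of \<open>w'\<close> has no effect.\<close>

lemma dz_square_pair_change:
  assumes T: "T \<in> complex_structures A F"
    and P: "P \<in> compatible_structures A F T" and P': "P' \<in> compatible_structures A F T"
    and 1: "coordinate_pair P P' W1 w1 w1' f1" "p \<in> W1"
    and 2: "coordinate_pair P P' W2 w2 w2' f2" "p \<in> W2"
  shows "dz_square F T w2 p (\<kappa> * schwarzian f2 (w2 p)) = dz_square F T w1 p (\<kappa> * schwarzian f1 (w1 p))"
proof -
  note pP = compatible_projective[OF P] and pP' = compatible_projective[OF P']
  have w1: "(W1, Cpt \<circ> w1) \<in> \<Union>P" and w1': "(W1, Cpt \<circ> w1') \<in> \<Union>P'"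
    and f1: "f1 holomorphic_on (w1 ` W1)" "\<And>x. x \<in> W1 \<Longrightarrow> w1' x = f1 (w1 x)"
    using 1(1) unfolding coordinate_pair_def by blast+
  have w2: "(W2, Cpt \<circ> w2) \<in> \<Union>P" and w2': "(W2, Cpt \<circ> w2') \<in> \<Union>P'"
    and f2: "f2 holomorphic_on (w2 ` W2)" "\<And>x. x \<in> W2 \<Longrightarrow> w2' x = f2 (w2 x)"
    using 2(1) unfolding coordinate_pair_def by blast+
  note c1 = coordinate_pair_facts[OF pP pP' 1(1)] and c2 = coordinate_pair_facts[OF pP pP' 2(1)]
  obtain V a b c d where V: "open V" "p \<in> V" "a * d - b * c = 1" "V \<subseteq> W1 \<inter> W2"
    "\<And>x. x \<in> V \<Longrightarrow> c * w1 x + d \<noteq> 0 \<and> w2 x = (a * w1 x + b) / (c * w1 x + d)"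
    by (rule projective_coordinate_change[OF pP w1 1(2) w2 2(2)]) (rule that)
  obtain V' a' b' c' d' where V': "open V'" "p \<in> V'" "a' * d' - b' * c' = 1" "V' \<subseteq> W1 \<inter> W2"
    "\<And>x. x \<in> V' \<Longrightarrow> c' * w1' x + d' \<noteq> 0 \<and> w2' x = (a' * w1' x + b') / (c' * w1' x + d')"
    by (rule projective_coordinate_change[OF pP' w1' 1(2) w2' 2(2)]) (rule that)
  let ?V = "V \<inter> V'"
  have oV: "open ?V" "p \<in> ?V" "?V \<subseteq> W1" "?V \<subseteq> W2"
    using V V' by auto
  have oU: "open (w1 ` ?V)" "w1 p \<in> w1 ` ?V"
    using submersion_open_map[OF c1(2) oV(1,3)] oV(2) by auto
  define m where "m = (\<lambda>z. (a * z + b) / (c * z + d))"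
  have m: "w2 x = m (w1 x)" "c * w1 x + d \<noteq> 0" if "x \<in> ?V" for x
    using V(5) that by (auto simp: m_def)
  have mhol: "m holomorphic_on (w1 ` ?V)"
    unfolding m_def using m(2) by (intro holomorphic_intros) auto
  have "schwarzian f2 (m (w1 p)) * (deriv m (w1 p))\<^sup>2 = schwarzian f1 (w1 p)"
  proof (rule schwarzian_moebius_change[OF V(3) V'(3) oU])
    show "f1 holomorphic_on w1 ` ?V"
      by (rule holomorphic_on_subset[OF f1(1)]) (use oV(3) in blast)
    show "deriv f1 (w1 p) \<noteq> 0"
      by (rule c1(5)[OF 1(2)])
    show "open (w2 ` W2)"
      by (rule c2(4))
    show "f2 holomorphic_on w2 ` W2"
      by (rule f2(1))
    show "m y \<in> w2 ` W2" if y: "y \<in> w1 ` ?V" for y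
    proof -
      obtain x where x: "x \<in> ?V" "y = w1 x"
        using y by blast
      then have "m y = w2 x"
        using m(1)[OF x(1)] by simp
      then show ?thesis
        using x(1) oV(4) by blast
    qed
    show "deriv f2 (m (w1 p)) \<noteq> 0"
      using c2(5)[OF 2(2)] m(1)[OF oV(2)] by simp
    show "c * y + d \<noteq> 0 \<and> m y = (a * y + b) / (c * y + d)" if "y \<in> w1 ` ?V" for y
      using that m(2) by (auto simp: m_def)
    show "c' * f1 y + d' \<noteq> 0 \<and> f2 (m y) = (a' * f1 y + b') / (c' * f1 y + d')" if y: "y \<in> w1 ` ?V" for y
    proof -
      obtain x where x: "x \<in> ?V" "y = w1 x"
        using y by blast
      have "f1 y = w1' x" "f2 (m y) = w2' x"
        using x oV(3,4) f1(2)[of x] f2(2)[of x] m(1)[OF x(1)] by auto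
      then show ?thesis
        using V'(5)[of x] x(1) by simp
    qed
  qed
  then have S: "schwarzian f2 (w2 p) * (deriv m (w1 p))\<^sup>2 = schwarzian f1 (w1 p)"
    using m(1)[OF oV(2)] by simp
  have "dz_square F T w2 p (\<kappa> * schwarzian f2 (w2 p))
      = dz_square F T w1 p (\<kappa> * schwarzian f2 (w2 p) * (deriv m (w1 p))\<^sup>2)"
    by (rule dz_square_change[OF T compatible_coordinate[OF T P w1] oV(2,1,3) mhol m(1)])
  also have "\<kappa> * schwarzian f2 (w2 p) * (deriv m (w1 p))\<^sup>2 = \<kappa> * schwarzian f1 (w1 p)"
    using S by simp
  finally show ?thesis .
qed

lemma H0_K2_fibre: "q \<in> H0_K2 A F T \<Longrightarrow> q p \<in> K2_fibre A F T p"
  unfolding H0_K2_def by blast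

lemma structure_difference_iff:
  assumes T: "T \<in> complex_structures A F"
    and P: "P \<in> compatible_structures A F T" and P': "P' \<in> compatible_structures A F T"
    and q: "\<And>p. q p \<in> K2_fibre A F T p"
  shows "structure_difference A F T \<kappa> P' P q \<longleftrightarrow>
    (\<forall>W w w' f. coordinate_pair P P' W w w' f \<longrightarrow>
       (\<forall>p\<in>W. q p = dz_square F T w p (\<kappa> * schwarzian f (w p))))" (is "?L \<longleftrightarrow> ?R")
proof
  note pP = compatible_projective[OF P] and pP' = compatible_projective[OF P']
  {
    assume L: ?L
    show ?R
    proof (intro allI impI ballI)
      fix W w w' f p assume c: "coordinate_pair P P' W w w' f" and p: "p \<in> W"
      have ch: "(W, Cpt \<circ> w) \<in> \<Union>P" "(W, Cpt \<circ> w') \<in> \<Union>P'"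
        and f: "f holomorphic_on (w ` W)" "\<forall>x\<in>W. w' x = f (w x)"
        using c unfolding coordinate_pair_def by blast+
      have "open W"
        by (rule coordinate_pair_facts(1)[OF pP pP' c])
      then have "open W \<and> W \<subseteq> W \<inter> W \<and> (\<forall>p\<in>W. (Cpt \<circ> w) p = Cpt (w p) \<and> (Cpt \<circ> w') p = Cpt (w' p)) \<and>
          f holomorphic_on (w ` W) \<and> (\<forall>p\<in>W. w' p = f (w p))"
        using f by simp
      with L[unfolded structure_difference_def, THEN bspec[OF _ ch(1)], unfolded prod.case,
          THEN bspec[OF _ ch(2)], unfolded prod.case, rule_format, of W w w' f]
      have "\<And>m n. m \<in> normal10 A F T p \<Longrightarrow> n \<in> normal10 A F T p \<Longrightarrow>
          q p m n = \<kappa> * schwarzian f (w p) * covector w p m * covector w p n"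
        using p unfolding covector_def by blast
      then show "q p = dz_square F T w p (\<kappa> * schwarzian f (w p))"
        by (rule dz_square_eqI[OF q])
    qed
  next
    assume R: ?R
    show ?L
      unfolding structure_difference_def
    proof (intro ballI, clarify)
      fix U \<sigma> D U' \<sigma>' D' W w w' f p m1 m2 n1 n2
      assume D: "(U, \<sigma>) \<in> D" "D \<in> P" and D': "(U', \<sigma>') \<in> D'" "D' \<in> P'"
        and W: "open W" "W \<subseteq> U \<inter> U'" "\<forall>p\<in>W. \<sigma> p = Cpt (w p) \<and> \<sigma>' p = Cpt (w' p)"
        and f: "f holomorphic_on (w ` W)" "\<forall>p\<in>W. w' p = f (w p)" and p: "p \<in> W"
        and mn: "(m1, m2) \<in> normal10 A F T p" "(n1, n2) \<in> normal10 A F T p"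
      have ch: "(U, \<sigma>) \<in> \<Union>P" "(U', \<sigma>') \<in> \<Union>P'"
        using D D' by blast+
      have "(W, Cpt \<circ> w) \<in> \<Union>P"
        by (rule projective_finite_chart[OF pP ch(1) W(1)]) (use W in auto)
      moreover have "(W, Cpt \<circ> w') \<in> \<Union>P'"
        by (rule projective_finite_chart[OF pP' ch(2) W(1)]) (use W in auto)
      ultimately have "coordinate_pair P P' W w w' f"
        unfolding coordinate_pair_def using f by blast
      then have "q p = dz_square F T w p (\<kappa> * schwarzian f (w p))"
        using R p by blast
      then show "q p (m1, m2) (n1, n2) = \<kappa> * schwarzian f (w p) * cext (descend (dfun A w p)) (m1, m2)
          * cext (descend (dfun A w p)) (n1, n2)"
        using mn by (simp add: dz_square_def covector_def)
    qed
  }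
qed

section \<open>The difference as a section\<close>

text \<open>The local expressions agree by \<open>dz_square_pair_change\<close> and define \<open>q\<close>. It is transversely holomorphic since
  one pair of coordinates can be used at all points of its domain.\<close>

lemma difference_exists:
  assumes T: "T \<in> complex_structures A F"
    and P: "P \<in> compatible_structures A F T" and P': "P' \<in> compatible_structures A F T"
  obtains q where "q \<in> H0_K2 A F T" "structure_difference A F T \<kappa> P' P q"
proof -
  note pP = compatible_projective[OF P] and pP' = compatible_projective[OF P']
  define val where "val = (\<lambda>p \<beta>. \<exists>W w w' f. coordinate_pair P P' W w w' f \<and> p \<in> W \<and>
    \<beta> = dz_square F T w p (\<kappa> * schwarzian f (w p)))"
  define q where "q = (\<lambda>p. SOME \<beta>. val p \<beta>)"
  have q: "q p = dz_square F T w p (\<kappa> * schwarzian f (w p))"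
    if c: "coordinate_pair P P' W w w' f" and p: "p \<in> W" for W w w' f p
  proof -
    have "val p (dz_square F T w p (\<kappa> * schwarzian f (w p)))"
      unfolding val_def using c p by blast
    then have "val p (q p)"
      unfolding q_def by (rule someI[of "val p"])
    then obtain W1 w1 w1' f1 where c1: "coordinate_pair P P' W1 w1 w1' f1" "p \<in> W1"
        "q p = dz_square F T w1 p (\<kappa> * schwarzian f1 (w1 p))"
      unfolding val_def by (elim exE conjE) (rule that)
    show ?thesis
      unfolding c1(3) by (rule dz_square_pair_change[OF T P P' c p c1(1,2)])
  qed
  have "q \<in> H0_K2 A F T"
    unfolding H0_K2_iff[OF T P]
  proof
    fix p
    obtain W w w' f where c: "p \<in> W" "coordinate_pair P P' W w w' f"
      by (rule coordinate_pair_cover[OF T P P']) (rule that)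
    note facts = coordinate_pair_facts[OF pP pP' c(2)]
    have "schwarzian f holomorphic_on (w ` W)"
    proof (rule holomorphic_on_schwarzian[OF facts(4)])
      show "f holomorphic_on (w ` W)"
        using c(2) unfolding coordinate_pair_def by blast
    qed (use facts(5) in auto)
    then have hol: "(\<lambda>z. \<kappa> * schwarzian f z) holomorphic_on (w ` W)"
      by (intro holomorphic_intros)
    have ch: "(W, Cpt \<circ> w) \<in> \<Union>P"
      using c(2) unfolding coordinate_pair_def by blast
    have "\<forall>x\<in>W. q x = dz_square F T w x (\<kappa> * schwarzian f (w x))"
      using q[OF c(2)] by (rule ballI)
    then show "\<exists>W w h. p \<in> W \<and> (W, Cpt \<circ> w) \<in> \<Union>P \<and> h holomorphic_on (w ` W) \<and>
        (\<forall>x\<in>W. q x = dz_square F T w x (h (w x)))"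
      by (intro exI[of _ W] exI[of _ w] exI[of _ "\<lambda>z. \<kappa> * schwarzian f z"] conjI c(1) ch hol)
  qed
  moreover have "structure_difference A F T \<kappa> P' P q"
    unfolding structure_difference_iff[OF T P P' H0_K2_fibre[OF \<open>q \<in> H0_K2 A F T\<close>]]
    using q by (intro allI impI ballI)
  ultimately show ?thesis
    by (rule that)
qed

lemma difference_unique:
  assumes T: "T \<in> complex_structures A F"
    and P: "P \<in> compatible_structures A F T" and P': "P' \<in> compatible_structures A F T"
    and q: "q \<in> H0_K2 A F T" "structure_difference A F T \<kappa> P' P q"
    and q': "q' \<in> H0_K2 A F T" "structure_difference A F T \<kappa> P' P q'"
  shows "q = q'"
proof
  fix p
  obtain W w w' f where c: "p \<in> W" "coordinate_pair P P' W w w' f"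
    by (rule coordinate_pair_cover[OF T P P']) (rule that)
  have "q p = dz_square F T w p (\<kappa> * schwarzian f (w p))"
    using q(2)[unfolded structure_difference_iff[OF T P P' H0_K2_fibre[OF q(1)]]] c by blast
  moreover have "q' p = dz_square F T w p (\<kappa> * schwarzian f (w p))"
    using q'(2)[unfolded structure_difference_iff[OF T P P' H0_K2_fibre[OF q'(1)]]] c by blast
  ultimately show "q p = q' p"
    by simp
qed

lemma dz_square_zero: "dz_square F T w p 0 = 0"
  by (auto simp: dz_square_def fun_eq_iff)

lemma zero_in_H0_K2:
  assumes T: "T \<in> complex_structures A F" and P: "P \<in> compatible_structures A F T"
  shows "0 \<in> H0_K2 A F T"
  unfolding H0_K2_iff[OF T P]
proof
  fix p
  obtain W w where w: "(W, Cpt \<circ> w) \<in> \<Union>P" "p \<in> W"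
    by (rule projective_finite_cover[OF compatible_projective[OF P]]) (rule that)
  show "\<exists>W w h. p \<in> W \<and> (W, Cpt \<circ> w) \<in> \<Union>P \<and> h holomorphic_on (w ` W) \<and>
      (\<forall>x\<in>W. 0 x = dz_square F T w x (h (w x)))"
    by (intro exI[of _ W] exI[of _ w] exI[of _ "\<lambda>z. 0"] conjI w holomorphic_on_const)
       (simp add: dz_square_zero)
qed

lemma difference_refl:
  assumes T: "T \<in> complex_structures A F" and P: "P \<in> compatible_structures A F T"
  shows "structure_difference A F T \<kappa> P P 0"
proof -
  note pP = compatible_projective[OF P]
  have fib: "0 p \<in> K2_fibre A F T p" for p
    by (rule H0_K2_fibre[OF zero_in_H0_K2[OF T P]])
  show ?thesis
    unfolding structure_difference_iff[OF T P P fib]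
  proof (intro allI impI ballI)
    fix W w w' f p assume c: "coordinate_pair P P W w w' f" and p: "p \<in> W"
    note facts = coordinate_pair_facts[OF pP pP c]
    have ch: "(W, Cpt \<circ> w) \<in> \<Union>P" "(W, Cpt \<circ> w') \<in> \<Union>P" and f: "\<And>x. x \<in> W \<Longrightarrow> w' x = f (w x)"
      using c unfolding coordinate_pair_def by blast+
    obtain V a b c d where V: "open V" "p \<in> V" "a * d - b * c = 1" "V \<subseteq> W \<inter> W"
      "\<And>x. x \<in> V \<Longrightarrow> c * w x + d \<noteq> 0 \<and> w' x = (a * w x + b) / (c * w x + d)"
      by (rule projective_coordinate_change[OF pP ch(1) p ch(2) p]) (rule that)
    have VW: "V \<subseteq> W"
      using V(4) by simp
    have "schwarzian f (w p) = 0"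
    proof (rule schwarzian_moebius[OF submersion_open_map[OF facts(2) V(1) VW] _ V(3)])
      show "w p \<in> w ` V"
        using V(2) by simp
      show "c * y + d \<noteq> 0 \<and> f y = (a * y + b) / (c * y + d)" if y: "y \<in> w ` V" for y
      proof -
        obtain x where x: "x \<in> V" "y = w x"
          using y by blast
        have "x \<in> W"
          using x(1) VW by blast
        then show ?thesis
          using V(5)[OF x(1)] f x(2) by simp
      qed
    qed
    then show "0 p = dz_square F T w p (\<kappa> * schwarzian f (w p))"
      by (simp add: dz_square_zero)
  qed
qed

lemma H0_K2_local:
  assumes T: "T \<in> complex_structures A F" and P: "P \<in> compatible_structures A F T"
    and q: "q \<in> H0_K2 A F T" and w: "(W, Cpt \<circ> w) \<in> \<Union>P" "p \<in> W"
  obtains V h where "open V" "p \<in> V" "V \<subseteq> W" "h holomorphic_on (w ` V)"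
    "\<And>x. x \<in> V \<Longrightarrow> q x = dz_square F T w x (h (w x))"
proof -
  obtain W1 w1 h1 where 1: "p \<in> W1" "(W1, Cpt \<circ> w1) \<in> \<Union>P" "h1 holomorphic_on (w1 ` W1)"
      "\<forall>x\<in>W1. q x = dz_square F T w1 x (h1 (w1 x))"
    using spec[OF q[unfolded H0_K2_iff[OF T P]], of p] by (elim exE conjE) (rule that)
  note cw = compatible_coordinate[OF T P w(1)] and cw1 = compatible_coordinate[OF T P 1(2)]
  obtain V f where V: "open V" "p \<in> V" "V \<subseteq> W \<inter> W1" "open (w ` V)" "f holomorphic_on (w ` V)"
    "\<And>x. x \<in> V \<Longrightarrow> w1 x = f (w x)" "\<And>x. x \<in> V \<Longrightarrow> deriv f (w x) \<noteq> 0"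
    by (rule coordinate_transition[OF T cw cw1 w(2) 1(1)]) (rule that)
  have VW: "V \<subseteq> W"
    using V(3) by blast
  have "(h1 \<circ> f) holomorphic_on (w ` V)"
    by (rule holomorphic_on_compose_gen[OF V(5) 1(3)]) (use V(3,6) in force)
  then have hol: "(\<lambda>z. h1 (f z) * (deriv f z)\<^sup>2) holomorphic_on (w ` V)"
    unfolding o_def by (intro holomorphic_intros holomorphic_deriv[OF V(5,4)])
  have "q x = dz_square F T w x (h1 (f (w x)) * (deriv f (w x))\<^sup>2)" if x: "x \<in> V" for x
  proof -
    have "q x = dz_square F T w1 x (h1 (f (w x)))"
      using 1(4) V(3) V(6)[OF x] x by auto
    also have "\<dots> = dz_square F T w x (h1 (f (w x)) * (deriv f (w x))\<^sup>2)"
      by (rule dz_square_change[OF T cw x V(1) VW V(5,6)])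
    finally show ?thesis .
  qed
  then show ?thesis
    by (rule that[OF V(1,2) VW hol])
qed

lemma H0_K2_add:
  assumes T: "T \<in> complex_structures A F" and P: "P \<in> compatible_structures A F T"
    and u: "u \<in> H0_K2 A F T" and v: "v \<in> H0_K2 A F T"
  shows "u + v \<in> H0_K2 A F T"
  unfolding H0_K2_iff[OF T P]
proof
  fix p
  obtain W w where w: "(W, Cpt \<circ> w) \<in> \<Union>P" "p \<in> W"
    by (rule projective_finite_cover[OF compatible_projective[OF P]]) (rule that)
  obtain V1 h1 where 1: "open V1" "p \<in> V1" "V1 \<subseteq> W" "h1 holomorphic_on (w ` V1)"
    "\<And>x. x \<in> V1 \<Longrightarrow> u x = dz_square F T w x (h1 (w x))"
    by (rule H0_K2_local[OF T P u w]) (rule that)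
  obtain V2 h2 where 2: "open V2" "p \<in> V2" "V2 \<subseteq> W" "h2 holomorphic_on (w ` V2)"
    "\<And>x. x \<in> V2 \<Longrightarrow> v x = dz_square F T w x (h2 (w x))"
    by (rule H0_K2_local[OF T P v w]) (rule that)
  let ?V = "V1 \<inter> V2"
  have ch: "(?V, Cpt \<circ> w) \<in> \<Union>P"
    by (rule projective_restrict[OF compatible_projective[OF P] w(1)]) (use 1 2 in auto)
  have "h1 holomorphic_on (w ` ?V)" "h2 holomorphic_on (w ` ?V)"
    by (rule holomorphic_on_subset[OF 1(4)], blast) (rule holomorphic_on_subset[OF 2(4)], blast)
  then have hol: "(\<lambda>z. h1 z + h2 z) holomorphic_on (w ` ?V)"
    by (intro holomorphic_intros)
  have val: "\<forall>x\<in>?V. (u + v) x = dz_square F T w x (h1 (w x) + h2 (w x))"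
    using 1(5) 2(5) dz_square_add by simp
  show "\<exists>W w h. p \<in> W \<and> (W, Cpt \<circ> w) \<in> \<Union>P \<and> h holomorphic_on (w ` W) \<and>
      (\<forall>x\<in>W. (u + v) x = dz_square F T w x (h (w x)))"
    by (intro exI[of _ ?V] exI[of _ w] exI[of _ "\<lambda>z. h1 z + h2 z"] conjI ch hol val)
       (use 1(2) 2(2) in auto)
qed

lemma H0_K2_scale:
  assumes T: "T \<in> complex_structures A F" and P: "P \<in> compatible_structures A F T"
    and u: "u \<in> H0_K2 A F T"
  shows "ksection_scale k u \<in> H0_K2 A F T"
  unfolding H0_K2_iff[OF T P]
proof
  fix p
  obtain W w h where 1: "p \<in> W" "(W, Cpt \<circ> w) \<in> \<Union>P" "h holomorphic_on (w ` W)"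
      "\<forall>x\<in>W. u x = dz_square F T w x (h (w x))"
    using spec[OF u[unfolded H0_K2_iff[OF T P]], of p] by (elim exE conjE) (rule that)
  have hol: "(\<lambda>z. k * h z) holomorphic_on (w ` W)"
    using 1(3) by (intro holomorphic_intros)
  have val: "\<forall>x\<in>W. ksection_scale k u x = dz_square F T w x (k * h (w x))"
    using 1(4) by (auto simp: ksection_scale_def dz_square_def fun_eq_iff)
  show "\<exists>W w h. p \<in> W \<and> (W, Cpt \<circ> w) \<in> \<Union>P \<and> h holomorphic_on (w ` W) \<and>
      (\<forall>x\<in>W. ksection_scale k u x = dz_square F T w x (h (w x)))"
    by (intro exI[of _ W] exI[of _ w] exI[of _ "\<lambda>z. k * h z"] conjI 1(1,2) hol val)
qed

text \<open>This is the chain rule for the Schwarzian derivative, multiplied by \<open>\<kappa> (dw)\<^sup>2\<close>: if \<open>w1 = g \<circ> w\<close>, then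
  \<open>(dw1)\<^sup>2 = g'\<^sup>2 (dw)\<^sup>2\<close>.\<close>

lemma difference_add:
  assumes T: "T \<in> complex_structures A F"
    and P: "P \<in> compatible_structures A F T" and P1: "P1 \<in> compatible_structures A F T"
    and P2: "P2 \<in> compatible_structures A F T"
    and u: "u \<in> H0_K2 A F T" "structure_difference A F T \<kappa> P1 P u"
    and v: "v \<in> H0_K2 A F T" "structure_difference A F T \<kappa> P2 P1 v"
  shows "structure_difference A F T \<kappa> P2 P (u + v)"
proof -
  note pP = compatible_projective[OF P] and pP1 = compatible_projective[OF P1]
    and pP2 = compatible_projective[OF P2]
  have fib: "(u + v) p \<in> K2_fibre A F T p" for p
    by (rule H0_K2_fibre[OF H0_K2_add[OF T P u(1) v(1)]])
  show ?thesis
    unfolding structure_difference_iff[OF T P P2 fib]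
  proof (intro allI impI ballI)
    fix W w w2 f p assume c: "coordinate_pair P P2 W w w2 f" and p: "p \<in> W"
    have ch: "(W, Cpt \<circ> w) \<in> \<Union>P" "(W, Cpt \<circ> w2) \<in> \<Union>P2"
      and f: "\<And>x. x \<in> W \<Longrightarrow> w2 x = f (w x)"
      using c unfolding coordinate_pair_def by blast+
    obtain W1 w1 where w1: "(W1, Cpt \<circ> w1) \<in> \<Union>P1" "p \<in> W1"
      by (rule projective_finite_cover[OF pP1]) (rule that)
    obtain V1 g where g: "p \<in> V1" "V1 \<subseteq> W \<inter> W1" "coordinate_pair P P1 V1 w w1 g"
      by (rule coordinate_pair_exists[OF T P P1 ch(1) p w1]) (rule that)
    obtain V2 k where k: "p \<in> V2" "V2 \<subseteq> W1 \<inter> W" "coordinate_pair P1 P2 V2 w1 w2 k"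
      by (rule coordinate_pair_exists[OF T P1 P2 w1 ch(2) p]) (rule that)
    let ?V = "V1 \<inter> V2"
    have oV: "open ?V" "p \<in> ?V"
      using coordinate_pair_facts(1)[OF pP pP1 g(3)] coordinate_pair_facts(1)[OF pP1 pP2 k(3)] g(1) k(1)
      by auto
    have g': "coordinate_pair P P1 ?V w w1 g" and k': "coordinate_pair P1 P2 ?V w1 w2 k"
      by (rule coordinate_pair_restrict[OF pP pP1 g(3) oV(1)], blast)
         (rule coordinate_pair_restrict[OF pP1 pP2 k(3) oV(1)], blast)
    note gf = coordinate_pair_facts[OF pP pP1 g'] and kf = coordinate_pair_facts[OF pP1 pP2 k']
    have gh: "g holomorphic_on (w ` ?V)" "\<And>x. x \<in> ?V \<Longrightarrow> w1 x = g (w x)"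
      and kh: "k holomorphic_on (w1 ` ?V)" "\<And>x. x \<in> ?V \<Longrightarrow> w2 x = k (w1 x)"
      using g' k' unfolding coordinate_pair_def by blast+
    have "schwarzian f (w p) = schwarzian (\<lambda>z. k (g z)) (w p)"
    proof (rule schwarzian_cong[OF gf(4)])
      show "f z = k (g z)" if "z \<in> w ` ?V" for z
      proof -
        obtain x where x: "x \<in> ?V" "z = w x"
          using \<open>z \<in> w ` ?V\<close> by blast
        have "x \<in> W"
          using x(1) g(2) by blast
        then show ?thesis
          using f[of x] gh(2)[OF x(1)] kh(2)[OF x(1)] x(2) by simp
      qed
    qed (use oV(2) in blast)
    also have "\<dots> = schwarzian k (g (w p)) * (deriv g (w p))\<^sup>2 + schwarzian g (w p)"
    proof (rule schwarzian_compose[OF gf(4) gh(1) kf(4) kh(1)])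
      show "g ` w ` ?V \<subseteq> w1 ` ?V"
        using gh(2) by force
      show "w p \<in> w ` ?V"
        using oV(2) by blast
      show "deriv g (w p) \<noteq> 0"
        by (rule gf(5)[OF oV(2)])
      show "deriv k (g (w p)) \<noteq> 0"
        using kf(5)[OF oV(2)] gh(2)[OF oV(2)] by simp
    qed
    finally have S: "schwarzian f (w p) = schwarzian g (w p) + schwarzian k (w1 p) * (deriv g (w p))\<^sup>2"
      using gh(2)[OF oV(2)] by simp
    have "u p = dz_square F T w p (\<kappa> * schwarzian g (w p))"
      using u(2)[unfolded structure_difference_iff[OF T P P1 H0_K2_fibre[OF u(1)]]] g' oV(2) by blast
    moreover have "v p = dz_square F T w1 p (\<kappa> * schwarzian k (w1 p))"
      using v(2)[unfolded structure_difference_iff[OF T P1 P2 H0_K2_fibre[OF v(1)]]] k' oV(2) by blast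
    moreover have "dz_square F T w1 p (\<kappa> * schwarzian k (w1 p))
        = dz_square F T w p (\<kappa> * schwarzian k (w1 p) * (deriv g (w p))\<^sup>2)"
      by (rule dz_square_change[OF T compatible_coordinate[OF T P ch(1)] oV(2,1) _ gh]) (use g(2) in blast)
    ultimately have "(u + v) p = dz_square F T w p
        (\<kappa> * schwarzian g (w p) + \<kappa> * schwarzian k (w1 p) * (deriv g (w p))\<^sup>2)"
      using dz_square_add by simp
    then show "(u + v) p = dz_square F T w p (\<kappa> * schwarzian f (w p))"
      unfolding S by (simp add: algebra_simps)
  qed
qed

lemma schwarzian_zero_imp_moebius_germ:
  assumes w: "complex_submersion A F W w" and w': "complex_submersion A F W w'" and p: "p \<in> W"
    and f: "f holomorphic_on (w ` W)" "\<And>x. x \<in> W \<Longrightarrow> w' x = f (w x)"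
    and S: "\<And>x. x \<in> W \<Longrightarrow> schwarzian f (w x) = 0"
  shows "moebius_germ p (Cpt \<circ> w) (Cpt \<circ> w')"
proof -
  have W: "open W"
    by (rule submersion_open[OF w])
  have "open (w ` W)"
    by (rule submersion_open_map[OF w W order_refl])
  then obtain r where r: "r > 0" "ball (w p) r \<subseteq> w ` W"
    using p open_contains_ball by blast
  have nz: "deriv f z \<noteq> 0" "schwarzian f z = 0" if z: "z \<in> ball (w p) r" for z
  proof -
    obtain x where x: "x \<in> W" "z = w x"
      using z r(2) by blast
    show "deriv f z \<noteq> 0"
      unfolding x(2) by (rule transition_deriv_nonzero[OF w w' f x(1)])
    show "schwarzian f z = 0"
      unfolding x(2) by (rule S[OF x(1)])
  qed
  obtain a b c d where m: "a * d - b * c = 1"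
    "\<And>z. z \<in> ball (w p) r \<Longrightarrow> c * z + d \<noteq> 0 \<and> f z = (a * z + b) / (c * z + d)"
    by (rule schwarzian_zero_imp_moebius[OF holomorphic_on_subset[OF f(1) r(2)] nz r(1)]) (assumption | rule that)+
  have "open (w -` ball (w p) r \<inter> W)"
    using submersion_continuous[OF w] W by (simp add: continuous_on_open_vimage)
  then show ?thesis
    by (rule moebius_germ_CptI[OF _ _ m(1)]) (use p r(1) m(2) f(2) in auto)
qed

lemma difference_zero_imp_eq:
  assumes T: "T \<in> complex_structures A F" and \<kappa>: "\<kappa> \<noteq> 0"
    and P: "P \<in> compatible_structures A F T" and P': "P' \<in> compatible_structures A F T"
    and d: "structure_difference A F T \<kappa> P' P 0"
  shows "P = P'"
proof (rule projective_eqI[OF compatible_projective[OF P] compatible_projective[OF P']])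
  note pP = compatible_projective[OF P] and pP' = compatible_projective[OF P']
  fix p
  obtain W w w' f where p: "p \<in> W" and c: "coordinate_pair P P' W w w' f"
    by (rule coordinate_pair_cover[OF T P P']) (rule that)
  have ch: "(W, Cpt \<circ> w) \<in> \<Union>P" "(W, Cpt \<circ> w') \<in> \<Union>P'"
    and f: "f holomorphic_on (w ` W)" "\<And>x. x \<in> W \<Longrightarrow> w' x = f (w x)"
    using c unfolding coordinate_pair_def by blast+
  note facts = coordinate_pair_facts[OF pP pP' c]
  have S: "schwarzian f (w x) = 0" if x: "x \<in> W" for x
  proof -
    have "0 x = dz_square F T w x (\<kappa> * schwarzian f (w x))"
      using d[unfolded structure_difference_iff[OF T P P' H0_K2_fibre[OF zero_in_H0_K2[OF T P]]]] c x by blast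
    then have "dz_square F T w x 0 = dz_square F T w x (\<kappa> * schwarzian f (w x))"
      by (simp add: dz_square_zero)
    then have "0 = \<kappa> * schwarzian f (w x)"
      unfolding dz_square_eq_iff[OF T compatible_coordinate[OF T P ch(1)] x] .
    then show ?thesis
      using \<kappa> by simp
  qed
  have "moebius_germ p (Cpt \<circ> w) (Cpt \<circ> w')"
    by (rule schwarzian_zero_imp_moebius_germ[where f = f, OF facts(2,3) p f S])
  then show "\<exists>U \<sigma> V \<tau>. (U, \<sigma>) \<in> \<Union>P \<and> (V, \<tau>) \<in> \<Union>P' \<and> p \<in> U \<inter> V \<and> moebius_germ p \<sigma> \<tau>"
    by (intro exI[of _ W] exI[of _ "Cpt \<circ> w"] exI[of _ "Cpt \<circ> w'"] conjI ch IntI p)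
qed

end

section \<open>Deforming a projective structure\<close>

context smooth_manifold
begin

lemma open_component:
  fixes S :: "'m set"
  assumes "open S" "K \<in> components S"
  shows "open K"
proof (subst open_subopen, intro ballI)
  fix x assume x: "x \<in> K"
  then have "x \<in> S"
    using in_components_subset[OF assms(2)] by blast
  obtain W where W: "open W" "connected W" "x \<in> W" "W \<subseteq> S"
    by (rule connected_neighbourhood[OF assms(1) \<open>x \<in> S\<close>]) (rule that)
  have "W \<subseteq> K"
    by (rule components_maximal[OF assms(2) W(2,4)]) (use x W(3) in blast)
  then show "\<exists>W. open W \<and> x \<in> W \<and> W \<subseteq> K"
    using W(1,3) by blast
qed

text \<open>The charts \<open>\<phi> \<circ> w\<close> that differ from the chart \<open>w\<close> of \<open>P\<close> by the prescribed quadratic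
  differential.\<close>

definition deformed_chart ::
    "('m \<Rightarrow> 'e set) \<Rightarrow> 'm tdata set \<Rightarrow> complex \<Rightarrow> 'm tdata set \<Rightarrow> ('m, 'e) ksection \<Rightarrow>
     'm set \<Rightarrow> ('m \<Rightarrow> complex) \<Rightarrow> (complex \<Rightarrow> complex) \<Rightarrow> bool" where
  "deformed_chart F T \<kappa> P q C w \<phi> \<longleftrightarrow> (C, Cpt \<circ> w) \<in> \<Union>P \<and> \<phi> holomorphic_on (w ` C) \<and>
     inj_on \<phi> (w ` C) \<and> (\<forall>z\<in>w ` C. deriv \<phi> z \<noteq> 0) \<and>
     (\<forall>x\<in>C. q x = dz_square F T w x (\<kappa> * schwarzian \<phi> (w x)))"

definition deformed_data ::
    "('m \<Rightarrow> 'e set) \<Rightarrow> 'm tdata set \<Rightarrow> complex \<Rightarrow> 'm tdata set \<Rightarrow> ('m, 'e) ksection \<Rightarrow> 'm tdata" where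
  "deformed_data F T \<kappa> P q = {(C, Cpt \<circ> (\<lambda>x. \<phi> (w x))) | C w \<phi>. deformed_chart F T \<kappa> P q C w \<phi>}"

lemma deformed_chart_submersion:
  assumes P: "P \<in> projective_structures A F" and d: "deformed_chart F T \<kappa> P q C w \<phi>"
  shows "complex_submersion A F C w" "complex_submersion A F C (\<lambda>x. \<phi> (w x))" "open (w ` C)"
proof -
  show w: "complex_submersion A F C w"
    by (rule projective_submersion[OF P]) (use d in \<open>simp add: deformed_chart_def\<close>)
  show op: "open (w ` C)"
    by (rule submersion_open_map[OF w submersion_open[OF w] order_refl])
  show "complex_submersion A F C (\<lambda>x. \<phi> (w x))"
    by (rule submersion_compose[OF w op, where f = \<phi>]) (use d in \<open>auto simp: deformed_chart_def\<close>)
qed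

lemma deformed_chart_cover:
  assumes T: "T \<in> complex_structures A F" and P: "P \<in> compatible_structures A F T"
    and \<kappa>: "\<kappa> \<noteq> 0" and q: "q \<in> H0_K2 A F T"
  obtains C w \<phi> where "p \<in> C" "deformed_chart F T \<kappa> P q C w \<phi>"
proof -
  note pP = compatible_projective[OF P]
  obtain W w h where 1: "p \<in> W" "(W, Cpt \<circ> w) \<in> \<Union>P" "h holomorphic_on (w ` W)"
      "\<forall>x\<in>W. q x = dz_square F T w x (h (w x))"
    using spec[OF q[unfolded H0_K2_iff[OF T P]], of p] by (elim exE conjE) (rule that)
  note sw = projective_submersion[OF pP 1(2)]
  have W: "open W"
    by (rule submersion_open[OF sw])
  have op: "open (w ` W)" "w p \<in> w ` W"
    using submersion_open_map[OF sw W order_refl] 1(1) by auto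
  have hol: "(\<lambda>z. h z / \<kappa>) holomorphic_on (w ` W)"
    using 1(3) \<kappa> by (intro holomorphic_intros)
  obtain \<phi> r where \<phi>: "r > 0" "ball (w p) r \<subseteq> w ` W" "\<phi> holomorphic_on ball (w p) r"
    "inj_on \<phi> (ball (w p) r)" "\<And>z. z \<in> ball (w p) r \<Longrightarrow> deriv \<phi> z \<noteq> 0"
    "\<And>z. z \<in> ball (w p) r \<Longrightarrow> schwarzian \<phi> z = h z / \<kappa>"
    by (rule schwarzian_solution[OF op(1) hol op(2)]) (rule that)
  let ?C = "w -` ball (w p) r \<inter> W"
  have oC: "open ?C"
    using submersion_continuous[OF sw] W by (simp add: continuous_on_open_vimage)
  have sub: "w ` ?C \<subseteq> ball (w p) r"
    by blast
  have "deformed_chart F T \<kappa> P q ?C w \<phi>"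
    unfolding deformed_chart_def
  proof (intro conjI ballI)
    show "(?C, Cpt \<circ> w) \<in> \<Union>P"
      by (rule projective_restrict[OF pP 1(2) oC]) blast
    show "\<phi> holomorphic_on (w ` ?C)"
      by (rule holomorphic_on_subset[OF \<phi>(3) sub])
    show "inj_on \<phi> (w ` ?C)"
      by (rule inj_on_subset[OF \<phi>(4) sub])
    show "deriv \<phi> z \<noteq> 0" if "z \<in> w ` ?C" for z
      using \<phi>(5) sub that by blast
    show "q x = dz_square F T w x (\<kappa> * schwarzian \<phi> (w x))" if x: "x \<in> ?C" for x
      using 1(4) \<phi>(6)[of "w x"] x \<kappa> by simp
  qed
  then show ?thesis
    by (rule that[rotated]) (use 1(1) \<phi>(1) in simp)
qed

text \<open>If \<open>w2 = m \<circ> w1\<close> with a Moebius transformation \<open>m\<close>, then \<open>\<phi>1\<close> and \<open>\<phi>2 \<circ> m\<close> have the same Schwarzian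
  derivative, since both are prescribed by \<open>q\<close>. By the chain rule, the function that carries one to the other
  has Schwarzian derivative zero.\<close>

lemma deformed_charts_moebius:
  assumes T: "T \<in> complex_structures A F" and P: "P \<in> compatible_structures A F T"
    and \<kappa>: "\<kappa> \<noteq> 0"
    and 1: "deformed_chart F T \<kappa> P q C1 w1 \<phi>1" "p \<in> C1"
    and 2: "deformed_chart F T \<kappa> P q C2 w2 \<phi>2" "p \<in> C2"
  shows "moebius_germ p (Cpt \<circ> (\<lambda>x. \<phi>1 (w1 x))) (Cpt \<circ> (\<lambda>x. \<phi>2 (w2 x)))"
proof -
  note pP = compatible_projective[OF P]
  note s1 = deformed_chart_submersion[OF pP 1(1)] and s2 = deformed_chart_submersion[OF pP 2(1)]
  have ch: "(C1, Cpt \<circ> w1) \<in> \<Union>P" "(C2, Cpt \<circ> w2) \<in> \<Union>P"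
    using 1(1) 2(1) unfolding deformed_chart_def by blast+
  obtain V a b c d where V: "open V" "p \<in> V" "a * d - b * c = 1" "V \<subseteq> C1 \<inter> C2"
    "\<And>x. x \<in> V \<Longrightarrow> c * w1 x + d \<noteq> 0 \<and> w2 x = (a * w1 x + b) / (c * w1 x + d)"
    by (rule projective_coordinate_change[OF pP ch(1) 1(2) ch(2) 2(2)]) (rule that)
  have sub: "V \<subseteq> C1" "V \<subseteq> C2" "w1 ` V \<subseteq> w1 ` C1"
    using V(4) by auto
  define m where "m = (\<lambda>z. (a * z + b) / (c * z + d))"
  have m: "w2 x = m (w1 x)" "c * w1 x + d \<noteq> 0" if "x \<in> V" for x
    using V(5)[OF that] by (auto simp: m_def)
  have U: "open (w1 ` V)"
    by (rule submersion_open_map[OF s1(1) V(1) sub(1)])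
  have mder: "(m has_field_derivative 1 / (c * z + d)\<^sup>2) (at z)" if "z \<in> w1 ` V" for z
    unfolding m_def by (rule moebius_has_derivative[OF V(3)]) (use that m(2) in auto)
  have mhol: "m holomorphic_on (w1 ` V)"
    unfolding holomorphic_on_open[OF U] using mder by blast
  have mnz: "deriv m (w1 x) \<noteq> 0" if "x \<in> V" for x
    using DERIV_imp_deriv[OF mder[of "w1 x"]] m(2)[OF that] that by auto
  have mS: "schwarzian m (w1 x) = 0" if "x \<in> V" for x
    by (rule schwarzian_moebius[OF U _ V(3)]) (use that m(2) in \<open>auto simp: m_def\<close>)
  have m_into: "m ` w1 ` V \<subseteq> w2 ` C2"
  proof clarify
    fix x assume "x \<in> V"
    then show "m (w1 x) \<in> w2 ` C2"
      using m(1)[of x] sub(2) by (intro image_eqI[of _ _ x]) auto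
  qed
  have \<phi>1: "\<phi>1 holomorphic_on w1 ` V" "inj_on \<phi>1 (w1 ` V)" "\<And>z. z \<in> w1 ` V \<Longrightarrow> deriv \<phi>1 z \<noteq> 0"
    using 1(1) holomorphic_on_subset[OF _ sub(3)] inj_on_subset[OF _ sub(3)] sub(3)
    unfolding deformed_chart_def by blast+
  have \<phi>2: "\<phi>2 holomorphic_on w2 ` C2" "\<And>z. z \<in> w2 ` C2 \<Longrightarrow> deriv \<phi>2 z \<noteq> 0"
    using 2(1) unfolding deformed_chart_def by blast+
  obtain g where g: "g holomorphic_on \<phi>1 ` w1 ` V" "\<And>z. z \<in> w1 ` V \<Longrightarrow> g (\<phi>1 z) = z"
    using holomorphic_has_inverse[OF \<phi>1(1) U \<phi>1(2)] by metis
  define u1 u2 where "u1 = (\<lambda>x. \<phi>1 (w1 x))" and "u2 = (\<lambda>x. \<phi>2 (w2 x))"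
  have u: "complex_submersion A F V u1" "complex_submersion A F V u2"
    unfolding u1_def u2_def
    by (rule submersion_restrict[OF s1(2) V(1) sub(1)], rule submersion_restrict[OF s2(2) V(1) sub(2)])
  have u1V: "u1 ` V = \<phi>1 ` w1 ` V"
    unfolding u1_def by (simp add: image_image)
  have u1op: "open (u1 ` V)"
    by (rule submersion_open_map[OF u(1) V(1) order_refl])
  \<comment> \<open>The transition function from \<open>u1\<close> to \<open>u2\<close>; its Schwarzian derivative vanishes, since both
    charts realise the same quadratic differential.\<close>
  define k where "k = (\<lambda>z. \<phi>2 (m (g z)))"
  have k: "u2 x = k (u1 x)" if "x \<in> V" for x
    using m(1)[OF that] g(2)[of "w1 x"] that by (simp add: k_def u1_def u2_def)
  have "(m \<circ> g) holomorphic_on u1 ` V"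
    unfolding u1V by (rule holomorphic_on_compose_gen[OF g(1) mhol]) (use g(2) in auto)
  then have "(\<phi>2 \<circ> (m \<circ> g)) holomorphic_on u1 ` V"
    by (rule holomorphic_on_compose_gen[OF _ \<phi>2(1)])
       (use g(2) m_into in \<open>auto simp: u1V\<close>)
  then have khol: "k holomorphic_on u1 ` V"
    by (simp add: k_def o_def)
  have kS: "schwarzian k (u1 x) = 0" if x: "x \<in> V" for x
  proof -
    have zx: "w1 x \<in> w1 ` V"
      using x by blast
    have knz: "deriv k (u1 x) \<noteq> 0"
      by (rule transition_deriv_nonzero[OF u khol k x])
    have "schwarzian (\<lambda>z. k (\<phi>1 z)) (w1 x)
        = schwarzian k (\<phi>1 (w1 x)) * (deriv \<phi>1 (w1 x))\<^sup>2 + schwarzian \<phi>1 (w1 x)"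
      by (rule schwarzian_compose[OF U \<phi>1(1) u1op khol _ zx \<phi>1(3)[OF zx]])
         (use knz in \<open>simp_all add: u1_def image_image\<close>)
    moreover have "schwarzian (\<lambda>z. \<phi>2 (m z)) (w1 x)
        = schwarzian \<phi>2 (m (w1 x)) * (deriv m (w1 x))\<^sup>2 + schwarzian m (w1 x)"
      by (rule schwarzian_compose[OF U mhol s2(3) \<phi>2(1) m_into zx mnz[OF x]])
         (use \<phi>2(2)[of "m (w1 x)"] m_into zx in auto)
    moreover have "schwarzian (\<lambda>z. k (\<phi>1 z)) (w1 x) = schwarzian (\<lambda>z. \<phi>2 (m z)) (w1 x)"
      by (rule schwarzian_cong[OF U _ zx]) (simp add: k_def g(2))
    ultimately have e1: "schwarzian k (u1 x) * (deriv \<phi>1 (w1 x))\<^sup>2 + schwarzian \<phi>1 (w1 x)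
        = schwarzian \<phi>2 (w2 x) * (deriv m (w1 x))\<^sup>2"
      using mS[OF x] m(1)[OF x] by (simp add: u1_def)
    have "dz_square F T w1 x (\<kappa> * schwarzian \<phi>1 (w1 x)) = q x"
      using 1(1) x sub(1) unfolding deformed_chart_def by auto
    also have "\<dots> = dz_square F T w2 x (\<kappa> * schwarzian \<phi>2 (w2 x))"
      using 2(1) x sub(2) unfolding deformed_chart_def by auto
    also have "\<dots> = dz_square F T w1 x (\<kappa> * schwarzian \<phi>2 (w2 x) * (deriv m (w1 x))\<^sup>2)"
      by (rule dz_square_change[OF T compatible_coordinate[OF T P ch(1)] x V(1) sub(1) mhol m(1)])
    finally have "\<kappa> * schwarzian \<phi>1 (w1 x) = \<kappa> * schwarzian \<phi>2 (w2 x) * (deriv m (w1 x))\<^sup>2"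
      using dz_square_eq_iff[OF T compatible_coordinate[OF T P ch(1)]] x sub(1) by blast
    then have "schwarzian \<phi>1 (w1 x) = schwarzian \<phi>2 (w2 x) * (deriv m (w1 x))\<^sup>2"
      using \<kappa> by simp
    with e1 show ?thesis
      using \<phi>1(3)[OF zx] by simp
  qed
  have "moebius_germ p (Cpt \<circ> u1) (Cpt \<circ> u2)"
    by (rule schwarzian_zero_imp_moebius_germ[where f = k, OF u V(2) khol k kS])
  then show ?thesis
    unfolding u1_def u2_def .
qed

lemma deformed_data_moebius:
  assumes T: "T \<in> complex_structures A F" and P: "P \<in> compatible_structures A F T"
    and \<kappa>: "\<kappa> \<noteq> 0" and q: "q \<in> H0_K2 A F T"
  shows "transverse_data A F cp1_moebius_on (deformed_data F T \<kappa> P q)"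
proof (rule moebius_dataI)
  fix U \<sigma> assume "(U, \<sigma>) \<in> deformed_data F T \<kappa> P q"
  then obtain w \<phi> where d: "deformed_chart F T \<kappa> P q U w \<phi>" "\<sigma> = Cpt \<circ> (\<lambda>x. \<phi> (w x))"
    unfolding deformed_data_def by blast
  show "submersion_chart A F U \<sigma>"
    by (rule chart_of_submersion[OF deformed_chart_submersion(2)[OF compatible_projective[OF P] d(1)]])
       (simp add: d(2))
next
  fix p
  obtain C w \<phi> where "p \<in> C" "deformed_chart F T \<kappa> P q C w \<phi>"
    by (rule deformed_chart_cover[OF T P \<kappa> q]) (rule that)
  then show "\<exists>U \<sigma>. (U, \<sigma>) \<in> deformed_data F T \<kappa> P q \<and> p \<in> U"
    unfolding deformed_data_def by blast
next
  fix U \<sigma> V \<tau> p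
  assume ch: "(U, \<sigma>) \<in> deformed_data F T \<kappa> P q" "(V, \<tau>) \<in> deformed_data F T \<kappa> P q" and p: "p \<in> U \<inter> V"
  obtain w \<phi> where d: "deformed_chart F T \<kappa> P q U w \<phi>" "\<sigma> = Cpt \<circ> (\<lambda>x. \<phi> (w x))"
    using ch(1) unfolding deformed_data_def by blast
  obtain w' \<phi>' where d': "deformed_chart F T \<kappa> P q V w' \<phi>'" "\<tau> = Cpt \<circ> (\<lambda>x. \<phi>' (w' x))"
    using ch(2) unfolding deformed_data_def by blast
  show "moebius_germ p \<sigma> \<tau>"
    unfolding d(2) d'(2) by (rule deformed_charts_moebius[OF T P \<kappa> d(1) _ d'(1)]) (use p in auto)
qed

definition finite_charts :: "'m tdata set \<Rightarrow> 'm tdata" where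
  "finite_charts P = {(W, Cpt \<circ> w) | W w. (W, Cpt \<circ> w) \<in> \<Union>P}"

lemma finite_charts_in:
  assumes P: "P \<in> projective_structures A F"
  shows "transverse_data A F cp1_moebius_on (finite_charts P)" "finite_charts P \<in> P"
proof -
  have sub: "finite_charts P \<subseteq> \<Union>P"
    unfolding finite_charts_def by blast
  show 1: "transverse_data A F cp1_moebius_on (finite_charts P)"
  proof (rule moebius_dataI)
    show "submersion_chart A F U \<sigma>" if "(U, \<sigma>) \<in> finite_charts P" for U \<sigma>
      by (rule structure_chart[OF P]) (use that sub in blast)
    show "\<exists>U \<sigma>. (U, \<sigma>) \<in> finite_charts P \<and> p \<in> U" for p
      by (rule projective_finite_cover[OF P, of p]) (auto simp: finite_charts_def)
    show "moebius_germ p \<sigma> \<tau>"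
      if "(U, \<sigma>) \<in> finite_charts P" "(V, \<tau>) \<in> finite_charts P" "p \<in> U \<inter> V" for U \<sigma> V \<tau> p
      by (rule projective_germ[OF P _ _ that(3)]) (use that sub in blast)+
  qed
  show "finite_charts P \<in> P"
    by (rule projective_memI[OF P 1 sub])
qed

lemma finite_transition_on_component:
  assumes P: "P \<in> projective_structures A F"
    and w: "(W, Cpt \<circ> w) \<in> \<Union>P" and w': "(W', Cpt \<circ> w') \<in> \<Union>P" and K: "K \<in> components (W \<inter> W')"
  obtains t where "t holomorphic_on (w ` K)" "\<And>x. x \<in> K \<Longrightarrow> w' x = t (w x)"
proof -
  have "(W, Cpt \<circ> w) \<in> finite_charts P" "(W', Cpt \<circ> w') \<in> finite_charts P"
    unfolding finite_charts_def using w w' by blast+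
  then obtain f where f: "cp1_moebius_on f ((Cpt \<circ> w) ` K)" "\<forall>x\<in>K. f ((Cpt \<circ> w) x) = (Cpt \<circ> w') x"
    using finite_charts_in(1)[OF P] K unfolding transverse_data_iff by blast
  have "cp1_holomorphic_on f ((Cpt \<circ> w) ` K)"
    by (rule moebius_on_imp_holomorphic_on[OF f(1)])
  then have "(affine_coord \<circ> f \<circ> Cpt) holomorphic_on
      (affine_coord ` {z \<in> (Cpt \<circ> w) ` K \<inter> - {Infty}. f z \<in> - {Infty}})"
    using affine_chart_in unfolding cp1_holomorphic_on_def chart_inv_affine[symmetric] by fastforce
  moreover have "w ` K \<subseteq> affine_coord ` {z \<in> (Cpt \<circ> w) ` K \<inter> - {Infty}. f z \<in> - {Infty}}"
  proof
    fix y assume "y \<in> w ` K"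
    then obtain x where x: "x \<in> K" "y = w x"
      by blast
    show "y \<in> affine_coord ` {z \<in> (Cpt \<circ> w) ` K \<inter> - {Infty}. f z \<in> - {Infty}}"
      by (rule image_eqI[of _ _ "Cpt (w x)"]) (use x f(2) in auto)
  qed
  ultimately have "(affine_coord \<circ> f \<circ> Cpt) holomorphic_on (w ` K)"
    by (rule holomorphic_on_subset)
  then show ?thesis
    by (rule that) (use f(2) in simp)
qed

lemma holomorphic_transition_Cpt:
  assumes "open (v ` K)" "t holomorphic_on (v ` K)" "\<And>x. x \<in> K \<Longrightarrow> u x = t (v x)"
  shows "\<exists>f. cp1_holomorphic_on f ((Cpt \<circ> v) ` K) \<and> (\<forall>x\<in>K. f ((Cpt \<circ> v) x) = (Cpt \<circ> u) x)"
proof (intro exI conjI)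
  show "cp1_holomorphic_on (\<lambda>z. Cpt (t (affine_coord z))) ((Cpt \<circ> v) ` K)"
    unfolding image_comp[symmetric] by (rule cp1_holomorphic_Cpt[OF assms(1,2)])
qed (use assms(3) in simp)

text \<open>It suffices to exhibit one datum of \<open>T\<close> whose union with the new data is again a holomorphic datum. The
  finite-valued charts of \<open>P\<close> serve for this, the transition maps to them being built from the functions \<open>\<phi>\<close>,
  which are injective, and from transition functions of \<open>P\<close>.\<close>

lemma deformed_data_compatible:
  assumes T: "T \<in> complex_structures A F" and P: "P \<in> compatible_structures A F T"
    and \<kappa>: "\<kappa> \<noteq> 0" and q: "q \<in> H0_K2 A F T"
  shows "deformed_data F T \<kappa> P q \<in> T"
proof -
  note pP = compatible_projective[OF P]
  let ?D = "finite_charts P" and ?E = "deformed_data F T \<kappa> P q"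
  have D: "?D \<in> T"
    using finite_charts_in(2)[OF pP] compatible_iff(2)[OF T pP] P by blast
  have hD: "transverse_data A F cp1_holomorphic_on ?D" and hE: "transverse_data A F cp1_holomorphic_on ?E"
    using transverse_data_mono[where G = cp1_moebius_on and H = cp1_holomorphic_on, OF moebius_on_imp_holomorphic_on]
      finite_charts_in(1)[OF pP] deformed_data_moebius[OF T P \<kappa> q] by blast+
  have mixed: "(\<exists>f. cp1_holomorphic_on f (\<sigma> ` K) \<and> (\<forall>x\<in>K. f (\<sigma> x) = \<tau> x)) \<and>
      (\<exists>f. cp1_holomorphic_on f (\<tau> ` K) \<and> (\<forall>x\<in>K. f (\<tau> x) = \<sigma> x))"
    if ch: "(U, \<sigma>) \<in> ?D" "(V, \<tau>) \<in> ?E" and K: "K \<in> components (U \<inter> V)" for U \<sigma> V \<tau> K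
  proof -
    obtain w where w: "(U, Cpt \<circ> w) \<in> \<Union>P" "\<sigma> = Cpt \<circ> w"
      using ch(1) unfolding finite_charts_def by blast
    obtain w1 \<phi> where d: "deformed_chart F T \<kappa> P q V w1 \<phi>" "\<tau> = Cpt \<circ> (\<lambda>x. \<phi> (w1 x))"
      using ch(2) unfolding deformed_data_def by blast
    have w1: "(V, Cpt \<circ> w1) \<in> \<Union>P" and \<phi>: "\<phi> holomorphic_on (w1 ` V)" "inj_on \<phi> (w1 ` V)"
      using d(1) unfolding deformed_chart_def by blast+
    note sw = projective_submersion[OF pP w(1)] and s1 = deformed_chart_submersion[OF pP d(1)]
    have oUV: "open (U \<inter> V)"
      using submersion_open[OF sw] submersion_open[OF s1(1)] by (rule open_Int)
    have oK: "open K"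
      by (rule open_component[OF oUV K])
    have KU: "K \<subseteq> U" and KV: "K \<subseteq> V"
      using in_components_subset[OF K] by auto
    obtain t where t: "t holomorphic_on (w ` K)" "\<And>x. x \<in> K \<Longrightarrow> w1 x = t (w x)"
      by (rule finite_transition_on_component[OF pP w(1) w1 K]) (rule that)
    have K': "K \<in> components (V \<inter> U)"
      using K by (simp add: Int_commute)
    obtain s where s: "s holomorphic_on (w1 ` K)" "\<And>x. x \<in> K \<Longrightarrow> w x = s (w1 x)"
      by (rule finite_transition_on_component[OF pP w1 w(1) K']) (rule that)
    obtain g where g: "g holomorphic_on \<phi> ` w1 ` V" "\<And>z. z \<in> w1 ` V \<Longrightarrow> g (\<phi> z) = z"
      using holomorphic_has_inverse[OF \<phi>(1) s1(3) \<phi>(2)] by metis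
    have "(\<phi> \<circ> t) holomorphic_on (w ` K)"
    proof (rule holomorphic_on_compose_gen[OF t(1) \<phi>(1)])
      show "t ` w ` K \<subseteq> w1 ` V"
        using t(2) KV by force
    qed
    then have 1: "\<exists>f. cp1_holomorphic_on f ((Cpt \<circ> w) ` K) \<and>
        (\<forall>x\<in>K. f ((Cpt \<circ> w) x) = (Cpt \<circ> (\<lambda>x. \<phi> (w1 x))) x)"
      by (rule holomorphic_transition_Cpt[OF submersion_open_map[OF sw oK KU]]) (use t(2) in simp)
    have img: "(\<lambda>x. \<phi> (w1 x)) ` K \<subseteq> \<phi> ` w1 ` V"
      using KV by auto
    have "(s \<circ> g) holomorphic_on ((\<lambda>x. \<phi> (w1 x)) ` K)"
    proof (rule holomorphic_on_compose_gen[OF holomorphic_on_subset[OF g(1) img] s(1)])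
      show "g ` (\<lambda>x. \<phi> (w1 x)) ` K \<subseteq> w1 ` K"
        using g(2) KV by force
    qed
    then have 2: "\<exists>f. cp1_holomorphic_on f ((Cpt \<circ> (\<lambda>x. \<phi> (w1 x))) ` K) \<and>
        (\<forall>x\<in>K. f ((Cpt \<circ> (\<lambda>x. \<phi> (w1 x))) x) = (Cpt \<circ> w) x)"
      by (rule holomorphic_transition_Cpt[OF submersion_open_map[OF s1(2) oK KV]])
         (use s(2) g(2) KV in auto)
    show ?thesis
      unfolding w(2) d(2) using 1 2 by (rule conjI)
  qed
  have "transverse_data A F cp1_holomorphic_on (?D \<union> ?E)"
  proof -
    have trans: "\<exists>f. cp1_holomorphic_on f (\<sigma> ` K) \<and> (\<forall>x\<in>K. f (\<sigma> x) = \<tau> x)"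
      if ch: "(U, \<sigma>) \<in> ?D \<union> ?E" "(V, \<tau>) \<in> ?D \<union> ?E" and K: "K \<in> components (U \<inter> V)" for U \<sigma> V \<tau> K
    proof -
      consider "(U, \<sigma>) \<in> ?D" "(V, \<tau>) \<in> ?D" | "(U, \<sigma>) \<in> ?E" "(V, \<tau>) \<in> ?E"
        | "(U, \<sigma>) \<in> ?D" "(V, \<tau>) \<in> ?E" | "(U, \<sigma>) \<in> ?E" "(V, \<tau>) \<in> ?D"
        using ch by blast
      then show ?thesis
      proof cases
        case 1
        then show ?thesis
          using hD K unfolding transverse_data_iff by blast
      next
        case 2
        then show ?thesis
          using hE K unfolding transverse_data_iff by blast
      next
        case 3
        then show ?thesis
          using mixed[OF 3 K] by blast
      next
        case 4
        have "K \<in> components (V \<inter> U)"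
          using K by (simp add: Int_commute)
        then show ?thesis
          using mixed[OF 4(2,1)] by blast
      qed
    qed
    have cover: "(\<Union>(U, \<sigma>)\<in>?D \<union> ?E. U) = UNIV"
      using hD unfolding transverse_data_iff by blast
    have charts: "submersion_chart A F U \<sigma>" if "(U, \<sigma>) \<in> ?D \<union> ?E" for U \<sigma>
      using that transverse_data_chart[OF hD] transverse_data_chart[OF hE] by blast
    show ?thesis
      unfolding transverse_data_iff
    proof (intro conjI ballI case_prodI2)
      show "submersion_chart A F U \<sigma>" if "s \<in> ?D \<union> ?E" "s = (U, \<sigma>)" for s U \<sigma>
        using that charts by simp
      show "\<exists>f. cp1_holomorphic_on f (\<sigma> ` K) \<and> (\<forall>x\<in>K. f (\<sigma> x) = \<tau> x)"
        if "s \<in> ?D \<union> ?E" "s = (U, \<sigma>)" "s' \<in> ?D \<union> ?E" "s' = (V, \<tau>)" "K \<in> components (U \<inter> V)"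
        for s U \<sigma> s' V \<tau> K
        by (rule trans[of U \<sigma> V \<tau>]) (use that in simp_all)
    qed (rule cover)
  qed
  then show ?thesis
    by (rule structure_memI[OF T D hE])
qed

lemma deformation_exists:
  assumes T: "T \<in> complex_structures A F" and P: "P \<in> compatible_structures A F T"
    and \<kappa>: "\<kappa> \<noteq> 0" and q: "q \<in> H0_K2 A F T"
  obtains P' where "P' \<in> compatible_structures A F T" "structure_difference A F T \<kappa> P' P q"
proof -
  let ?E = "deformed_data F T \<kappa> P q"
  define P' where "P' = transverse_equiv A F cp1_moebius_on `` {?E}"
  note data = deformed_data_moebius[OF T P \<kappa> q]
  have P': "P' \<in> projective_structures A F" "?E \<in> P'"
    unfolding P'_def by (rule structure_of_data[OF data])+
  have comp: "P' \<in> compatible_structures A F T"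
    using compatible_iff(1)[OF T P'(1)] P'(2) deformed_data_compatible[OF T P \<kappa> q] by blast
  have "structure_difference A F T \<kappa> P' P q"
    unfolding structure_difference_iff[OF T P comp H0_K2_fibre[OF q]]
  proof (intro allI impI ballI)
    fix W w w' f p assume c: "coordinate_pair P P' W w w' f" and p: "p \<in> W"
    obtain C w1 \<phi> where d: "p \<in> C" "deformed_chart F T \<kappa> P q C w1 \<phi>"
      by (rule deformed_chart_cover[OF T P \<kappa> q]) (rule that)
    have "(C, Cpt \<circ> (\<lambda>x. \<phi> (w1 x))) \<in> \<Union>P'"
      using P'(2) d(2) unfolding deformed_data_def by blast
    then have pair: "coordinate_pair P P' C w1 (\<lambda>x. \<phi> (w1 x)) \<phi>"
      using d(2) unfolding coordinate_pair_def deformed_chart_def by blast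
    have "q p = dz_square F T w1 p (\<kappa> * schwarzian \<phi> (w1 p))"
      using d unfolding deformed_chart_def by blast
    also have "\<dots> = dz_square F T w p (\<kappa> * schwarzian f (w p))"
      by (rule dz_square_pair_change[OF T P comp c p pair d(1)])
    finally show "q p = dz_square F T w p (\<kappa> * schwarzian f (w p))" .
  qed
  with comp show ?thesis
    by (rule that)
qed

text \<open>If \<open>r\<close> is the difference of the two candidates, then \<open>q + r = q\<close> by additivity.\<close>

lemma deformation_unique:
  assumes T: "T \<in> complex_structures A F" and \<kappa>: "\<kappa> \<noteq> 0" and P: "P \<in> compatible_structures A F T"
    and q: "q \<in> H0_K2 A F T"
    and 1: "P1 \<in> compatible_structures A F T" "structure_difference A F T \<kappa> P1 P q"
    and 2: "P2 \<in> compatible_structures A F T" "structure_difference A F T \<kappa> P2 P q"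
  shows "P1 = P2"
proof -
  obtain r where r: "r \<in> H0_K2 A F T" "structure_difference A F T \<kappa> P2 P1 r"
    by (rule difference_exists[OF T 1(1) 2(1)]) (rule that)
  have "structure_difference A F T \<kappa> P2 P (q + r)"
    by (rule difference_add[OF T P 1(1) 2(1) q 1(2) r])
  then have "q + r = q"
    by (rule difference_unique[OF T P 2(1) H0_K2_add[OF T P q r(1)] _ q 2(2)])
  then have "r = 0"
    by simp
  then show ?thesis
    using difference_zero_imp_eq[OF T \<kappa> 1(1) 2(1)] r(2) by simp
qed

end

section \<open>The affine structure\<close>

theorem proposition6p2:
  fixes A :: "('m::{t2_space, second_countable_topology}, 'e::euclidean_space) chart set"
    and F :: "'m \<Rightarrow> 'e set" and d :: nat and T :: "'m tdata set" and \<kappa> :: complex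
  assumes "connected (UNIV :: 'm set)" and "smooth_atlas A" and "DIM('e) = d + 2"
    and "smooth_subbundle A d F" and "integrable_subbundle A F"
    and "T \<in> complex_structures A F"
    and "compatible_structures A F T \<noteq> {}"
    and "\<kappa> \<noteq> 0"
  shows "ksection.subspace (H0_K2 A F T) \<and>
    (\<exists>act. affine_space_for (H0_K2 A F T) act (compatible_structures A F T) \<and>
       (\<forall>q\<in>H0_K2 A F T. \<forall>P\<in>compatible_structures A F T. \<forall>P'\<in>compatible_structures A F T.
          act q P = P' \<longleftrightarrow> structure_difference A F T \<kappa> P' P q))"
proof
  interpret smooth_manifold A
    by (rule smooth_manifold.intro) (rule assms(2))
  note T = assms(6) and \<kappa> = assms(8)
  let ?V = "H0_K2 A F T" and ?S = "compatible_structures A F T"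
  obtain P0 where P0: "P0 \<in> ?S"
    using assms(7) by blast
  have zero: "0 \<in> ?V" and add: "\<And>u v. u \<in> ?V \<Longrightarrow> v \<in> ?V \<Longrightarrow> u + v \<in> ?V"
    by (rule zero_in_H0_K2[OF T P0], rule H0_K2_add[OF T P0])
  show "ksection.subspace ?V"
    unfolding ksection.subspace_def
    using zero add H0_K2_scale[OF T P0] by (intro conjI ballI allI)
  define act where "act = (\<lambda>q P. SOME P'. P' \<in> ?S \<and> structure_difference A F T \<kappa> P' P q)"
  have act: "act q P \<in> ?S" "structure_difference A F T \<kappa> (act q P) P q" if h: "q \<in> ?V" "P \<in> ?S" for q P
  proof -
    have "\<exists>P'. P' \<in> ?S \<and> structure_difference A F T \<kappa> P' P q"
      by (rule deformation_exists[OF T h(2) \<kappa> h(1)]) blast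
    from someI_ex[OF this] show "act q P \<in> ?S" "structure_difference A F T \<kappa> (act q P) P q"
      unfolding act_def by auto
  qed
  have act_iff: "act q P = P' \<longleftrightarrow> structure_difference A F T \<kappa> P' P q"
    if h: "q \<in> ?V" "P \<in> ?S" "P' \<in> ?S" for q P P'
    using act[OF h(1,2)] deformation_unique[OF T \<kappa> h(2,1) act[OF h(1,2)] h(3)] by blast
  have "affine_space_for ?V act ?S"
    unfolding affine_space_for_def
  proof (intro conjI ballI impI)
    show "?S \<noteq> {}"
      by (rule assms(7))
    show "act v s \<in> ?S" if h: "v \<in> ?V" "s \<in> ?S" for v s
      by (rule act(1)[OF h])
    show "act 0 s = s" if s: "s \<in> ?S" for s
      unfolding act_iff[OF zero s s] by (rule difference_refl[OF T s])
    show "act (u + v) s = act u (act v s)" if h: "u \<in> ?V" "v \<in> ?V" "s \<in> ?S" for u v s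
    proof -
      note s1 = act[OF h(2,3)] and s2 = act[OF h(1) act(1)[OF h(2,3)]]
      have "structure_difference A F T \<kappa> (act u (act v s)) s (v + u)"
        by (rule difference_add[OF T h(3) s1(1) s2(1) h(2) s1(2) h(1) s2(2)])
      then show ?thesis
        unfolding act_iff[OF add[OF h(1,2)] h(3) s2(1)] by (simp add: add.commute)
    qed
    show "v = 0" if h: "v \<in> ?V" "s \<in> ?S" "act v s = s" for v s
    proof -
      have "structure_difference A F T \<kappa> s s v"
        using h(3) unfolding act_iff[OF h(1,2,2)] .
      then show ?thesis
        by (rule difference_unique[OF T h(2,2,1) _ zero difference_refl[OF T h(2)]])
    qed
    show "\<exists>v\<in>?V. act v s = t" if h: "s \<in> ?S" "t \<in> ?S" for s t
    proof -
      obtain v where v: "v \<in> ?V" "structure_difference A F T \<kappa> t s v"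
        by (rule difference_exists[OF T h]) (rule that)
      then show ?thesis
        using act_iff[OF v(1) h] by blast
    qed
  qed
  then show "\<exists>act. affine_space_for ?V act ?S \<and>
      (\<forall>q\<in>?V. \<forall>P\<in>?S. \<forall>P'\<in>?S. act q P = P' \<longleftrightarrow> structure_difference A F T \<kappa> P' P q)"
    using act_iff by blast
qed

end
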